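(* Let $f:\mathbb{R}^n\to\mathbb{R}$ be locally Lipschitz continuous, $D_f:\mathbb{R}^n\rightrightarrows\mathbb{R}^n$ a set-valued mapping, $\varphi:\mathbb{R}^n\to\mathbb{R}$ a function, $\{\eta_k\},\{\theta_k\}$ positive sequences, and $\{\delta_k\},\{\nu_k\}$ nonnegative sequences. Let $\{(x_k,m_k)\}$ be generated by the momentum based stochastic Bregman subgradient method (MSBG): for each $k\ge0$, $x_{k+1}$ is a $\nu_k$-optimal solution of $$\min_{x\in\mathbb{R}^n}\left\{\langle m_k,x-x_k\rangle+\frac1{\eta_k}\mathcal{D}_\varphi(x,x_k)\right\},\quad\text{i.e.}\quad\left\|m_k+\frac1{\eta_k}(\nabla\varphi(x_{k+1})-\nabla\varphi(x_k))\right\|\le\nu_k,$$ and $$m_{k+1}=m_k-\theta_kP(x_k)(m_k-g_k),$$ where $g_k=d_k+\xi_k$, $d_k\in D_f^{\delta_k}(x_k)$ and $\xi_k$ is stochastic noise. Suppose that: (1) $\varphi\in\mathcal{C}^2(\mathbb{R}^n)$ is a supercoercive Legendre kernel function over $\mathbb{R}^n$, $\nabla^2\varphi(\cdot)$ is positive definite everywhere, and $P(\cdot)=(\nabla^2\varphi(\cdot))^{-1}$; (2) $\{x_k\}$, $\{\nabla\varphi(x_k)\}$, $\{d_k\}$ and $\{m_k\}$ are uniformly bounded almost surely; (3) $\{\xi_k\}$ is a martingale difference noise, i.e. $\mathbb{E}[\xi_{k+1}|\mathcal{F}_k]=0$ almost surely, $\sum_{k=0}^\infty\eta_k=\infty$,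 and one of the following holds: (a) $\{\xi_k\}$ is uniformly bounded and $\eta_k=o(1/\log k)$; (b) $\mathbb{E}[\|\xi_{k+1}\|^2|\mathcal{F}_k]\le\sigma^2<\infty$ and $\sum_{k=0}^\infty\eta_k^2<\infty$; (4) $\lim_{k\to\infty}\delta_k=0$ and $\lim_{k\to\infty}\nu_k=0$; (5) there exists $\tau>0$ such that $\lim_{k\to\infty}\theta_k/\eta_k=\tau$; (6) $f$ is bounded below and $D_f$ is a convex-valued conservative field for $f$; (7) the critical value set $\{f(x):0\in D_f(x)\}$ has empty interior in $\mathbb{R}$. Then, almost surely, any cluster point $x^*$ of $\{x_k\}$ is a $D_f$-stationary point of $f$ (i.e. $0\in D_f(x^* )$), $\lim_{k\to\infty}m_k=0$, and the function values $\{f(x_k)\}$ converge.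
   Context: $(\Omega,\mathcal{F},\mathbb{P})$ is a probability space and $\mathcal{F}_k=\sigma(\xi_0,\ldots,\xi_k)$. The Bregman distance is $\mathcal{D}_\varphi(x,y)=\varphi(x)-\varphi(y)-\langle\nabla\varphi(y),x-y\rangle$. A Legendre kernel function over $\mathbb{R}^n$ is a strictly convex $\varphi\in\mathcal{C}^1(\mathbb{R}^n)$ such that $\|\nabla\varphi(u_k)\|\to\infty$ whenever $\|u_k\|\to\infty$; it is supercoercive if $\lim_{\|u\|\to\infty}\varphi(u)/\|u\|=\infty$. A $\nu$-optimal solution of $\min_x g(x)$, $g$ convex, is a point $x$ with $\mathrm{dist}(0,\partial g(x))\le\nu$. For a set-valued mapping $S:\mathbb{R}^n\rightrightarrows\mathbb{R}^n$ and $\delta\ge0$, $S^\delta(x)=\bigcup_{\|y-x\|\le\delta}(S(y)+\delta\mathbb{B}^n)$, $\mathbb{B}^n$ the unit ball. A conservative field for a locally Lipschitz $f$ is a nonempty-closed-valued, closed-graph mapping $D_f:\mathbb{R}^n\rightrightarrows\mathbb{R}^n$ such that for every absolutely continuous $\gamma:[0,1]\to\mathbb{R}^n$, $\frac{d}{dt}(f\circ\gamma)(t)=\langle v,\dot\gamma(t)\rangle$ for all $v\in D_f(\gamma(t))$ and almost all $t\in[0,1]$. *)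

theory Defs
  imports "HOL-Probability.Probability" "HOL-Library.Landau_Symbols"
begin

section \<open>Smooth functions and Legendre kernels\<close>

definition grad :: "('a::real_inner \<Rightarrow> real) \<Rightarrow> 'a \<Rightarrow> 'a" where
  "grad \<phi> x = (THE D. GDERIV \<phi> x :> D)"

definition hessian :: "(real^'n \<Rightarrow> real) \<Rightarrow> real^'n \<Rightarrow> real^'n^'n" where
  "hessian \<phi> x = jacobian (grad \<phi>) (at x)"

definition C1_fun :: "('a::real_inner \<Rightarrow> real) \<Rightarrow> bool" where
  "C1_fun \<phi> \<longleftrightarrow> (\<forall>x. \<exists>D. GDERIV \<phi> x :> D) \<and> continuous_on UNIV (grad \<phi>)"

definition C2_fun :: "(real^'n \<Rightarrow> real) \<Rightarrow> bool" where
  "C2_fun \<phi> \<longleftrightarrow> C1_fun \<phi> \<and> (\<forall>x. grad \<phi> differentiable (at x)) \<and>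
     continuous_on UNIV (hessian \<phi>)"

definition positive_definite :: "real^'n^'n \<Rightarrow> bool" where
  "positive_definite A \<longleftrightarrow> transpose A = A \<and> (\<forall>h. h \<noteq> 0 \<longrightarrow> h \<bullet> (A *v h) > 0)"

definition strictly_convex :: "('a::real_vector \<Rightarrow> real) \<Rightarrow> bool" where
  "strictly_convex \<phi> \<longleftrightarrow>
     (\<forall>x y t. x \<noteq> y \<longrightarrow> 0 < t \<longrightarrow> t < 1 \<longrightarrow>
        \<phi> ((1 - t) *\<^sub>R x + t *\<^sub>R y) < (1 - t) * \<phi> x + t * \<phi> y)"

definition legendre_kernel :: "('a::real_inner \<Rightarrow> real) \<Rightarrow> bool" where
  "legendre_kernel \<phi> \<longleftrightarrow> strictly_convex \<phi> \<and> C1_fun \<phi> \<and>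
     (\<forall>u :: nat \<Rightarrow> 'a. filterlim (\<lambda>k. norm (u k)) at_top sequentially \<longrightarrow>
        filterlim (\<lambda>k. norm (grad \<phi> (u k))) at_top sequentially)"

definition supercoercive :: "('a::real_normed_vector \<Rightarrow> real) \<Rightarrow> bool" where
  "supercoercive \<phi> \<longleftrightarrow> filterlim (\<lambda>u. \<phi> u / norm u) at_top at_infinity"

definition bregman :: "('a::real_inner \<Rightarrow> real) \<Rightarrow> 'a \<Rightarrow> 'a \<Rightarrow> real" where
  "bregman \<phi> x y = \<phi> x - \<phi> y - grad \<phi> y \<bullet> (x - y)"

section \<open>Approximate minimizers of convex functions\<close>

definition subdifferential :: "('a::real_inner \<Rightarrow> real) \<Rightarrow> 'a \<Rightarrow> 'a set" where
  "subdifferential g x = {v. \<forall>y. g y \<ge> g x + v \<bullet> (y - x)}"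

text \<open>The library sets \<open>infdist a {} = 0\<close>, whereas here the distance to the empty set is infinite.\<close>

definition nu_optimal :: "real \<Rightarrow> ('a::real_inner \<Rightarrow> real) \<Rightarrow> 'a \<Rightarrow> bool" where
  "nu_optimal \<nu> g x \<longleftrightarrow> subdifferential g x \<noteq> {} \<and> infdist 0 (subdifferential g x) \<le> \<nu>"

lemma GDERIV_grad: "C1_fun \<phi> \<Longrightarrow> GDERIV \<phi> x :> grad \<phi> x"
proof -
  assume "C1_fun \<phi>"
  then obtain D where D: "GDERIV \<phi> x :> D" unfolding C1_fun_def by blast
  have "E = D" if "GDERIV \<phi> x :> E" for E
  proof -
    have "(\<lambda>h. h \<bullet> E) = (\<lambda>h. h \<bullet> D)"
      using that D has_derivative_unique unfolding gderiv_def by blast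
    then have "h \<bullet> E = h \<bullet> D" for h by (rule fun_cong)
    then have "(E - D) \<bullet> (E - D) = 0" by (simp add: inner_diff_right)
    then show ?thesis by simp
  qed
  with D show ?thesis unfolding grad_def by (rule theI[where P="gderiv \<phi> x"])
qed

lemma subdifferential_subset:
  assumes "GDERIV g x :> D"
  shows "subdifferential g x \<subseteq> {D}"
proof
  fix v assume v: "v \<in> subdifferential g x"
  have "((\<lambda>y. g y - v \<bullet> (y - x)) has_derivative (\<lambda>h. h \<bullet> D - v \<bullet> h)) (at x)"
    using assms unfolding gderiv_def by (auto intro!: derivative_eq_intros)
  then have "(\<lambda>h. h \<bullet> D - v \<bullet> h) = (\<lambda>h. 0)"
    by (rule has_derivative_local_min) (use v in \<open>simp add: subdifferential_def algebra_simps\<close>)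
  then have "h \<bullet> D - v \<bullet> h = 0" for h by (rule fun_cong)
  then have "(D - v) \<bullet> (D - v) = 0"
    by (metis inner_commute inner_diff_right)
  then show "v \<in> {D}" by simp
qed

lemma convex_gradient_ineq:
  assumes "strictly_convex \<phi>" "C1_fun \<phi>"
  shows "\<phi> x + grad \<phi> x \<bullet> (y - x) \<le> \<phi> y"
proof (cases "y = x")
  case False
  define q where "q t = \<phi> (x + t *\<^sub>R (y - x))" for t :: real
  have q: "(q has_real_derivative grad \<phi> x \<bullet> (y - x)) (at 0)"
  proof -
    have "((\<lambda>t. x + t *\<^sub>R (y - x)) has_derivative (\<lambda>t. t *\<^sub>R (y - x))) (at 0)"
      by (auto intro!: derivative_eq_intros)
    moreover have "(\<phi> has_derivative (\<lambda>h. h \<bullet> grad \<phi> x)) (at (x + 0 *\<^sub>R (y - x)))"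
      using GDERIV_grad[OF assms(2)] by (simp add: gderiv_def)
    ultimately have "(q has_derivative (\<lambda>t. (t *\<^sub>R (y - x)) \<bullet> grad \<phi> x)) (at 0)"
      unfolding q_def by (rule has_derivative_compose)
    then show ?thesis
      by (simp add: has_field_derivative_def inner_commute[of "y - x"] mult_commute_abs)
  qed
  then have "((\<lambda>t. (q t - q 0) / t) \<longlongrightarrow> grad \<phi> x \<bullet> (y - x)) (at_right 0)"
    by (auto simp: has_field_derivative_iff intro: filterlim_mono at_le)
  moreover have "eventually (\<lambda>t. (q t - q 0) / t \<le> \<phi> y - \<phi> x) (at_right 0)"
  proof -
    have "eventually (\<lambda>t::real. t \<in> {0<..<1}) (at_right 0)"
      by (rule eventually_at_right_real) simp
    then show ?thesis
    proof eventually_elim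
      case (elim t)
      have "\<phi> ((1 - t) *\<^sub>R x + t *\<^sub>R y) < (1 - t) * \<phi> x + t * \<phi> y"
        using assms(1) False elim unfolding strictly_convex_def by auto
      moreover have "(1 - t) *\<^sub>R x + t *\<^sub>R y = x + t *\<^sub>R (y - x)"
        by (simp add: algebra_simps)
      ultimately show ?case using elim by (simp add: q_def field_simps)
    qed
  qed
  ultimately have "grad \<phi> x \<bullet> (y - x) \<le> \<phi> y - \<phi> x"
    by (rule tendsto_upperbound) simp
  then show ?thesis by simp
qed simp

text \<open>The gradient form of the update of the iterates.\<close>

lemma nu_optimal_bregman_iff:
  assumes "strictly_convex \<phi>" "C1_fun \<phi>" "\<eta> > 0"
  shows "nu_optimal \<nu> (\<lambda>z. m \<bullet> (z - x) + 1 / \<eta> * bregman \<phi> z x) z \<longleftrightarrow>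
    norm (m + (1 / \<eta>) *\<^sub>R (grad \<phi> z - grad \<phi> x)) \<le> \<nu>"
proof -
  let ?g = "\<lambda>z. m \<bullet> (z - x) + 1 / \<eta> * bregman \<phi> z x"
  let ?D = "m + (1 / \<eta>) *\<^sub>R (grad \<phi> z - grad \<phi> x)"
  have "(\<phi> has_derivative (\<lambda>h. h \<bullet> grad \<phi> z)) (at z)"
    using GDERIV_grad[OF assms(2)] by (simp add: gderiv_def)
  then have "(?g has_derivative
      (\<lambda>h. m \<bullet> h + 1 / \<eta> * (h \<bullet> grad \<phi> z - grad \<phi> x \<bullet> h))) (at z)"
    unfolding bregman_def using assms(3) by (auto intro!: derivative_eq_intros)
  then have "GDERIV ?g z :> ?D"
    unfolding gderiv_def
    by (simp add: inner_add_right inner_diff_right inner_commute[of _ "grad \<phi> _"] inner_commute[of _ m])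
  then have "subdifferential ?g z \<subseteq> {?D}" by (rule subdifferential_subset)
  moreover have "?D \<in> subdifferential ?g z"
  proof -
    have "?g z + ?D \<bullet> (y - z) \<le> ?g y" for y
    proof -
      have "?g y - ?g z - ?D \<bullet> (y - z) = 1 / \<eta> * (\<phi> y - \<phi> z - grad \<phi> z \<bullet> (y - z))"
        unfolding bregman_def
        by (simp add: inner_add_left inner_diff_left inner_diff_right inner_add_right
            algebra_simps add_divide_distrib diff_divide_distrib)
      also have "\<dots> \<ge> 0"
        using convex_gradient_ineq[OF assms(1,2), of z y] assms(3) by simp
      finally show ?thesis by linarith
    qed
    then show ?thesis by (simp add: subdifferential_def)
  qed
  ultimately have "subdifferential ?g z = {?D}" by blast
  then show ?thesis by (simp add: nu_optimal_def)
qed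

section \<open>Conservative fields\<close>

definition locally_lipschitz :: "('a::metric_space \<Rightarrow> 'b::metric_space) \<Rightarrow> bool" where
  "locally_lipschitz f \<longleftrightarrow> (\<forall>x. \<exists>e>0. \<exists>L. L-lipschitz_on (ball x e) f)"

text \<open>The intervals \<open>(u i, v i)\<close> form a finite pairwise disjoint family, some possibly degenerate.\<close>

definition abs_cont_on :: "real \<Rightarrow> real \<Rightarrow> (real \<Rightarrow> 'a::real_normed_vector) \<Rightarrow> bool" where
  "abs_cont_on a b \<gamma> \<longleftrightarrow>
     (\<forall>\<epsilon>>0. \<exists>\<delta>>0. \<forall>(n::nat) u v.
        (\<forall>i<n. a \<le> u i \<and> u i \<le> v i \<and> v i \<le> b) \<longrightarrow>
        (\<forall>i<n. \<forall>j<n. i \<noteq> j \<longrightarrow> {u i<..<v i} \<inter> {u j<..<v j} = {}) \<longrightarrow>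
        (\<Sum>i<n. v i - u i) < \<delta> \<longrightarrow>
        (\<Sum>i<n. norm (\<gamma> (v i) - \<gamma> (u i))) < \<epsilon>)"

definition conservative_field ::
    "('a::euclidean_space \<Rightarrow> real) \<Rightarrow> ('a \<Rightarrow> 'a set) \<Rightarrow> bool" where
  "conservative_field f D \<longleftrightarrow>
     (\<forall>x. D x \<noteq> {} \<and> closed (D x)) \<and> closed {(x, v). v \<in> D x} \<and>
     (\<forall>\<gamma>. abs_cont_on 0 1 \<gamma> \<longrightarrow>
        (AE t in lebesgue_on {0..1}. \<exists>\<gamma>'.
           (\<gamma> has_vector_derivative \<gamma>') (at t within {0..1}) \<and>
           (\<forall>v\<in>D (\<gamma> t). ((f \<circ> \<gamma>) has_real_derivative v \<bullet> \<gamma>') (at t within {0..1}))))"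

definition expansion ::
    "('a::real_normed_vector \<Rightarrow> 'a set) \<Rightarrow> real \<Rightarrow> 'a \<Rightarrow> 'a set" where
  "expansion S \<delta> x = (\<Union>y\<in>cball x \<delta>. {v + \<delta> *\<^sub>R b |v b. v \<in> S y \<and> b \<in> cball 0 1})"

section \<open>Martingale difference noise\<close>

definition natural_filtration ::
    "'w measure \<Rightarrow> (nat \<Rightarrow> 'w \<Rightarrow> 'a::topological_space) \<Rightarrow> nat \<Rightarrow> 'w measure" where
  "natural_filtration M \<xi> k =
     sigma (space M) {\<xi> i -` A \<inter> space M |i A. i \<le> k \<and> A \<in> sets borel}"

text \<open>The library has conditional expectations of real random variables only.\<close>

definition vec_cond_exp ::
    "'w measure \<Rightarrow> 'w measure \<Rightarrow> ('w \<Rightarrow> real^'n) \<Rightarrow> 'w \<Rightarrow> real^'n" where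
  "vec_cond_exp M F X \<omega> = (\<chi> i. real_cond_exp M F (\<lambda>\<omega>. X \<omega> $ i) \<omega>)"

text \<open>Integrability is part of the notion: for a non-integrable argument
  \<^const>\<open>real_cond_exp\<close> need not be a conditional expectation.\<close>

definition martingale_difference ::
    "'w measure \<Rightarrow> (nat \<Rightarrow> 'w \<Rightarrow> real^'n) \<Rightarrow> bool" where
  "martingale_difference M \<xi> \<longleftrightarrow>
     (\<forall>k. integrable M (\<xi> (Suc k)) \<and>
        (AE \<omega> in M. vec_cond_exp M (natural_filtration M \<xi> k) (\<xi> (Suc k)) \<omega> = 0))"

end

theory Submission
  imports Defs "HOL-Complex_Analysis.Great_Picard"
begin

text \<open>
  Write \<open>H\<close> for the Hessian of the kernel and \<open>E (x, m) = f x + \<bar>m\<bar>\<^sup>2 / (2 \<tau>)\<close>. In the time scale that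
  counts step \<open>k\<close> as an interval of length \<open>\<eta> k\<close>, the recursion is a perturbed Euler scheme for
  \<open>H(x) x' = - m\<close> and \<open>H(x) m' \<in> - \<tau> (m - D x)\<close>. Along a solution the chain rule of the conservative
  field and the symmetry of \<open>H\<close> give \<open>E' = - x' \<bullet> H(x) x'\<close>: energy is lost as long as \<open>m \<noteq> 0\<close>, and if
  \<open>m\<close> stays \<open>0\<close> then \<open>m' = 0\<close>, which forces \<open>0 \<in> D x\<close>. The theorem transfers this to the iterates.

  Probability enters only through two pathwise facts about the noise (\<open>noise_windows\<close>). On index
  windows of time length at most one, \<open>\<Sum> \<eta> k \<xi> k\<close> tends to zero, and \<open>\<Sum> \<eta> k \<bar>\<xi> k\<bar>\<close> is at most
  proportional to the length of the window, up to an error that tends to zero. For bounded noise the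
  first fact follows from an exponential maximal inequality and the Borel-Cantelli lemma, and the second
  one is immediate; for square integrable noise both follow from Kolmogorov's inequality. The second fact is there because the iterates need not be adapted to the
  filtration of the noise, so that \<open>P (x k) \<xi> k\<close> need not be a martingale difference. On a short window
  \<open>P (x k)\<close> is nearly constant; the first fact handles the constant matrix, the second one the
  remainder.

  For a fixed path, the iterates seen from later and later starting indices form step functions on the
  unit time interval that are Lipschitz up to a vanishing error, hence converge along a subsequence to a
  Lipschitz curve (\<open>asymptotically_lipschitz_limit\<close>). Where this curve is differentiable, averaging the
  increments over shrinking windows identifies its velocity (\<open>X_velocity\<close>, \<open>M_velocity\<close>); convexity
  and the closed graph of \<open>D\<close> keep the averages of \<open>d k\<close> near \<open>D\<close> at the limit point. Differentiability
  almost everywhere is contained in the definition of a conservative field, which may also be applied to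
  the momentum curve. A Lipschitz function whose derivative is at most \<open>c\<close> almost everywhere grows at
  most at rate \<open>c\<close>, so the energy of a limit curve does not increase, and it stays constant only if
  the curve starts at a stationary point (\<open>stationary_if_energy_constant\<close>).

  If the energies of the iterates did not converge, they would cross upwards, infinitely often, some
  level \<open>c\<close> that is not a critical value, as these have empty interior. Starting the windows where the
  path leaves the values below \<open>c\<close> for the last time before reaching a higher level, the limit curve has energy \<open>c\<close> initially,
  strictly less at time one, and never more in between, so the path would have to return below \<open>c\<close>
  first (\<open>energy_convergent\<close>). Once the energies converge, every limit curve has constant energy;
  hence every cluster point is stationary with zero momentum (\<open>path_conclusions\<close>).
\<close>

section \<open>Maximal inequalities for martingale differences\<close>

text \<open>Doob's maximal inequality. Decompose the event by the first index at which \<open>a\<close> is reached. Each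
  piece lies in the past of that index, so the integral of \<open>X\<close> over it does not decrease afterwards.\<close>

lemma (in prob_space) maximal_inequality:
  fixes X :: "nat \<Rightarrow> 'a \<Rightarrow> real" and F :: "nat \<Rightarrow> 'a measure"
  assumes sub: "\<And>k. subalgebra M (F k)"
    and filtr: "\<And>j k. j \<le> k \<Longrightarrow> sets (F j) \<subseteq> sets (F k)"
    and adapted: "\<And>k. X k \<in> borel_measurable (F k)"
    and int: "\<And>k. integrable M (X k)"
    and nonneg: "\<And>k \<omega>. 0 \<le> X k \<omega>"
    and step: "\<And>k A. A \<in> sets (F k) \<Longrightarrow>
      (\<integral>\<omega>. indicator A \<omega> * X k \<omega> \<partial>M) \<le> (\<integral>\<omega>. indicator A \<omega> * X (Suc k) \<omega> \<partial>M)"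
    and bound: "\<And>k. expectation (X k) \<le> B"
    and "a > 0"
  shows "prob {\<omega>\<in>space M. \<exists>k. a \<le> X k \<omega>} \<le> B / a"
proof -
  define A where "A k = {\<omega>\<in>space M. a \<le> X k \<omega> \<and> (\<forall>j<k. X j \<omega> < a)}" for k
  have space_F: "space (F k) = space M" for k
    using sub by (simp add: subalgebra_def)
  have adapted': "X j \<in> borel_measurable (F k)" if "j \<le> k" for j k
    using measurable_from_subalg[of "F k" "F j"] adapted filtr[OF that]
    by (auto simp: subalgebra_def space_F)
  have A_F: "A k \<in> sets (F k)" for k
  proof -
    have "A k = {\<omega>\<in>space (F k). a \<le> X k \<omega>} \<inter> (\<Inter>j\<in>{..<k}. {\<omega>\<in>space (F k). X j \<omega> < a}) \<inter> space (F k)"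
      by (auto simp: A_def space_F)
    moreover have "{\<omega>\<in>space (F k). a \<le> X k \<omega>} \<in> sets (F k)"
      using adapted[of k] by measurable
    moreover have "{\<omega>\<in>space (F k). X j \<omega> < a} \<in> sets (F k)" if "j \<in> {..<k}" for j
    proof -
      have [measurable]: "X j \<in> borel_measurable (F k)" using adapted'[of j k] that by simp
      show ?thesis by measurable
    qed
    ultimately show ?thesis by (cases "k = 0") (auto intro!: sets.Int sets.finite_INT)
  qed
  have A_M [measurable]: "A k \<in> sets M" for k
    using A_F sub by (auto simp: subalgebra_def)
  have int_ind: "integrable M (\<lambda>\<omega>. indicator C \<omega> * X n \<omega>)" if "C \<in> sets M" for C n
    using integrable_mult_indicator[OF that int, of n] by simp
  have later: "(\<integral>\<omega>. indicator (A k) \<omega> * X k \<omega> \<partial>M) \<le> (\<integral>\<omega>. indicator (A k) \<omega> * X n \<omega> \<partial>M)"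
    if "k \<le> n" for k n
    using that
  proof (induction n rule: dec_induct)
    case (step n)
    have "A k \<in> sets (F n)" using A_F filtr[OF step(1)] by auto
    from assms(6)[OF this] step.IH show ?case by simp
  qed simp
  have fin: "prob (\<Union>k\<le>n. A k) \<le> B / a" for n
  proof -
    have one: "a * prob (A k) \<le> (\<integral>\<omega>. indicator (A k) \<omega> * X n \<omega> \<partial>M)" if "k \<le> n" for k
    proof -
      have "a * prob (A k) = (\<integral>\<omega>. indicator (A k) \<omega> * a \<partial>M)"
        by simp
      also have "\<dots> \<le> (\<integral>\<omega>. indicator (A k) \<omega> * X k \<omega> \<partial>M)"
      proof (intro integral_mono int_ind A_M)
        show "integrable M (\<lambda>\<omega>. indicator (A k) \<omega> * a)"
          by (intro integrable_mult_left integrable_real_indicator) (simp_all add: emeasure_eq_measure)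
      qed (auto simp: A_def indicator_def)
      also have "\<dots> \<le> (\<integral>\<omega>. indicator (A k) \<omega> * X n \<omega> \<partial>M)" by (rule later[OF that])
      finally show ?thesis .
    qed
    have disj: "(\<Sum>k\<le>n. indicator (A k) \<omega> * X n \<omega>) \<le> X n \<omega>" for \<omega>
    proof (cases "\<exists>k\<le>n. \<omega> \<in> A k")
      case True
      then obtain k where k: "k \<le> n" "\<omega> \<in> A k" by blast
      have "\<omega> \<notin> A j" if "j \<noteq> k" for j
      proof
        assume "\<omega> \<in> A j"
        with k(2) have "\<not> j < k" "\<not> k < j" by (force simp: A_def)+
        with that show False by simp
      qed
      then have "(\<Sum>j\<le>n. indicator (A j) \<omega> * X n \<omega>) = (\<Sum>j\<in>{k}. X n \<omega>)"
        using k by (intro sum.mono_neutral_cong_right) (auto simp: indicator_def)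
      then show ?thesis by (simp only: sum.insert finite.emptyI sum.empty) simp
    next
      case False
      then have "(\<Sum>j\<le>n. indicator (A j) \<omega> * X n \<omega>) = 0"
        by (intro sum.neutral) auto
      with nonneg[of n \<omega>] show ?thesis by linarith
    qed
    have "a * prob (\<Union>k\<le>n. A k) \<le> a * (\<Sum>k\<le>n. prob (A k))"
      using \<open>a > 0\<close> by (intro mult_left_mono finite_measure_subadditive_finite) auto
    also have "\<dots> = (\<Sum>k\<le>n. a * prob (A k))" by (rule sum_distrib_left)
    also have "\<dots> \<le> (\<Sum>k\<le>n. \<integral>\<omega>. indicator (A k) \<omega> * X n \<omega> \<partial>M)"
      by (intro sum_mono one) simp
    also have "\<dots> = (\<integral>\<omega>. (\<Sum>k\<le>n. indicator (A k) \<omega> * X n \<omega>) \<partial>M)"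
      by (intro Bochner_Integration.integral_sum[symmetric] int_ind) simp
    also have "\<dots> \<le> expectation (X n)"
      by (intro integral_mono Bochner_Integration.integrable_sum int_ind int disj) simp
    also have "\<dots> \<le> B" by (rule bound)
    finally show ?thesis using \<open>a > 0\<close> by (simp add: field_simps)
  qed
  have "(\<lambda>n. prob (\<Union>k\<le>n. A k)) \<longlonglongrightarrow> prob (\<Union>n. \<Union>k\<le>n. A k)"
    by (intro finite_Lim_measure_incseq) (auto simp: incseq_def, force+)
  moreover have "(\<Union>n. \<Union>k\<le>n. A k) = {\<omega>\<in>space M. \<exists>k. a \<le> X k \<omega>}"
  proof (intro set_eqI iffI)
    fix \<omega> assume "\<omega> \<in> {\<omega>\<in>space M. \<exists>k. a \<le> X k \<omega>}"
    then have "\<omega> \<in> space M" and ex: "\<exists>k. a \<le> X k \<omega>" by auto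
    define k where "k = (LEAST k. a \<le> X k \<omega>)"
    have "a \<le> X k \<omega>" unfolding k_def by (rule LeastI_ex[OF ex])
    moreover have "X j \<omega> < a" if "j < k" for j
      using not_less_Least[OF that[unfolded k_def]] by simp
    ultimately have "\<omega> \<in> A k" using \<open>\<omega> \<in> space M\<close> by (simp add: A_def)
    then show "\<omega> \<in> (\<Union>n. \<Union>k\<le>n. A k)" by blast
  qed (auto simp: A_def)
  ultimately show ?thesis
    using fin by (auto intro: LIMSEQ_le_const2)
qed

text \<open>The variable \<open>Y 0\<close> is only required to be adapted: centering starts with \<open>Y 1\<close>, as in
  \<^const>\<open>martingale_difference\<close>.\<close>

locale martingale_differences = prob_space M for M :: "'w measure" +
  fixes F :: "nat \<Rightarrow> 'w measure" and Y :: "nat \<Rightarrow> 'w \<Rightarrow> real"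
  assumes sub: "\<And>k. subalgebra M (F k)"
    and filtr: "\<And>j k. j \<le> k \<Longrightarrow> sets (F j) \<subseteq> sets (F k)"
    and adapted: "\<And>k. Y k \<in> borel_measurable (F k)"
    and integrable: "\<And>k. integrable M (Y (Suc k))"
    and centered: "\<And>k. AE \<omega> in M. real_cond_exp M (F k) (Y (Suc k)) \<omega> = 0"
begin

definition S :: "(nat \<Rightarrow> real) \<Rightarrow> nat \<Rightarrow> 'w \<Rightarrow> real" where
  "S c n \<omega> = (\<Sum>k<n. c k * Y (Suc k) \<omega>)"

lemma S_0 [simp]: "S c 0 \<omega> = 0" and S_Suc: "S c (Suc n) \<omega> = S c n \<omega> + c n * Y (Suc n) \<omega>"
  by (simp_all add: S_def)

lemma adapted_later: "j \<le> k \<Longrightarrow> Y j \<in> borel_measurable (F k)"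
  using measurable_from_subalg[of "F k" "F j"] adapted filtr[of j k] sub
  by (auto simp: subalgebra_def)

lemma Y_measurable [measurable]: "Y k \<in> borel_measurable M"
  using measurable_from_subalg[OF sub adapted] .

lemma S_adapted: "S c n \<in> borel_measurable (F n)"
  unfolding S_def using adapted_later by (auto intro!: borel_measurable_sum)

lemma S_measurable [measurable]: "S c n \<in> borel_measurable M"
  using measurable_from_subalg[OF sub S_adapted] .

lemma sets_F_M: "A \<in> sets (F k) \<Longrightarrow> A \<in> sets M"
  using sub by (auto simp: subalgebra_def)

text \<open>The only way in which the martingale property is used: the past is orthogonal to the next
  difference.\<close>

lemma orthogonal:
  assumes "Z \<in> borel_measurable (F k)" "integrable M (\<lambda>\<omega>. Z \<omega> * Y (Suc k) \<omega>)"
  shows "(\<integral>\<omega>. Z \<omega> * Y (Suc k) \<omega> \<partial>M) = 0"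
proof -
  interpret finite_measure_subalgebra M "F k"
    by unfold_locales (rule sub)
  have "(\<integral>\<omega>. Z \<omega> * Y (Suc k) \<omega> \<partial>M) = (\<integral>\<omega>. Z \<omega> * real_cond_exp M (F k) (Y (Suc k)) \<omega> \<partial>M)"
    by (rule real_cond_exp_intg(2)[symmetric]) (use assms in auto)
  also have "\<dots> = (\<integral>\<omega>. 0 \<partial>M)"
  proof (rule integral_cong_AE)
    have [measurable]: "Z \<in> borel_measurable M"
      "real_cond_exp M (F k) (Y (Suc k)) \<in> borel_measurable M"
      using measurable_from_subalg[OF sub assms(1)] by (auto intro: borel_measurable_cond_exp2)
    show "(\<lambda>\<omega>. Z \<omega> * real_cond_exp M (F k) (Y (Suc k)) \<omega>) \<in> borel_measurable M" by measurable
    show "AE \<omega> in M. Z \<omega> * real_cond_exp M (F k) (Y (Suc k)) \<omega> = 0"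
      using centered[of k] by eventually_elim simp
  qed simp
  finally show ?thesis by simp
qed

end

locale square_integrable_differences = martingale_differences +
  fixes s :: real
  assumes square_integrable: "\<And>k. integrable M (\<lambda>\<omega>. (Y (Suc k) \<omega>)\<^sup>2)"
    and second_moment: "\<And>k. expectation (\<lambda>\<omega>. (Y (Suc k) \<omega>)\<^sup>2) \<le> s"
begin

lemma s_nonneg: "0 \<le> s"
  by (rule order_trans[OF _ second_moment[of 0]]) (simp add: Bochner_Integration.integral_nonneg)

lemma integrable_prod:
  assumes [measurable]: "f \<in> borel_measurable M" "g \<in> borel_measurable M"
    and "integrable M (\<lambda>\<omega>. (f \<omega>)\<^sup>2)" "integrable M (\<lambda>\<omega>. (g \<omega>)\<^sup>2)"
  shows "integrable M (\<lambda>\<omega>. f \<omega> * g \<omega> :: real)"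
proof (rule Bochner_Integration.integrable_bound)
  show "integrable M (\<lambda>\<omega>. (f \<omega>)\<^sup>2 + (g \<omega>)\<^sup>2)" using assms by simp
  show "AE \<omega> in M. norm (f \<omega> * g \<omega>) \<le> norm ((f \<omega>)\<^sup>2 + (g \<omega>)\<^sup>2)"
  proof (rule AE_I2)
    fix \<omega>
    have "0 \<le> (\<bar>f \<omega>\<bar> - \<bar>g \<omega>\<bar>)\<^sup>2" by simp
    then have "2 * (\<bar>f \<omega>\<bar> * \<bar>g \<omega>\<bar>) \<le> (f \<omega>)\<^sup>2 + (g \<omega>)\<^sup>2" by (simp add: power2_diff)
    moreover have "0 \<le> \<bar>f \<omega>\<bar> * \<bar>g \<omega>\<bar>" by simp
    ultimately have "\<bar>f \<omega>\<bar> * \<bar>g \<omega>\<bar> \<le> \<bar>(f \<omega>)\<^sup>2 + (g \<omega>)\<^sup>2\<bar>" by linarith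
    then show "norm (f \<omega> * g \<omega>) \<le> norm ((f \<omega>)\<^sup>2 + (g \<omega>)\<^sup>2)"
      unfolding real_norm_def abs_mult .
  qed
qed simp

lemma S_square_integrable: "integrable M (\<lambda>\<omega>. (S c n \<omega>)\<^sup>2)"
proof (induction n)
  case (Suc n)
  have "integrable M (\<lambda>\<omega>. S c n \<omega> * Y (Suc n) \<omega>)"
    by (rule integrable_prod) (use Suc square_integrable in auto)
  then have "integrable M (\<lambda>\<omega>. (S c n \<omega>)\<^sup>2 + 2 * c n * (S c n \<omega> * Y (Suc n) \<omega>) + (c n)\<^sup>2 * (Y (Suc n) \<omega>)\<^sup>2)"
    using Suc square_integrable by (intro Bochner_Integration.integrable_add) auto
  then show ?case by (simp add: S_Suc power2_sum algebra_simps power_mult_distrib)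
qed simp

text \<open>The cross term vanishes, also on events of the past.\<close>

lemma S_square_step:
  assumes "A \<in> sets (F n)"
  shows "(\<integral>\<omega>. indicator A \<omega> * (S c (Suc n) \<omega>)\<^sup>2 \<partial>M) =
    (\<integral>\<omega>. indicator A \<omega> * (S c n \<omega>)\<^sup>2 \<partial>M) + (c n)\<^sup>2 * (\<integral>\<omega>. indicator A \<omega> * (Y (Suc n) \<omega>)\<^sup>2 \<partial>M)"
proof -
  have [measurable]: "A \<in> sets M" using assms by (rule sets_F_M)
  have i1: "integrable M (\<lambda>\<omega>. indicator A \<omega> * (S c n \<omega>)\<^sup>2)"
    using integrable_mult_indicator[OF \<open>A \<in> sets M\<close> S_square_integrable] by simp
  have i2: "integrable M (\<lambda>\<omega>. indicator A \<omega> * (Y (Suc n) \<omega>)\<^sup>2)"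
    using integrable_mult_indicator[OF \<open>A \<in> sets M\<close> square_integrable] by simp
  have "integrable M (\<lambda>\<omega>. S c n \<omega> * Y (Suc n) \<omega>)"
    by (rule integrable_prod) (use S_square_integrable square_integrable in auto)
  then have i3: "integrable M (\<lambda>\<omega>. (indicator A \<omega> * S c n \<omega>) * Y (Suc n) \<omega>)"
    using integrable_mult_indicator[OF \<open>A \<in> sets M\<close>, of "\<lambda>\<omega>. S c n \<omega> * Y (Suc n) \<omega>"] by (simp add: mult.assoc)
  have z: "(\<integral>\<omega>. (indicator A \<omega> * S c n \<omega>) * Y (Suc n) \<omega> \<partial>M) = 0"
    using assms by (intro orthogonal i3 borel_measurable_times S_adapted borel_measurable_indicator)
  have "(\<integral>\<omega>. indicator A \<omega> * (S c (Suc n) \<omega>)\<^sup>2 \<partial>M) =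
    (\<integral>\<omega>. indicator A \<omega> * (S c n \<omega>)\<^sup>2 + 2 * c n * ((indicator A \<omega> * S c n \<omega>) * Y (Suc n) \<omega>)
       + (c n)\<^sup>2 * (indicator A \<omega> * (Y (Suc n) \<omega>)\<^sup>2) \<partial>M)"
    by (rule Bochner_Integration.integral_cong) (auto simp: S_Suc power2_sum algebra_simps power_mult_distrib)
  also have "\<dots> = (\<integral>\<omega>. indicator A \<omega> * (S c n \<omega>)\<^sup>2 \<partial>M) + 2 * c n * 0
      + (c n)\<^sup>2 * (\<integral>\<omega>. indicator A \<omega> * (Y (Suc n) \<omega>)\<^sup>2 \<partial>M)"
    using i1 i2 i3 z by (simp add: Bochner_Integration.integral_add)
  finally show ?thesis by simp
qed

lemma S_second_moment: "expectation (\<lambda>\<omega>. (S c n \<omega>)\<^sup>2) \<le> s * (\<Sum>k<n. (c k)\<^sup>2)"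
proof (induction n)
  case (Suc n)
  have top: "space M \<in> sets (F n)" using sub[of n] by (metis sets.top subalgebra_def)
  have ind: "(\<integral>\<omega>. indicator (space M) \<omega> * h \<omega> \<partial>M) = expectation h" for h :: "_ \<Rightarrow> real"
    by (rule Bochner_Integration.integral_cong) auto
  have "expectation (\<lambda>\<omega>. (S c (Suc n) \<omega>)\<^sup>2) =
      expectation (\<lambda>\<omega>. (S c n \<omega>)\<^sup>2) + (c n)\<^sup>2 * expectation (\<lambda>\<omega>. (Y (Suc n) \<omega>)\<^sup>2)"
    using S_square_step[OF top, of c] unfolding ind .
  also have "\<dots> \<le> s * (\<Sum>k<n. (c k)\<^sup>2) + (c n)\<^sup>2 * s"
    by (intro add_mono Suc mult_left_mono second_moment) simp
  finally show ?case by (simp add: algebra_simps)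
qed simp

text \<open>By the vanishing cross terms the squared partial sums form a submartingale.\<close>

lemma kolmogorov_inequality:
  assumes "\<And>n. (\<Sum>k<n. (c k)\<^sup>2) \<le> b" "\<epsilon> > 0"
  shows "prob {\<omega>\<in>space M. \<exists>n. \<epsilon> \<le> \<bar>S c n \<omega>\<bar>} \<le> s * b / \<epsilon>\<^sup>2"
proof -
  have "prob {\<omega>\<in>space M. \<exists>n. \<epsilon>\<^sup>2 \<le> (S c n \<omega>)\<^sup>2} \<le> s * b / \<epsilon>\<^sup>2"
  proof (rule maximal_inequality[OF sub filtr])
    show "(\<lambda>\<omega>. (S c n \<omega>)\<^sup>2) \<in> borel_measurable (F n)" for n
      using S_adapted by (rule borel_measurable_power)
    show "(\<integral>\<omega>. indicator A \<omega> * (S c n \<omega>)\<^sup>2 \<partial>M) \<le> (\<integral>\<omega>. indicator A \<omega> * (S c (Suc n) \<omega>)\<^sup>2 \<partial>M)"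
      if "A \<in> sets (F n)" for n A
      unfolding S_square_step[OF that] by (simp add: Bochner_Integration.integral_nonneg)
    show "expectation (\<lambda>\<omega>. (S c n \<omega>)\<^sup>2) \<le> s * b" for n
      using S_second_moment[of c n] mult_left_mono[OF assms(1)[of n] s_nonneg] by linarith
  qed (use S_square_integrable assms(2) in auto)
  moreover have "\<epsilon>\<^sup>2 \<le> (S c n \<omega>)\<^sup>2 \<longleftrightarrow> \<epsilon> \<le> \<bar>S c n \<omega>\<bar>" for n \<omega>
    using assms(2) abs_le_square_iff[of \<epsilon> "S c n \<omega>"] by simp
  ultimately show ?thesis by simp
qed

text \<open>The partial sums are almost surely Cauchy: the inequality above, applied to the weights that are
  cut off below \<open>N\<close>, bounds the probability of a large oscillation after \<open>N\<close> by a tail of the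
  convergent series of squared weights.\<close>

lemma weighted_sum_convergent:
  assumes "summable (\<lambda>k. (c k)\<^sup>2)"
  shows "AE \<omega> in M. convergent (\<lambda>n. S c n \<omega>)"
proof -
  have "AE \<omega> in M. \<exists>N. \<forall>n\<ge>N. \<bar>S c n \<omega> - S c N \<omega>\<bar> < 1 / real (Suc i)" for i
  proof -
    let ?\<epsilon> = "1 / real (Suc i)"
    \<comment> \<open>Cutting off the weights turns the oscillation after \<open>N\<close> into a deviation from \<open>0\<close>.\<close>
    define c' where "c' N k = (if k < N then 0 else c k)" for N k
    define A where "A N = {\<omega>\<in>space M. \<exists>n. ?\<epsilon> \<le> \<bar>S (c' N) n \<omega>\<bar>}" for N
    have [measurable]: "A N \<in> sets M" for N unfolding A_def by measurable
    have tail: "S (c' N) n \<omega> = S c n \<omega> - S c N \<omega>" if "N \<le> n" for N n \<omega>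
      using that by (induction n rule: dec_induct) (auto simp: S_Suc S_def c'_def)
    have lim: "(\<lambda>N. suminf (\<lambda>k. (c (k + N))\<^sup>2)) \<longlonglongrightarrow> 0"
      using suminf_exist_split2[OF assms] .
    have prob_A: "prob (A N) \<le> s * suminf (\<lambda>k. (c (k + N))\<^sup>2) / ?\<epsilon>\<^sup>2" for N
      unfolding A_def
    proof (rule kolmogorov_inequality)
      fix n
      have "(\<Sum>k<n. (c' N k)\<^sup>2) = (\<Sum>k\<in>{N..<n}. (c k)\<^sup>2)"
        by (rule sum.mono_neutral_cong_right) (auto simp: c'_def)
      also have "\<dots> = (\<Sum>k\<in>{0..<n-N}. (c (k + N))\<^sup>2)"
        by (cases "N \<le> n") (use sum.shift_bounds_nat_ivl[of "\<lambda>k. (c k)\<^sup>2" 0 N "n - N"] in auto)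
      also have "\<dots> \<le> suminf (\<lambda>k. (c (k + N))\<^sup>2)"
        by (intro sum_le_suminf summable_ignore_initial_segment assms) auto
      finally show "(\<Sum>k<n. (c' N k)\<^sup>2) \<le> suminf (\<lambda>k. (c (k + N))\<^sup>2)" .
    qed simp
    have "(\<lambda>N. s * suminf (\<lambda>k. (c (k + N))\<^sup>2) / ?\<epsilon>\<^sup>2) \<longlonglongrightarrow> s * 0 / ?\<epsilon>\<^sup>2"
      by (intro tendsto_intros lim) simp
    then have lim2: "(\<lambda>N. s * suminf (\<lambda>k. (c (k + N))\<^sup>2) / ?\<epsilon>\<^sup>2) \<longlonglongrightarrow> 0" by simp
    have "(\<lambda>N. prob (A N)) \<longlonglongrightarrow> 0"
    proof (rule tendsto_sandwich[OF _ _ tendsto_const[of 0] lim2])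
      show "\<forall>\<^sub>F N in sequentially. 0 \<le> prob (A N)"
        by (intro always_eventually allI measure_nonneg)
      show "\<forall>\<^sub>F N in sequentially. prob (A N) \<le> s * suminf (\<lambda>k. (c (k + N))\<^sup>2) / ?\<epsilon>\<^sup>2"
        by (intro always_eventually allI prob_A)
    qed
    moreover have "prob (\<Inter>N. A N) \<le> prob (A N)" for N
      by (intro finite_measure_mono) auto
    ultimately have "prob (\<Inter>N. A N) \<le> 0"
      by (metis LIMSEQ_le_const)
    then have "(\<Inter>N. A N) \<in> null_sets M"
      by (intro null_setsI) (auto simp: emeasure_eq_measure measure_le_0_iff)
    then have "AE \<omega> in M. \<omega> \<notin> (\<Inter>N. A N)" by (rule AE_not_in)
    with AE_space show ?thesis
    proof eventually_elim
      case (elim \<omega>)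
      then obtain N where N: "\<And>n. \<bar>S (c' N) n \<omega>\<bar> < ?\<epsilon>" by (auto simp: A_def not_le)
      show ?case
      proof (intro exI allI impI)
        show "\<bar>S c n \<omega> - S c N \<omega>\<bar> < ?\<epsilon>" if "N \<le> n" for n
          using N[of n] tail[OF that] by simp
      qed
    qed
  qed
  then have "AE \<omega> in M. \<forall>i. \<exists>N. \<forall>n\<ge>N. \<bar>S c n \<omega> - S c N \<omega>\<bar> < 1 / real (Suc i)"
    by (simp add: AE_all_countable)
  then show ?thesis
  proof eventually_elim
    case (elim \<omega>)
    have "Cauchy (\<lambda>n. S c n \<omega>)"
    proof (rule metric_CauchyI)
      fix e :: real assume "e > 0"
      then obtain i where i: "1 / real (Suc i) < e / 2"
        using reals_Archimedean[of "e/2"] by (auto simp: field_simps)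
      with elim obtain N where N: "\<And>n. n \<ge> N \<Longrightarrow> \<bar>S c n \<omega> - S c N \<omega>\<bar> < 1 / real (Suc i)" by blast
      show "\<exists>N. \<forall>m\<ge>N. \<forall>n\<ge>N. dist (S c m \<omega>) (S c n \<omega>) < e"
      proof (intro exI allI impI)
        fix m n assume "N \<le> m" "N \<le> n"
        with N[of m] N[of n] i show "dist (S c m \<omega>) (S c n \<omega>) < e"
          unfolding dist_real_def by linarith
      qed
    qed
    then show ?case by (simp add: Cauchy_convergent)
  qed
qed

end


text \<open>The linear term disappears when a centered variable is inserted; what remains is a Gaussian bound
  on its exponential moments.\<close>

lemma exp_le_add_exp_square: "exp y \<le> y + exp (y\<^sup>2)" for y :: real
proof (cases "\<bar>y\<bar> \<le> 1")
  case True
  have "exp y \<le> 1 + y + y\<^sup>2"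
  proof (cases "0 \<le> y")
    case False
    have "exp (- y) \<ge> 1 + (- y) + (- y)\<^sup>2 / 2"
      using exp_lower_Taylor_quadratic[of "- y"] False by simp
    then have "(1 - y + y\<^sup>2 / 2) * exp y \<le> exp (- y) * exp y"
      by (intro mult_right_mono) auto
    then have "(1 - y + y\<^sup>2 / 2) * exp y \<le> 1" by (simp flip: exp_add)
    moreover have "1 \<le> (1 - y + y\<^sup>2 / 2) * (1 + y + y\<^sup>2)"
    proof -
      have "(1 - y + y\<^sup>2 / 2) * (1 + y + y\<^sup>2) - 1 = y\<^sup>2 / 2 * (1 + (y\<^sup>2 - y))"
        by (simp add: power2_eq_square field_simps)
      also have "\<dots> \<ge> 0"
        using False by (intro mult_nonneg_nonneg add_nonneg_nonneg) (auto intro: order_trans[of y 0])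
      finally show ?thesis by simp
    qed
    ultimately have "(1 - y + y\<^sup>2 / 2) * exp y \<le> (1 - y + y\<^sup>2 / 2) * (1 + y + y\<^sup>2)" by linarith
    moreover have "0 < 1 - y + y\<^sup>2 / 2" using False zero_le_power2[of y] by linarith
    ultimately show ?thesis by simp
  qed (use True exp_bound[of y] in auto)
  also have "\<dots> \<le> y + exp (y\<^sup>2)" using exp_ge_add_one_self[of "y\<^sup>2"] by simp
  finally show ?thesis .
next
  case False
  show ?thesis
  proof (cases "y > 0")
    case True
    with False have "y \<le> y\<^sup>2" by (simp add: power2_eq_square)
    then have "exp y \<le> exp (y\<^sup>2)" by simp
    with True show ?thesis by linarith
  next
    case y: False
    with False have "y < - 1" by simp
    then have "exp y \<le> 1" by simp
    moreover have "- y \<le> y\<^sup>2"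
      using mult_left_mono[of 1 "- y" "- y"] \<open>y < -1\<close> by (simp add: power2_eq_square)
    ultimately show ?thesis using exp_ge_add_one_self[of "y\<^sup>2"] by linarith
  qed
qed

locale bounded_differences = martingale_differences +
  fixes C :: real
  assumes bounded: "\<And>k. AE \<omega> in M. \<bar>Y (Suc k) \<omega>\<bar> \<le> C"
begin

lemma S_bounded: "AE \<omega> in M. \<bar>S c n \<omega>\<bar> \<le> (\<Sum>k<n. \<bar>c k\<bar> * C)"
proof -
  have "AE \<omega> in M. \<forall>k. \<bar>Y (Suc k) \<omega>\<bar> \<le> C" using bounded by (simp add: AE_all_countable)
  then show ?thesis
  proof eventually_elim
    case (elim \<omega>)
    have "\<bar>S c n \<omega>\<bar> \<le> (\<Sum>k<n. \<bar>c k * Y (Suc k) \<omega>\<bar>)" unfolding S_def by (rule sum_abs)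
    also have "\<dots> \<le> (\<Sum>k<n. \<bar>c k\<bar> * C)"
      unfolding abs_mult using elim by (intro sum_mono mult_left_mono) auto
    finally show ?case .
  qed
qed

lemma exp_S_integrable: "integrable M (\<lambda>\<omega>. exp (S c n \<omega>))"
proof (rule integrable_const_bound)
  show "AE \<omega> in M. norm (exp (S c n \<omega>)) \<le> exp (\<Sum>k<n. \<bar>c k\<bar> * C)"
    using S_bounded[of c n] by eventually_elim auto
qed simp

lemma exp_S_Y_integrable: "integrable M (\<lambda>\<omega>. exp (S c n \<omega>) * Y (Suc n) \<omega>)"
proof (rule Bochner_Integration.integrable_bound)
  show "integrable M (\<lambda>\<omega>. exp (\<Sum>k<n. \<bar>c k\<bar> * C) * Y (Suc n) \<omega>)" using integrable by simp
  show "AE \<omega> in M. norm (exp (S c n \<omega>) * Y (Suc n) \<omega>) \<le> norm (exp (\<Sum>k<n. \<bar>c k\<bar> * C) * Y (Suc n) \<omega>)"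
    using S_bounded[of c n]
  proof eventually_elim
    case (elim \<omega>)
    then have "exp (S c n \<omega>) \<le> exp (\<Sum>k<n. \<bar>c k\<bar> * C)" by simp
    then show ?case unfolding real_norm_def abs_mult by (intro mult_right_mono) auto
  qed
qed simp

lemma exp_S_step:
  assumes "A \<in> sets (F n)"
  shows "(\<integral>\<omega>. indicator A \<omega> * exp (S c n \<omega>) \<partial>M) \<le> (\<integral>\<omega>. indicator A \<omega> * exp (S c (Suc n) \<omega>) \<partial>M)"
proof -
  have A: "A \<in> sets M" using assms by (rule sets_F_M)
  have i1: "integrable M (\<lambda>\<omega>. indicator A \<omega> * exp (S c n \<omega>))" for n
    using integrable_mult_indicator[OF A exp_S_integrable] by simp
  have i2: "integrable M (\<lambda>\<omega>. (indicator A \<omega> * exp (S c n \<omega>)) * Y (Suc n) \<omega>)"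
    using integrable_mult_indicator[OF A exp_S_Y_integrable] by (simp add: mult.assoc)
  have [measurable]: "S c n \<in> borel_measurable (F n)" by (rule S_adapted)
  have "(\<lambda>\<omega>. indicator A \<omega> * exp (S c n \<omega>)) \<in> borel_measurable (F n)"
    using assms by measurable
  then have z: "(\<integral>\<omega>. (indicator A \<omega> * exp (S c n \<omega>)) * Y (Suc n) \<omega> \<partial>M) = 0"
    by (rule orthogonal[OF _ i2])
  have "(\<integral>\<omega>. indicator A \<omega> * exp (S c n \<omega>) \<partial>M) =
      (\<integral>\<omega>. indicator A \<omega> * exp (S c n \<omega>) + c n * ((indicator A \<omega> * exp (S c n \<omega>)) * Y (Suc n) \<omega>) \<partial>M)"
    using i1 i2 z by (simp add: Bochner_Integration.integral_add)
  also have "\<dots> \<le> (\<integral>\<omega>. indicator A \<omega> * exp (S c (Suc n) \<omega>) \<partial>M)"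
  proof (intro integral_mono Bochner_Integration.integrable_add i1 integrable_mult_right i2)
    fix \<omega>
    have "exp (S c n \<omega>) * (1 + c n * Y (Suc n) \<omega>) \<le> exp (S c n \<omega>) * exp (c n * Y (Suc n) \<omega>)"
      by (intro mult_left_mono exp_ge_add_one_self) auto
    then have "indicator A \<omega> * (exp (S c n \<omega>) * (1 + c n * Y (Suc n) \<omega>)) \<le> indicator A \<omega> * exp (S c (Suc n) \<omega>)"
      by (intro mult_left_mono) (auto simp: S_Suc exp_add)
    then show "indicator A \<omega> * exp (S c n \<omega>) + c n * ((indicator A \<omega> * exp (S c n \<omega>)) * Y (Suc n) \<omega>)
        \<le> indicator A \<omega> * exp (S c (Suc n) \<omega>)"
      by (simp add: algebra_simps)
  qed
  finally show ?thesis .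
qed

lemma exp_S_moment: "expectation (\<lambda>\<omega>. exp (S c n \<omega>)) \<le> exp (C\<^sup>2 * (\<Sum>k<n. (c k)\<^sup>2))"
proof (induction n)
  case (Suc n)
  have z: "(\<integral>\<omega>. exp (S c n \<omega>) * Y (Suc n) \<omega> \<partial>M) = 0"
    by (rule orthogonal[OF borel_measurable_exp[THEN measurable_compose_rev, OF S_adapted] exp_S_Y_integrable])
  have "expectation (\<lambda>\<omega>. exp (S c (Suc n) \<omega>)) \<le>
    (\<integral>\<omega>. c n * (exp (S c n \<omega>) * Y (Suc n) \<omega>) + exp ((c n)\<^sup>2 * C\<^sup>2) * exp (S c n \<omega>) \<partial>M)"
  proof (intro integral_mono_AE Bochner_Integration.integrable_add integrable_mult_right exp_S_Y_integrable exp_S_integrable)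
    show "AE \<omega> in M. exp (S c (Suc n) \<omega>) \<le>
       c n * (exp (S c n \<omega>) * Y (Suc n) \<omega>) + exp ((c n)\<^sup>2 * C\<^sup>2) * exp (S c n \<omega>)"
      using bounded[of n]
    proof eventually_elim
      case (elim \<omega>)
      have "(Y (Suc n) \<omega>)\<^sup>2 \<le> C\<^sup>2" using elim by (meson abs_ge_self abs_le_square_iff order_trans)
      then have "(c n * Y (Suc n) \<omega>)\<^sup>2 \<le> (c n)\<^sup>2 * C\<^sup>2"
        by (simp add: power_mult_distrib mult_left_mono)
      then have "exp (c n * Y (Suc n) \<omega>) \<le> c n * Y (Suc n) \<omega> + exp ((c n)\<^sup>2 * C\<^sup>2)"
        using exp_le_add_exp_square[of "c n * Y (Suc n) \<omega>"]
        by (meson add_left_mono exp_le_cancel_iff order_trans)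
      then have "exp (S c n \<omega>) * exp (c n * Y (Suc n) \<omega>) \<le>
          exp (S c n \<omega>) * (c n * Y (Suc n) \<omega> + exp ((c n)\<^sup>2 * C\<^sup>2))"
        by (intro mult_left_mono) auto
      then show ?case by (simp add: S_Suc exp_add algebra_simps)
    qed
  qed
  also have "\<dots> = exp ((c n)\<^sup>2 * C\<^sup>2) * expectation (\<lambda>\<omega>. exp (S c n \<omega>))"
    using exp_S_Y_integrable exp_S_integrable z by (simp add: Bochner_Integration.integral_add)
  also have "\<dots> \<le> exp ((c n)\<^sup>2 * C\<^sup>2) * exp (C\<^sup>2 * (\<Sum>k<n. (c k)\<^sup>2))"
    by (intro mult_left_mono Suc) simp
  finally show ?case by (simp add: algebra_simps flip: exp_add)
qed (simp add: prob_space)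

text \<open>The exponentials of the partial sums form a submartingale whose expectation is controlled by the
  preceding lemma. The parameter \<open>l\<close> is left free, since its best choice depends on \<open>b\<close>.\<close>

lemma azuma_inequality:
  assumes "\<And>n. (\<Sum>k<n. (c k)\<^sup>2) \<le> b" "0 < l"
  shows "prob {\<omega>\<in>space M. \<exists>n. \<epsilon> \<le> S c n \<omega>} \<le> exp (C\<^sup>2 * l\<^sup>2 * b - l * \<epsilon>)"
proof -
  let ?c = "\<lambda>k. l * c k"
  have S: "S ?c n \<omega> = l * S c n \<omega>" for n \<omega>
    by (simp add: S_def sum_distrib_left mult.assoc)
  have "prob {\<omega>\<in>space M. \<exists>n. exp (l * \<epsilon>) \<le> exp (S ?c n \<omega>)} \<le> exp (C\<^sup>2 * l\<^sup>2 * b) / exp (l * \<epsilon>)"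
  proof (rule maximal_inequality[OF sub filtr])
    show "(\<lambda>\<omega>. exp (S ?c n \<omega>)) \<in> borel_measurable (F n)" for n
      using borel_measurable_exp[THEN measurable_compose_rev, OF S_adapted] .
    show "expectation (\<lambda>\<omega>. exp (S ?c n \<omega>)) \<le> exp (C\<^sup>2 * l\<^sup>2 * b)" for n
    proof (rule order_trans[OF exp_S_moment])
      have "(\<Sum>k<n. (?c k)\<^sup>2) = l\<^sup>2 * (\<Sum>k<n. (c k)\<^sup>2)"
        by (simp add: power_mult_distrib sum_distrib_left)
      also have "\<dots> \<le> l\<^sup>2 * b" by (intro mult_left_mono assms) simp
      finally show "exp (C\<^sup>2 * (\<Sum>k<n. (?c k)\<^sup>2)) \<le> exp (C\<^sup>2 * l\<^sup>2 * b)"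
        by (simp add: mult.assoc mult_left_mono)
    qed
  qed (auto intro: exp_S_integrable exp_S_step)
  then show ?thesis using \<open>0 < l\<close> by (simp add: S exp_diff)
qed

end

text \<open>All windows that start at \<open>n\<close> are handled at once by the weights \<open>c n\<close>, which are cut off where
  time one is exceeded: their absolute values sum to at most one, so their squares sum to at most
  the supremum of \<open>\<eta> k\<close> over \<open>k \<ge> n\<close>, which is eventually below \<open>\<kappa> / ln n\<close> for every
  \<open>\<kappa> > 0\<close>. For a suitable \<open>\<kappa>\<close> the deviation probability is at most \<open>1 / n\<^sup>2\<close>, and the Borel-Cantelli lemma applies. The sign \<open>s\<close> gives upper and
  lower deviations.\<close>

lemma (in bounded_differences) one_sided_window_sums:
  assumes pos: "\<And>k. \<eta> k > 0" and small: "(\<lambda>k. \<eta> k * ln (real k)) \<longlonglongrightarrow> 0" and "\<epsilon> > 0" and "s = 1 \<or> s = -1"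
  shows "AE \<omega> in M. \<forall>\<^sub>F n in sequentially. \<forall>m\<ge>n. (\<Sum>k=n..<m. \<eta> k) \<le> 1 \<longrightarrow>
    s * (\<Sum>k=n..<m. \<eta> k * Y (Suc k) \<omega>) < \<epsilon>"
proof -
  define c where "c n k = (if n \<le> k \<and> (\<Sum>i=n..k. \<eta> i) \<le> 1 then s * \<eta> k else 0)" for n k
  have window: "S (c n) m \<omega> = s * (\<Sum>k=n..<m. \<eta> k * Y (Suc k) \<omega>)"
    if "n \<le> m" "(\<Sum>k=n..<m. \<eta> k) \<le> 1" for n m \<omega>
  proof -
    have "S (c n) m \<omega> = (\<Sum>k=n..<m. s * \<eta> k * Y (Suc k) \<omega>)"
      unfolding S_def
    proof (rule sum.mono_neutral_cong_right)
      fix k assume k: "k \<in> {n..<m}"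
      have "(\<Sum>i=n..k. \<eta> i) \<le> (\<Sum>i=n..<m. \<eta> i)"
        using k pos by (intro sum_mono2) (auto intro: less_imp_le)
      with that k show "c n k * Y (Suc k) \<omega> = s * \<eta> k * Y (Suc k) \<omega>" by (simp add: c_def)
    qed (auto simp: c_def)
    then show ?thesis by (simp add: sum_distrib_left mult.assoc)
  qed
  have abs_c: "(\<Sum>k<m. \<bar>c n k\<bar>) \<le> 1" for n m
  proof -
    let ?K = "{k\<in>{n..<m}. (\<Sum>i=n..k. \<eta> i) \<le> 1}"
    have "(\<Sum>k<m. \<bar>c n k\<bar>) = (\<Sum>k\<in>?K. \<eta> k)"
      using assms(4) pos by (intro sum.mono_neutral_cong_right) (auto simp: c_def less_imp_le)
    also have "\<dots> \<le> 1"
    proof (cases "?K = {}")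
      case False
      have fin: "finite ?K" by simp
      have mx: "Max ?K \<in> ?K" by (rule Max_in[OF fin False])
      have "?K \<subseteq> {n..Max ?K}" using Max_ge[OF fin] by auto
      then have "(\<Sum>k\<in>?K. \<eta> k) \<le> (\<Sum>k=n..Max ?K. \<eta> k)"
        using pos by (intro sum_mono2) (auto intro: less_imp_le)
      with mx show ?thesis by auto
    next
      case True
      show ?thesis unfolding True by simp
    qed
    finally show ?thesis .
  qed
  define A where "A n = {\<omega>\<in>space M. \<exists>m. \<epsilon> \<le> S (c n) m \<omega>}" for n
  have [measurable]: "A n \<in> sets M" for n unfolding A_def by measurable
  define \<kappa> where "\<kappa> = \<epsilon>\<^sup>2 / (9 * C\<^sup>2 + 1)"
  have D: "9 * C\<^sup>2 + 1 > 0" by (simp add: add_nonneg_pos)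
  have \<kappa>: "\<kappa> > 0" "9 * C\<^sup>2 * \<kappa> \<le> \<epsilon>\<^sup>2"
  proof -
    show "\<kappa> > 0" using D \<open>\<epsilon> > 0\<close> by (simp add: \<kappa>_def)
    have "9 * C\<^sup>2 * \<kappa> \<le> (9 * C\<^sup>2 + 1) * \<kappa>" using \<open>\<kappa> > 0\<close> by (intro mult_right_mono) auto
    also have "\<dots> = \<epsilon>\<^sup>2" using D by (simp add: \<kappa>_def)
    finally show "9 * C\<^sup>2 * \<kappa> \<le> \<epsilon>\<^sup>2" .
  qed
  obtain n0 where n0: "\<And>k. k \<ge> n0 \<Longrightarrow> \<eta> k * ln (real k) \<le> \<kappa>"
    using order_tendstoD(2)[OF small \<kappa>(1)] by (auto simp: eventually_sequentially intro: less_imp_le)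
  have prob_A: "prob (A n) \<le> inverse (real n ^ 2)" if n: "n \<ge> max n0 2" for n
  proof -
    have ln: "ln (real n) > 0" using n by simp
    have \<eta>: "\<eta> k \<le> \<kappa> / ln (real n)" if "k \<ge> n" for k
    proof -
      have "\<eta> k * ln (real n) \<le> \<eta> k * ln (real k)"
        using that n pos[of k] by (intro mult_left_mono) auto
      also have "\<dots> \<le> \<kappa>" using that n by (intro n0) simp
      finally show ?thesis using ln by (simp add: field_simps)
    qed
    have squares: "(\<Sum>k<m. (c n k)\<^sup>2) \<le> \<kappa> / ln (real n)" for m
    proof -
      have "(\<Sum>k<m. (c n k)\<^sup>2) \<le> (\<Sum>k<m. \<kappa> / ln (real n) * \<bar>c n k\<bar>)"
      proof (rule sum_mono)
        fix k
        have "\<bar>c n k\<bar> \<le> \<kappa> / ln (real n)"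
        proof (cases "n \<le> k")
          case True
          then show ?thesis using \<eta>[of k] pos[of k] assms(4) \<kappa> ln by (auto simp: c_def)
        qed (use \<kappa> ln in \<open>auto simp: c_def\<close>)
        then have "\<bar>c n k\<bar> * \<bar>c n k\<bar> \<le> \<kappa> / ln (real n) * \<bar>c n k\<bar>"
          by (intro mult_right_mono) auto
        then show "(c n k)\<^sup>2 \<le> \<kappa> / ln (real n) * \<bar>c n k\<bar>" by (simp add: power2_eq_square)
      qed
      also have "\<dots> = \<kappa> / ln (real n) * (\<Sum>k<m. \<bar>c n k\<bar>)" by (simp add: sum_distrib_left)
      also have "\<dots> \<le> \<kappa> / ln (real n) * 1" using \<kappa> ln by (intro mult_left_mono abs_c) auto
      finally show ?thesis by simp
    qed
    \<comment> \<open>This makes the linear term of the exponent \<open>- 3 ln n\<close>; the quadratic one is at most \<open>ln n\<close> by choice of \<open>\<kappa>\<close>.\<close>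
    let ?l = "3 / \<epsilon> * ln (real n)"
    have "prob (A n) \<le> exp (C\<^sup>2 * ?l\<^sup>2 * (\<kappa> / ln (real n)) - ?l * \<epsilon>)"
      unfolding A_def by (rule azuma_inequality[OF squares]) (use ln \<open>\<epsilon> > 0\<close> in simp)
    also have "C\<^sup>2 * ?l\<^sup>2 * (\<kappa> / ln (real n)) = (9 * C\<^sup>2 * \<kappa>) / \<epsilon>\<^sup>2 * ln (real n)"
      using ln \<open>\<epsilon> > 0\<close> by (simp add: field_simps power2_eq_square)
    also have "?l * \<epsilon> = 3 * ln (real n)" using \<open>\<epsilon> > 0\<close> by simp
    also have "exp ((9 * C\<^sup>2 * \<kappa>) / \<epsilon>\<^sup>2 * ln (real n) - 3 * ln (real n)) \<le> exp (- 2 * ln (real n))"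
    proof -
      have "(9 * C\<^sup>2 * \<kappa>) / \<epsilon>\<^sup>2 * ln (real n) \<le> 1 * ln (real n)"
        using \<kappa> ln \<open>\<epsilon> > 0\<close> by (intro mult_right_mono) auto
      then show ?thesis by simp
    qed
    also have "\<dots> = inverse (real n ^ 2)"
    proof -
      have "exp (2 * ln (real n)) = real n ^ 2"
        using n exp_of_nat_mult[of 2 "ln (real n)"] by simp
      then show ?thesis by (simp add: exp_minus)
    qed
    finally show ?thesis .
  qed
  have "summable (\<lambda>n. prob (A n))"
  proof (rule summable_comparison_test)
    show "summable (\<lambda>n. inverse (real n ^ 2))" by (rule inverse_power_summable) simp
    show "\<exists>N. \<forall>n\<ge>N. norm (prob (A n)) \<le> inverse (real n ^ 2)"
      using prob_A by (intro exI[of _ "max n0 2"]) (auto simp: measure_nonneg)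
  qed
  then have "AE \<omega> in M. \<forall>\<^sub>F n in sequentially. \<omega> \<in> space M - A n"
    by (intro borel_cantelli_AE1) (auto simp: emeasure_eq_measure)
  then show ?thesis
  proof eventually_elim
    case (elim \<omega>)
    then show ?case
    proof eventually_elim
      case (elim n)
      show ?case
      proof (intro allI impI)
        fix m assume "n \<le> m" "(\<Sum>k=n..<m. \<eta> k) \<le> 1"
        then have "s * (\<Sum>k=n..<m. \<eta> k * Y (Suc k) \<omega>) = S (c n) m \<omega>" using window by simp
        also have "\<dots> < \<epsilon>" using elim by (auto simp: A_def not_le)
        finally show "s * (\<Sum>k=n..<m. \<eta> k * Y (Suc k) \<omega>) < \<epsilon>" .
      qed
    qed
  qed
qed

section \<open>Noise on short time windows\<close>

text \<open>A window is a range \<open>n..<m\<close> of indices, and its length is the sum of its step sizes. The second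
  notion bounds the total variation of the noise: it is what makes the noise harmless after
  multiplication by a slowly varying matrix.\<close>

definition window_small :: "(nat \<Rightarrow> real) \<Rightarrow> (nat \<Rightarrow> 'a::real_normed_vector) \<Rightarrow> bool" where
  "window_small \<eta> v \<longleftrightarrow> (\<forall>\<epsilon>>0. \<forall>\<^sub>F n in sequentially. \<forall>m\<ge>n. (\<Sum>k=n..<m. \<eta> k) \<le> 1 \<longrightarrow>
     norm (\<Sum>k=n..<m. \<eta> k *\<^sub>R v k) \<le> \<epsilon>)"

definition window_bounded :: "(nat \<Rightarrow> real) \<Rightarrow> (nat \<Rightarrow> 'a::real_normed_vector) \<Rightarrow> bool" where
  "window_bounded \<eta> v \<longleftrightarrow> (\<exists>C\<ge>0. \<forall>\<epsilon>>0. \<forall>\<^sub>F n in sequentially. \<forall>m\<ge>n. (\<Sum>k=n..<m. \<eta> k) \<le> 1 \<longrightarrow>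
     (\<Sum>k=n..<m. \<eta> k * norm (v k)) \<le> C * (\<Sum>k=n..<m. \<eta> k) + \<epsilon>)"

text \<open>The martingale lemmas pair a weight \<open>c k\<close> with the difference of index \<open>Suc k\<close>, whereas the
  recursion pairs \<open>\<eta> k\<close> with \<open>\<xi> k\<close>.\<close>

lemma eventually_window_shift:
  assumes "\<forall>\<^sub>F n in sequentially. \<forall>m\<ge>n. R (Suc n) (Suc m)"
  shows "\<forall>\<^sub>F n in sequentially. \<forall>m\<ge>n. R n m"
proof -
  from assms obtain N where N: "\<And>n m. N \<le> n \<Longrightarrow> n \<le> m \<Longrightarrow> R (Suc n) (Suc m)"
    by (auto simp: eventually_sequentially)
  have "R n m" if "Suc N \<le> n" "n \<le> m" for n m
    using that N[of "n - 1" "m - 1"] by (cases n; cases m) auto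
  then show ?thesis by (auto simp: eventually_sequentially)
qed

lemma window_small_shift:
  assumes "window_small (\<lambda>k. \<eta> (Suc k)) (\<lambda>k. v (Suc k))"
  shows "window_small \<eta> v"
  unfolding window_small_def
proof (intro allI impI eventually_window_shift[where R="\<lambda>n m. sum \<eta> {n..<m} \<le> 1 \<longrightarrow> norm (\<Sum>k=n..<m. \<eta> k *\<^sub>R v k) \<le> e" for e])
  fix \<epsilon> :: real assume "\<epsilon> > 0"
  with assms show "\<forall>\<^sub>F n in sequentially. \<forall>m\<ge>n. sum \<eta> {Suc n..<Suc m} \<le> 1 \<longrightarrow>
      norm (\<Sum>k=Suc n..<Suc m. \<eta> k *\<^sub>R v k) \<le> \<epsilon>"
    unfolding sum.shift_bounds_Suc_ivl window_small_def by blast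
qed

lemma window_small_componentwise:
  fixes v :: "nat \<Rightarrow> real^'n"
  assumes "\<And>i. window_small \<eta> (\<lambda>k. v k $ i)"
  shows "window_small \<eta> v"
  unfolding window_small_def
proof (intro allI impI)
  fix \<epsilon> :: real assume \<epsilon>: "\<epsilon> > 0"
  let ?e = "\<epsilon> / real CARD('n)"
  have "?e > 0" using \<epsilon> by simp
  then have "\<forall>\<^sub>F n in sequentially. \<forall>i. \<forall>m\<ge>n. (\<Sum>k=n..<m. \<eta> k) \<le> 1 \<longrightarrow>
     norm (\<Sum>k=n..<m. \<eta> k *\<^sub>R (v k $ i)) \<le> ?e"
    using assms unfolding window_small_def by (intro eventually_all_finite) blast
  then show "\<forall>\<^sub>F n in sequentially. \<forall>m\<ge>n. (\<Sum>k=n..<m. \<eta> k) \<le> 1 \<longrightarrow>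
     norm (\<Sum>k=n..<m. \<eta> k *\<^sub>R v k) \<le> \<epsilon>"
  proof eventually_elim
    case (elim n)
    show ?case
    proof (intro allI impI)
      fix m assume m: "n \<le> m" "(\<Sum>k=n..<m. \<eta> k) \<le> 1"
      have "norm (\<Sum>k=n..<m. \<eta> k *\<^sub>R v k) \<le> (\<Sum>i\<in>UNIV. \<bar>(\<Sum>k=n..<m. \<eta> k *\<^sub>R v k) $ i\<bar>)"
        by (rule norm_le_l1_cart)
      also have "\<dots> \<le> (\<Sum>i\<in>(UNIV::'n set). ?e)"
        using elim m by (intro sum_mono) (simp add: sum_component)
      also have "\<dots> = \<epsilon>" by simp
      finally show "norm (\<Sum>k=n..<m. \<eta> k *\<^sub>R v k) \<le> \<epsilon>" .
    qed
  qed
qed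

lemma (in bounded_differences) AE_window_small:
  assumes pos: "\<And>k. \<eta> k > 0" and small: "(\<lambda>k. \<eta> k * ln (real k)) \<longlonglongrightarrow> 0"
  shows "AE \<omega> in M. window_small \<eta> (\<lambda>k. Y (Suc k) \<omega>)"
proof -
  have "AE \<omega> in M. \<forall>i. \<forall>\<^sub>F n in sequentially. \<forall>m\<ge>n. (\<Sum>k=n..<m. \<eta> k) \<le> 1 \<longrightarrow>
      s * (\<Sum>k=n..<m. \<eta> k * Y (Suc k) \<omega>) < 1 / real (Suc i)" if "s = 1 \<or> s = -1" for s
    unfolding AE_all_countable by (intro allI one_sided_window_sums assms that) simp
  from this[of 1, OF disjI1[OF refl]] this[of "-1", OF disjI2[OF refl]] show ?thesis
  proof eventually_elim
    case (elim \<omega>)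
    show ?case
      unfolding window_small_def
    proof (intro allI impI)
      fix \<epsilon> :: real assume "\<epsilon> > 0"
      then obtain i where i: "1 / real (Suc i) < \<epsilon>"
        using reals_Archimedean[of \<epsilon>] by (auto simp: inverse_eq_divide)
      have "\<forall>\<^sub>F n in sequentially. \<forall>m\<ge>n. (\<Sum>k=n..<m. \<eta> k) \<le> 1 \<longrightarrow>
          (\<Sum>k=n..<m. \<eta> k * Y (Suc k) \<omega>) < 1 / real (Suc i)"
        "\<forall>\<^sub>F n in sequentially. \<forall>m\<ge>n. (\<Sum>k=n..<m. \<eta> k) \<le> 1 \<longrightarrow>
          - (\<Sum>k=n..<m. \<eta> k * Y (Suc k) \<omega>) < 1 / real (Suc i)"
        using elim unfolding mult_1 mult_minus1 by blast+
      then show "\<forall>\<^sub>F n in sequentially. \<forall>m\<ge>n. (\<Sum>k=n..<m. \<eta> k) \<le> 1 \<longrightarrow>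
          norm (\<Sum>k=n..<m. \<eta> k *\<^sub>R Y (Suc k) \<omega>) \<le> \<epsilon>"
      proof eventually_elim
        case (elim n)
        show ?case
        proof (intro allI impI)
          fix m assume "n \<le> m" "(\<Sum>k=n..<m. \<eta> k) \<le> 1"
          with elim have "(\<Sum>k=n..<m. \<eta> k * Y (Suc k) \<omega>) < 1 / real (Suc i)"
            "- (\<Sum>k=n..<m. \<eta> k * Y (Suc k) \<omega>) < 1 / real (Suc i)" by blast+
          with i show "norm (\<Sum>k=n..<m. \<eta> k *\<^sub>R Y (Suc k) \<omega>) \<le> \<epsilon>"
            unfolding real_norm_def real_scaleR_def by linarith
        qed
      qed
    qed
  qed
qed

lemma (in square_integrable_differences) AE_window_small:
  assumes "summable (\<lambda>k. (\<eta> k)\<^sup>2)"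
  shows "AE \<omega> in M. window_small \<eta> (\<lambda>k. Y (Suc k) \<omega>)"
  using weighted_sum_convergent[OF assms]
proof eventually_elim
  case (elim \<omega>)
  show ?case
    unfolding window_small_def
  proof (intro allI impI)
    fix \<epsilon> :: real assume "\<epsilon> > 0"
    from elim have "Cauchy (\<lambda>n. S \<eta> n \<omega>)" by (rule convergent_Cauchy)
    from metric_CauchyD[OF this \<open>\<epsilon> > 0\<close>] obtain N where
      N: "\<And>m n. N \<le> m \<Longrightarrow> N \<le> n \<Longrightarrow> \<bar>S \<eta> m \<omega> - S \<eta> n \<omega>\<bar> < \<epsilon>"
      by (auto simp: dist_real_def)
    have "norm (\<Sum>k=n..<m. \<eta> k *\<^sub>R Y (Suc k) \<omega>) \<le> \<epsilon>" if "N \<le> n" "n \<le> m" for n m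
    proof -
      have "(\<Sum>k=n..<m. \<eta> k * Y (Suc k) \<omega>) = S \<eta> m \<omega> - S \<eta> n \<omega>"
        using sum_diff_nat_ivl[of 0 n m "\<lambda>k. \<eta> k * Y (Suc k) \<omega>"] that by (simp add: S_def lessThan_atLeast0)
      with N[of m n] that show ?thesis by simp
    qed
    then show "\<forall>\<^sub>F n in sequentially. \<forall>m\<ge>n. (\<Sum>k=n..<m. \<eta> k) \<le> 1 \<longrightarrow>
          norm (\<Sum>k=n..<m. \<eta> k *\<^sub>R Y (Suc k) \<omega>) \<le> \<epsilon>"
      by (auto simp: eventually_sequentially)
  qed
qed


lemma sets_natural_filtration:
  "sets (natural_filtration M \<xi> k) = sigma_sets (space M) {\<xi> i -` A \<inter> space M |i A. i \<le> k \<and> A \<in> sets borel}"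
  unfolding natural_filtration_def by (rule sets_measure_of) auto

lemma space_natural_filtration: "space (natural_filtration M \<xi> k) = space M"
  unfolding natural_filtration_def by (rule space_measure_of) auto

lemma natural_filtration_subalgebra:
  assumes "\<And>k. \<xi> k \<in> borel_measurable M"
  shows "subalgebra M (natural_filtration M \<xi> k)"
  unfolding subalgebra_def sets_natural_filtration space_natural_filtration
  using assms by (auto intro!: sets.sigma_sets_subset measurable_sets)

lemma natural_filtration_mono:
  "j \<le> k \<Longrightarrow> sets (natural_filtration M \<xi> j) \<subseteq> sets (natural_filtration M \<xi> k)"
  unfolding sets_natural_filtration by (rule sigma_sets_mono') (blast intro: order_trans)

lemma natural_filtration_adapted: "\<xi> k \<in> borel_measurable (natural_filtration M \<xi> k)"
  by (rule measurableI) (auto simp: space_natural_filtration sets_natural_filtration intro!: sigma_sets.Basic)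

context
  fixes M :: "'w measure" and \<xi> :: "nat \<Rightarrow> 'w \<Rightarrow> real^'n"
  assumes prob: "prob_space M" and meas [measurable]: "\<And>k. \<xi> k \<in> borel_measurable M"
    and md: "martingale_difference M \<xi>"
begin

interpretation prob_space M by (rule prob)

abbreviation (input) past where "past \<equiv> natural_filtration M \<xi>"

lemma past_finite_subalgebra: "finite_measure_subalgebra M (past k)"
  by unfold_locales (rule natural_filtration_subalgebra[OF meas])

lemma component_martingale_differences: "martingale_differences M past (\<lambda>k \<omega>. \<xi> k \<omega> $ i)"
proof
  show "subalgebra M (past k)" for k by (rule natural_filtration_subalgebra[OF meas])
  show "sets (past j) \<subseteq> sets (past k)" if "j \<le> k" for j k using that by (rule natural_filtration_mono)
  show "(\<lambda>\<omega>. \<xi> k \<omega> $ i) \<in> borel_measurable (past k)" for k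
    by (rule measurable_compose[OF natural_filtration_adapted borel_measurable_continuous_onI])
      (intro continuous_intros)
  show "integrable M (\<lambda>\<omega>. \<xi> (Suc k) \<omega> $ i)" for k
    using md unfolding martingale_difference_def
    by (intro integrable_bounded_linear[OF bounded_linear_vec_nth]) auto
  show "AE \<omega> in M. real_cond_exp M (past k) (\<lambda>\<omega>. \<xi> (Suc k) \<omega> $ i) \<omega> = 0" for k
  proof -
    have "AE \<omega> in M. vec_cond_exp M (past k) (\<xi> (Suc k)) \<omega> = 0"
      using md unfolding martingale_difference_def by blast
    then show ?thesis
    proof eventually_elim
      case (elim \<omega>)
      then have "vec_cond_exp M (past k) (\<xi> (Suc k)) \<omega> $ i = 0" by simp
      then show ?case by (simp add: vec_cond_exp_def)
    qed
  qed
qed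

lemma bounded_noise_windows:
  assumes pos: "\<And>k. \<eta> k > 0" and small: "(\<lambda>k. \<eta> k * ln (real k)) \<longlonglongrightarrow> 0"
    and bounded: "AE \<omega> in M. \<forall>k. norm (\<xi> k \<omega>) \<le> C"
  shows "AE \<omega> in M. window_small \<eta> (\<lambda>k. \<xi> k \<omega>) \<and> window_bounded \<eta> (\<lambda>k. \<xi> k \<omega>)"
proof -
  have "(\<lambda>k. \<eta> (Suc k) * ln (real k)) \<longlonglongrightarrow> 0"
  proof (rule tendsto_sandwich[OF _ _ tendsto_const LIMSEQ_Suc[OF small]])
    show "\<forall>\<^sub>F k in sequentially. 0 \<le> \<eta> (Suc k) * ln (real k)"
      using eventually_ge_at_top[of 1] by eventually_elim (use pos in \<open>simp add: less_imp_le\<close>)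
    show "\<forall>\<^sub>F k in sequentially. \<eta> (Suc k) * ln (real k) \<le> \<eta> (Suc k) * ln (real (Suc k))"
      using eventually_ge_at_top[of 1] by eventually_elim (use pos in \<open>auto intro!: mult_left_mono less_imp_le\<close>)
  qed
  then have "AE \<omega> in M. window_small (\<lambda>k. \<eta> (Suc k)) (\<lambda>k. \<xi> (Suc k) \<omega> $ i)" for i
  proof -
    assume lim: "(\<lambda>k. \<eta> (Suc k) * ln (real k)) \<longlonglongrightarrow> 0"
    interpret martingale_differences M past "\<lambda>k \<omega>. \<xi> k \<omega> $ i" by (rule component_martingale_differences)
    interpret bounded_differences M past "\<lambda>k \<omega>. \<xi> k \<omega> $ i" C
    proof
      show "AE \<omega> in M. \<bar>\<xi> (Suc k) \<omega> $ i\<bar> \<le> C" for k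
        using bounded by eventually_elim (meson component_le_norm_cart order_trans)
    qed
    show ?thesis by (rule AE_window_small[OF pos lim])
  qed
  then have "AE \<omega> in M. \<forall>i. window_small (\<lambda>k. \<eta> (Suc k)) (\<lambda>k. \<xi> (Suc k) \<omega> $ i)"
    by (simp add: AE_all_countable)
  with bounded show ?thesis
  proof eventually_elim
    case (elim \<omega>)
    then have "window_small (\<lambda>k. \<eta> (Suc k)) (\<lambda>k. \<xi> (Suc k) \<omega>)"
      by (intro window_small_componentwise) blast
    then have "window_small \<eta> (\<lambda>k. \<xi> k \<omega>)" by (rule window_small_shift)
    moreover have "window_bounded \<eta> (\<lambda>k. \<xi> k \<omega>)"
      unfolding window_bounded_def
    proof (intro exI[of _ "max C 0"] conjI allI impI always_eventually)
      fix \<epsilon> :: real and n m assume "\<epsilon> > 0"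
      have "(\<Sum>k=n..<m. \<eta> k * norm (\<xi> k \<omega>)) \<le> (\<Sum>k=n..<m. \<eta> k * max C 0)"
        using elim(1) pos by (intro sum_mono mult_left_mono) (auto intro: less_imp_le simp: le_max_iff_disj)
      then show "(\<Sum>k=n..<m. \<eta> k * norm (\<xi> k \<omega>)) \<le> max C 0 * (\<Sum>k=n..<m. \<eta> k) + \<epsilon>"
        using \<open>\<epsilon> > 0\<close> by (simp add: sum_distrib_right[symmetric] mult.commute)
    qed simp
    ultimately show ?case by blast
  qed
qed

text \<open>Boundedness on windows: \<open>\<bar>\<xi> (k + 1)\<bar>\<close> minus its conditional expectation \<open>r k\<close> is again a square
  integrable martingale difference, hence negligible on windows, and \<open>r k \<le> 1 + \<sigma>\<^sup>2\<close> because
  \<open>y \<le> 1 + y\<^sup>2\<close>.\<close>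

lemma square_integrable_noise_windows:
  assumes pos: "\<And>k. \<eta> k > 0" and small: "summable (\<lambda>k. (\<eta> k)\<^sup>2)"
    and moment: "\<And>k. AE \<omega> in M. nn_cond_exp M (past k) (\<lambda>\<omega>. ennreal ((norm (\<xi> (Suc k) \<omega>))\<^sup>2)) \<omega> \<le> ennreal (\<sigma>\<^sup>2)"
  shows "AE \<omega> in M. window_small \<eta> (\<lambda>k. \<xi> k \<omega>) \<and> window_bounded \<eta> (\<lambda>k. \<xi> k \<omega>)"
proof -
  have small': "summable (\<lambda>k. (\<eta> (Suc k))\<^sup>2)"
    using small by (subst summable_Suc_iff)
  have nn: "(\<integral>\<^sup>+\<omega>. ennreal ((norm (\<xi> (Suc k) \<omega>))\<^sup>2) \<partial>M) \<le> ennreal (\<sigma>\<^sup>2)" for k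
  proof -
    interpret finite_measure_subalgebra M "past k" by (rule past_finite_subalgebra)
    have "(\<integral>\<^sup>+\<omega>. ennreal ((norm (\<xi> (Suc k) \<omega>))\<^sup>2) \<partial>M) =
      (\<integral>\<^sup>+\<omega>. nn_cond_exp M (past k) (\<lambda>\<omega>. ennreal ((norm (\<xi> (Suc k) \<omega>))\<^sup>2)) \<omega> \<partial>M)"
      using nn_cond_exp_intg[of "\<lambda>_. 1" "\<lambda>\<omega>. ennreal ((norm (\<xi> (Suc k) \<omega>))\<^sup>2)"] by simp
    also have "\<dots> \<le> (\<integral>\<^sup>+\<omega>. ennreal (\<sigma>\<^sup>2) \<partial>M)" by (rule nn_integral_mono_AE[OF moment])
    also have "\<dots> = ennreal (\<sigma>\<^sup>2)" by (simp add: emeasure_space_1)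
    finally show ?thesis .
  qed
  have sq_int: "integrable M (\<lambda>\<omega>. (norm (\<xi> (Suc k) \<omega>))\<^sup>2)" for k
    using order.strict_trans1[OF nn[of k]] by (intro integrableI_nonneg) auto
  have sq_le: "expectation (\<lambda>\<omega>. (norm (\<xi> (Suc k) \<omega>))\<^sup>2) \<le> \<sigma>\<^sup>2" for k
    by (subst integral_eq_nn_integral) (auto intro!: enn2real_leI nn)
  have "AE \<omega> in M. window_small (\<lambda>k. \<eta> (Suc k)) (\<lambda>k. \<xi> (Suc k) \<omega> $ i)" for i
  proof -
    interpret martingale_differences M past "\<lambda>k \<omega>. \<xi> k \<omega> $ i" by (rule component_martingale_differences)
    have le: "(\<xi> (Suc k) \<omega> $ i)\<^sup>2 \<le> (norm (\<xi> (Suc k) \<omega>))\<^sup>2" for k \<omega>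
      using component_le_norm_cart[of "\<xi> (Suc k) \<omega>" i] by (metis abs_ge_zero power2_abs power_mono)
    have int: "integrable M (\<lambda>\<omega>. (\<xi> (Suc k) \<omega> $ i)\<^sup>2)" for k
      by (rule Bochner_Integration.integrable_bound[OF sq_int[of k]]) (use le in auto)
    interpret square_integrable_differences M past "\<lambda>k \<omega>. \<xi> k \<omega> $ i" "\<sigma>\<^sup>2"
    proof
      show "expectation (\<lambda>\<omega>. (\<xi> (Suc k) \<omega> $ i)\<^sup>2) \<le> \<sigma>\<^sup>2" for k
        by (rule order_trans[OF integral_mono[OF int sq_int le] sq_le])
    qed (rule int)
    show ?thesis by (rule AE_window_small[OF small'])
  qed
  then have w1: "AE \<omega> in M. \<forall>i. window_small (\<lambda>k. \<eta> (Suc k)) (\<lambda>k. \<xi> (Suc k) \<omega> $ i)"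
    by (simp add: AE_all_countable)

  define r where "r k = real_cond_exp M (past k) (\<lambda>\<omega>. norm (\<xi> (Suc k) \<omega>))" for k
  have r_F [measurable]: "r k \<in> borel_measurable (past k)" for k
    unfolding r_def by (rule borel_measurable_cond_exp)
  have r_M [measurable]: "r k \<in> borel_measurable M" for k
    unfolding r_def by (rule borel_measurable_cond_exp2)
  have r_bound: "AE \<omega> in M. \<bar>r k \<omega>\<bar> \<le> 1 + \<sigma>\<^sup>2" for k
  proof -
    interpret finite_measure_subalgebra M "past k" by (rule past_finite_subalgebra)
    have "AE \<omega> in M. ennreal \<bar>r k \<omega>\<bar> \<le> nn_cond_exp M (past k) (\<lambda>\<omega>. ennreal (norm (\<xi> (Suc k) \<omega>))) \<omega>"
      using real_cond_exp_abs[of "\<lambda>\<omega>. norm (\<xi> (Suc k) \<omega>)"] by (simp add: r_def)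
    moreover have "AE \<omega> in M. nn_cond_exp M (past k) (\<lambda>\<omega>. ennreal (norm (\<xi> (Suc k) \<omega>))) \<omega>
        \<le> nn_cond_exp M (past k) (\<lambda>\<omega>. 1 + ennreal ((norm (\<xi> (Suc k) \<omega>))\<^sup>2)) \<omega>"
    proof (rule nn_cond_exp_mono[OF AE_I2])
      fix \<omega>
      have "y \<le> 1 + y\<^sup>2" for y :: real
        using zero_le_power2[of "y - 1 / 2"] unfolding power2_diff by (simp add: power2_eq_square)
      then have "ennreal (norm (\<xi> (Suc k) \<omega>)) \<le> ennreal (1 + (norm (\<xi> (Suc k) \<omega>))\<^sup>2)" by (intro ennreal_leI)
      then show "ennreal (norm (\<xi> (Suc k) \<omega>)) \<le> 1 + ennreal ((norm (\<xi> (Suc k) \<omega>))\<^sup>2)" by (simp add: ennreal_plus)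
    qed simp_all
    moreover have "AE \<omega> in M. nn_cond_exp M (past k) (\<lambda>\<omega>. 1) \<omega> + nn_cond_exp M (past k) (\<lambda>\<omega>. ennreal ((norm (\<xi> (Suc k) \<omega>))\<^sup>2)) \<omega>
        = nn_cond_exp M (past k) (\<lambda>\<omega>. 1 + ennreal ((norm (\<xi> (Suc k) \<omega>))\<^sup>2)) \<omega>"
      by (rule nn_cond_exp_sum) auto
    moreover have "AE \<omega> in M. (1::ennreal) = nn_cond_exp M (past k) (\<lambda>\<omega>. 1) \<omega>"
      by (rule nn_cond_exp_F_meas) simp
    ultimately show ?thesis
      using moment[of k]
    proof eventually_elim
      case (elim \<omega>)
      have "ennreal \<bar>r k \<omega>\<bar> \<le> 1 + nn_cond_exp M (past k) (\<lambda>\<omega>. ennreal ((norm (\<xi> (Suc k) \<omega>))\<^sup>2)) \<omega>"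
      proof -
        note elim(1)
        also note elim(2)
        also note elim(3)[symmetric]
        finally show ?thesis by (simp only: elim(4)[symmetric])
      qed
      also have "\<dots> \<le> 1 + ennreal (\<sigma>\<^sup>2)" by (intro add_left_mono elim(5))
      also have "\<dots> = ennreal (1 + \<sigma>\<^sup>2)" by (simp add: ennreal_plus)
      finally show ?case by (subst (asm) ennreal_le_iff) (simp_all add: add_nonneg_nonneg)
    qed
  qed
  define Z where "Z = (\<lambda>k \<omega>. case k of 0 \<Rightarrow> 0 | Suc j \<Rightarrow> norm (\<xi> k \<omega>) - r j \<omega>)"
  have norm_int: "integrable M (\<lambda>\<omega>. norm (\<xi> (Suc k) \<omega>))" for k
    using md unfolding martingale_difference_def by (intro integrable_norm) auto
  have r_int: "integrable M (r k)" for k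
  proof -
    interpret finite_measure_subalgebra M "past k" by (rule past_finite_subalgebra)
    show ?thesis unfolding r_def by (rule real_cond_exp_int(1)[OF norm_int])
  qed
  interpret Z: martingale_differences M past Z
  proof
    show "subalgebra M (past k)" for k by (rule natural_filtration_subalgebra[OF meas])
    show "sets (past j) \<subseteq> sets (past k)" if "j \<le> k" for j k using that by (rule natural_filtration_mono)
    show "Z k \<in> borel_measurable (past k)" for k
    proof (cases k)
      case (Suc j)
      have "r j \<in> borel_measurable (past k)"
        using Suc by (intro measurable_from_subalg[OF _ r_F])
          (simp add: subalgebra_def space_natural_filtration natural_filtration_mono)
      moreover have "(\<lambda>\<omega>. norm (\<xi> k \<omega>)) \<in> borel_measurable (past k)"
        using natural_filtration_adapted by measurable
      ultimately show ?thesis unfolding Z_def Suc nat.case by (intro borel_measurable_diff)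
    qed (simp add: Z_def)
    show "integrable M (Z (Suc k))" for k
      unfolding Z_def nat.case by (intro Bochner_Integration.integrable_diff norm_int r_int)
    show "AE \<omega> in M. real_cond_exp M (past k) (Z (Suc k)) \<omega> = 0" for k
    proof -
      interpret finite_measure_subalgebra M "past k" by (rule past_finite_subalgebra)
      have "AE \<omega> in M. real_cond_exp M (past k) (\<lambda>\<omega>. norm (\<xi> (Suc k) \<omega>) - r k \<omega>) \<omega> =
          r k \<omega> - real_cond_exp M (past k) (r k) \<omega>"
        using real_cond_exp_diff[OF norm_int r_int, of k k] by (simp add: r_def)
      moreover have "AE \<omega> in M. real_cond_exp M (past k) (r k) \<omega> = r k \<omega>"
        by (rule real_cond_exp_F_meas[OF r_int r_F])
      ultimately show ?thesis unfolding Z_def nat.case by eventually_elim simp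
    qed
  qed
  have Z_sq: "AE \<omega> in M. (Z (Suc k) \<omega>)\<^sup>2 \<le> 2 * (norm (\<xi> (Suc k) \<omega>))\<^sup>2 + 2 * (1 + \<sigma>\<^sup>2)\<^sup>2" for k
    using r_bound[of k]
  proof eventually_elim
    case (elim \<omega>)
    have "(r k \<omega>)\<^sup>2 \<le> (1 + \<sigma>\<^sup>2)\<^sup>2" using elim by (metis abs_ge_zero power2_abs power_mono)
    moreover have "(Z (Suc k) \<omega>)\<^sup>2 + (norm (\<xi> (Suc k) \<omega>) + r k \<omega>)\<^sup>2 = 2 * (norm (\<xi> (Suc k) \<omega>))\<^sup>2 + 2 * (r k \<omega>)\<^sup>2"
      by (simp add: Z_def power2_sum power2_diff)
    moreover have "0 \<le> (norm (\<xi> (Suc k) \<omega>) + r k \<omega>)\<^sup>2" by simp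
    ultimately show ?case by linarith
  qed
  have bound_int: "integrable M (\<lambda>\<omega>. 2 * (norm (\<xi> (Suc k) \<omega>))\<^sup>2 + 2 * (1 + \<sigma>\<^sup>2)\<^sup>2)" for k
    using sq_int by simp
  have Z_sq_int: "integrable M (\<lambda>\<omega>. (Z (Suc k) \<omega>)\<^sup>2)" for k
    by (rule Bochner_Integration.integrable_bound[OF bound_int[of k]])
      (use Z_sq[of k] in \<open>auto elim!: eventually_mono\<close>)
  interpret square_integrable_differences M past Z "2 * \<sigma>\<^sup>2 + 2 * (1 + \<sigma>\<^sup>2)\<^sup>2"
  proof
    show "expectation (\<lambda>\<omega>. (Z (Suc k) \<omega>)\<^sup>2) \<le> 2 * \<sigma>\<^sup>2 + 2 * (1 + \<sigma>\<^sup>2)\<^sup>2" for k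
    proof -
      have "expectation (\<lambda>\<omega>. (Z (Suc k) \<omega>)\<^sup>2) \<le> expectation (\<lambda>\<omega>. 2 * (norm (\<xi> (Suc k) \<omega>))\<^sup>2 + 2 * (1 + \<sigma>\<^sup>2)\<^sup>2)"
        by (rule integral_mono_AE[OF Z_sq_int bound_int Z_sq])
      also have "\<dots> = 2 * expectation (\<lambda>\<omega>. (norm (\<xi> (Suc k) \<omega>))\<^sup>2) + 2 * (1 + \<sigma>\<^sup>2)\<^sup>2"
        using sq_int by (simp add: Bochner_Integration.integral_add prob_space)
      finally show ?thesis using sq_le[of k] by linarith
    qed
  qed (rule Z_sq_int)
  have w2: "AE \<omega> in M. window_small (\<lambda>k. \<eta> (Suc k)) (\<lambda>k. Z (Suc k) \<omega>)"
    by (rule AE_window_small[OF small'])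
  have r_all: "AE \<omega> in M. \<forall>k. \<bar>r k \<omega>\<bar> \<le> 1 + \<sigma>\<^sup>2" using r_bound by (simp add: AE_all_countable)
  from w1 w2 r_all show ?thesis
  proof eventually_elim
    case (elim \<omega>)
    then have "window_small (\<lambda>k. \<eta> (Suc k)) (\<lambda>k. \<xi> (Suc k) \<omega>)"
      by (intro window_small_componentwise) blast
    then have "window_small \<eta> (\<lambda>k. \<xi> k \<omega>)" by (rule window_small_shift)
    moreover have "window_small \<eta> (\<lambda>k. Z k \<omega>)" using elim(2) by (rule window_small_shift)
    have "window_bounded \<eta> (\<lambda>k. \<xi> k \<omega>)"
      unfolding window_bounded_def
    proof (intro exI[of _ "1 + \<sigma>\<^sup>2"] conjI allI impI)
      fix \<epsilon> :: real assume "\<epsilon> > 0"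
      then have "\<forall>\<^sub>F n in sequentially. \<forall>m\<ge>n. (\<Sum>k=n..<m. \<eta> k) \<le> 1 \<longrightarrow> norm (\<Sum>k=n..<m. \<eta> k *\<^sub>R Z k \<omega>) \<le> \<epsilon>"
        using \<open>window_small \<eta> (\<lambda>k. Z k \<omega>)\<close> unfolding window_small_def by blast
      then show "\<forall>\<^sub>F n in sequentially. \<forall>m\<ge>n. (\<Sum>k=n..<m. \<eta> k) \<le> 1 \<longrightarrow>
        (\<Sum>k=n..<m. \<eta> k * norm (\<xi> k \<omega>)) \<le> (1 + \<sigma>\<^sup>2) * (\<Sum>k=n..<m. \<eta> k) + \<epsilon>"
        using eventually_ge_at_top[of 1]
      proof eventually_elim
        case (elim n)
        note n = this
        show ?case
        proof (intro allI impI)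
          fix m assume m: "n \<le> m" "(\<Sum>k=n..<m. \<eta> k) \<le> 1"
          have "(\<Sum>k=n..<m. \<eta> k * norm (\<xi> k \<omega>)) \<le> (\<Sum>k=n..<m. \<eta> k *\<^sub>R Z k \<omega> + (1 + \<sigma>\<^sup>2) * \<eta> k)"
          proof (rule sum_mono)
            fix k assume "k \<in> {n..<m}"
            with n obtain j where k: "k = Suc j" by (cases k) auto
            have "norm (\<xi> k \<omega>) \<le> Z k \<omega> + (1 + \<sigma>\<^sup>2)"
              using \<open>\<forall>k. \<bar>r k \<omega>\<bar> \<le> 1 + \<sigma>\<^sup>2\<close>[rule_format, of j] unfolding Z_def k nat.case by linarith
            then have "\<eta> k * norm (\<xi> k \<omega>) \<le> \<eta> k * (Z k \<omega> + (1 + \<sigma>\<^sup>2))"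
              using pos by (intro mult_left_mono) (auto intro: less_imp_le)
            then show "\<eta> k * norm (\<xi> k \<omega>) \<le> \<eta> k *\<^sub>R Z k \<omega> + (1 + \<sigma>\<^sup>2) * \<eta> k" by (simp add: algebra_simps)
          qed
          also have "\<dots> = (\<Sum>k=n..<m. \<eta> k *\<^sub>R Z k \<omega>) + (1 + \<sigma>\<^sup>2) * (\<Sum>k=n..<m. \<eta> k)"
            by (simp add: sum.distrib sum_distrib_left)
          also have "(\<Sum>k=n..<m. \<eta> k *\<^sub>R Z k \<omega>) \<le> \<epsilon>"
          proof -
            have "norm (\<Sum>k=n..<m. \<eta> k *\<^sub>R Z k \<omega>) \<le> \<epsilon>" using n(1) m by blast
            then show ?thesis unfolding real_norm_def by linarith
          qed
          finally show "(\<Sum>k=n..<m. \<eta> k * norm (\<xi> k \<omega>)) \<le> (1 + \<sigma>\<^sup>2) * (\<Sum>k=n..<m. \<eta> k) + \<epsilon>" by simp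
        qed
      qed
    qed simp
    with \<open>window_small \<eta> (\<lambda>k. \<xi> k \<omega>)\<close> show ?case by blast
  qed
qed

end

section \<open>Lipschitz curves and their limits\<close>

lemma AE_lebesgue_on_negligible:
  fixes a b :: real
  assumes "AE t in lebesgue_on {a..b}. Q t"
  shows "negligible {t\<in>{a..b}. \<not> Q t}"
proof -
  have "AE t in lebesgue. t \<in> {a..b} \<longrightarrow> Q t"
    using assms by (subst (asm) AE_restrict_space_iff) auto
  then obtain N where "N \<in> null_sets lebesgue" "{t. \<not> (t \<in> {a..b} \<longrightarrow> Q t)} \<subseteq> N"
    unfolding eventually_ae_filter by auto
  moreover have "{t\<in>{a..b}. \<not> Q t} \<subseteq> {t. \<not> (t \<in> {a..b} \<longrightarrow> Q t)}" by auto
  ultimately show ?thesis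
    unfolding negligible_iff_null_sets[symmetric] by (meson negligible_subset)
qed

lemma AE_lebesgue_on_frequently:
  fixes a b :: real
  assumes "AE t in lebesgue_on {a..b}. Q t" "a \<le> c" "c < d" "d \<le> b"
  obtains t where "c < t" "t < d" "Q t"
proof -
  have "\<not> negligible {c<..<d}"
    using negligible_interval(2)[of c d] \<open>c < d\<close> by simp
  then have "\<not> {c<..<d} \<subseteq> {t\<in>{a..b}. \<not> Q t}"
    using AE_lebesgue_on_negligible[OF assms(1)] negligible_subset by blast
  then show thesis using that assms(2-4) by force
qed

text \<open>Suppose \<open>g a < g b\<close>. Every value \<open>y\<close> between them is attained at a last time, after which \<open>g\<close> is
  larger than \<open>y\<close>; the derivative there cannot be negative. So the interval of these values lies in the
  image of a null set, which is null since \<open>g\<close> is locally Lipschitz.\<close>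

lemma decreasing_if_AE_derivative_neg:
  fixes g :: "real \<Rightarrow> real"
  assumes cont: "continuous_on {a..b} g"
    and lip: "\<And>t. t \<in> {a..b} \<Longrightarrow> \<exists>T B. open T \<and> t \<in> T \<and> (\<forall>s\<in>{a..b} \<inter> T. norm (g s - g t) \<le> B * norm (s - t))"
    and deriv: "negligible {t\<in>{a..b}. \<not> (\<exists>D<0. (g has_real_derivative D) (at t within {a..b}))}" (is "negligible ?N")
    and "a \<le> b"
  shows "g b \<le> g a"
proof (rule ccontr)
  assume "\<not> g b \<le> g a"
  then have less: "g a < g b" by simp
  have "{g a<..<g b} \<subseteq> g ` ?N"
  proof
    fix y assume y: "y \<in> {g a<..<g b}"
    define K where "K = {s\<in>{a..b}. g s \<le> y}"
    have "closed K" unfolding K_def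
      by (intro continuous_on_closed_Collect_le cont continuous_intros)
    moreover have "bounded K" unfolding K_def by (rule bounded_subset[of "{a..b}"]) auto
    ultimately have "compact K" by (simp add: compact_eq_bounded_closed)
    moreover have "a \<in> K" using y \<open>a \<le> b\<close> by (simp add: K_def)
    ultimately obtain t where t: "t \<in> K" and max: "\<And>s. s \<in> K \<Longrightarrow> s \<le> t"
      using compact_attains_sup[of K] by auto
    have tb: "t < b" using t y by (cases "t = b") (auto simp: K_def)
    have above: "y < g s" if "t < s" "s \<le> b" for s
      using max[of s] that t by (force simp: K_def)
    have "g t = y"
    proof (rule ccontr)
      assume "g t \<noteq> y"
      with t have "g t < y" by (simp add: K_def)
      moreover have "y \<le> g b" using y by simp
      ultimately obtain s where s: "t \<le> s" "s \<le> b" "g s = y"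
        using IVT'[of g t y b] t tb continuous_on_subset[OF cont, of "{t..b}"] by (auto simp: K_def)
      with above[of s] \<open>g t < y\<close> show False by (cases "s = t") auto
    qed
    moreover have "t \<in> ?N"
    proof (rule ccontr)
      assume "t \<notin> ?N"
      with t obtain D where "D < 0" "(g has_real_derivative D) (at t within {a..b})" by (auto simp: K_def)
      from has_real_derivative_neg_dec_right[OF this(2,1)] obtain d where d: "d > 0"
        "\<And>h. h > 0 \<Longrightarrow> t + h \<in> {a..b} \<Longrightarrow> h < d \<Longrightarrow> g (t + h) < g t" by auto
      define h where "h = min (d / 2) (b - t)"
      have "h > 0" "h < d" "t + h \<le> b" using d(1) tb by (auto simp: h_def)
      moreover have "a \<le> t" using t by (simp add: K_def)
      ultimately have "g (t + h) < g t" using d(2)[of h] by auto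
      moreover have "y < g (t + h)" using above[of "t + h"] \<open>h > 0\<close> \<open>t + h \<le> b\<close> by simp
      ultimately show False using \<open>g t = y\<close> by simp
    qed
    ultimately show "y \<in> g ` ?N" by blast
  qed
  moreover have "negligible (g ` ?N)"
  proof (rule negligible_locally_Lipschitz_image[OF _ deriv])
    fix t assume "t \<in> ?N"
    then have "t \<in> {a..b}" by simp
    from lip[OF this] obtain T B where "open T" "t \<in> T"
      "\<And>s. s\<in>{a..b} \<inter> T \<Longrightarrow> norm (g s - g t) \<le> B * norm (s - t)" by blast
    then show "\<exists>T B. open T \<and> t \<in> T \<and> (\<forall>s\<in>?N \<inter> T. norm (g s - g t) \<le> B * norm (s - t))"
      by (intro exI[of _ T] exI[of _ B]) blast
  qed simp
  ultimately have "negligible {g a<..<g b}" by (rule negligible_subset[rotated])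
  then show False using negligible_interval(2)[of "g a" "g b"] less by simp
qed

text \<open>Tilting \<open>g\<close> by a slope slightly above \<open>c\<close> reduces this to strictly negative derivatives.\<close>

lemma growth_le_if_AE_derivative_le:
  fixes g :: "real \<Rightarrow> real"
  assumes cont: "continuous_on {a..b} g"
    and lip: "\<And>t. t \<in> {a..b} \<Longrightarrow> \<exists>T B. open T \<and> t \<in> T \<and> (\<forall>s\<in>{a..b} \<inter> T. norm (g s - g t) \<le> B * norm (s - t))"
    and deriv: "negligible {t\<in>{a..b}. \<not> (\<exists>D\<le>c. (g has_real_derivative D) (at t within {a..b}))}" (is "negligible ?N")
    and "a \<le> b"
  shows "g b \<le> g a + c * (b - a)"
proof (rule field_le_epsilon)
  fix e :: real assume "e > 0"
  define \<epsilon> where "\<epsilon> = e / (b - a + 1)"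
  have \<epsilon>: "\<epsilon> > 0" "\<epsilon> * (b - a) \<le> e"
  proof -
    show "\<epsilon> > 0" using \<open>e > 0\<close> \<open>a \<le> b\<close> by (simp add: \<epsilon>_def)
    then have "\<epsilon> * (b - a) \<le> \<epsilon> * (b - a + 1)" by (intro mult_left_mono) auto
    also have "\<dots> = e" using \<open>a \<le> b\<close> by (simp add: \<epsilon>_def)
    finally show "\<epsilon> * (b - a) \<le> e" .
  qed
  let ?g = "\<lambda>t. g t - (c + \<epsilon>) * t"
  have "?g b \<le> ?g a"
  proof (rule decreasing_if_AE_derivative_neg[OF _ _ _ \<open>a \<le> b\<close>])
    show "continuous_on {a..b} ?g" by (intro continuous_intros cont)
    show "\<exists>T B. open T \<and> t \<in> T \<and> (\<forall>s\<in>{a..b} \<inter> T. norm (?g s - ?g t) \<le> B * norm (s - t))"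
      if t: "t \<in> {a..b}" for t
    proof -
      from lip[OF t] obtain T B where T: "open T" "t \<in> T"
        "\<And>s. s\<in>{a..b} \<inter> T \<Longrightarrow> norm (g s - g t) \<le> B * norm (s - t)" by blast
      have "norm (?g s - ?g t) \<le> (B + \<bar>c + \<epsilon>\<bar>) * norm (s - t)" if "s\<in>{a..b} \<inter> T" for s
      proof -
        have "?g s - ?g t = (g s - g t) - (c + \<epsilon>) * (s - t)" by (simp add: algebra_simps)
        then have "norm (?g s - ?g t) \<le> norm (g s - g t) + norm ((c + \<epsilon>) * (s - t))"
          using norm_triangle_ineq4 by metis
        also have "\<dots> \<le> B * norm (s - t) + \<bar>c + \<epsilon>\<bar> * norm (s - t)"
          using T(3)[OF that] by (simp add: abs_mult)
        finally show ?thesis by (simp add: algebra_simps)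
      qed
      with T(1,2) show ?thesis by blast
    qed
    show "negligible {t\<in>{a..b}. \<not> (\<exists>D<0. (?g has_real_derivative D) (at t within {a..b}))}"
    proof (rule negligible_subset[OF deriv], clarify)
      fix t D assume no: "\<not> (\<exists>D<0. (?g has_real_derivative D) (at t within {a..b}))"
        and "D \<le> c" "(g has_real_derivative D) (at t within {a..b})"
      then have "(?g has_real_derivative D - (c + \<epsilon>)) (at t within {a..b})"
        by (auto intro!: derivative_eq_intros)
      moreover have "D - (c + \<epsilon>) < 0" using \<open>D \<le> c\<close> \<epsilon>(1) by simp
      ultimately show False using no by blast
    qed
  qed
  then show "g b \<le> g a + c * (b - a) + e" using \<epsilon>(2) by (simp add: algebra_simps)
qed

text \<open>A variant of the Arzela-Ascoli theorem for functions that may be discontinuous: they are Lipschitz up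
  to an error that vanishes along the sequence. A diagonal argument gives a subsequence that converges
  at all rationals, and the Lipschitz bound extends convergence to the other points.
  Convergence is stated along moving arguments \<open>tj\<close> and further subsequences \<open>u\<close>; this replaces uniform convergence.\<close>

lemma asymptotically_lipschitz_limit:
  fixes G :: "nat \<Rightarrow> real \<Rightarrow> 'b::euclidean_space"
  assumes bnd: "\<And>j t. t \<in> {0..1} \<Longrightarrow> norm (G j t) \<le> B" and "L \<ge> 0"
    and lip: "\<And>\<epsilon>. \<epsilon> > 0 \<Longrightarrow> \<forall>\<^sub>F j in sequentially. \<forall>s\<in>{0..1}. \<forall>t\<in>{0..1}. norm (G j s - G j t) \<le> L * \<bar>s - t\<bar> + \<epsilon>"
  obtains r Z where "strict_mono (r :: nat \<Rightarrow> nat)" "L-lipschitz_on {0..1} Z"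
    "\<And>u t tj. filterlim u at_top sequentially \<Longrightarrow> (\<And>j. tj j \<in> {0..1}) \<Longrightarrow> tj \<longlonglongrightarrow> t \<Longrightarrow>
      (\<lambda>j. G (r (u j)) (tj j)) \<longlonglongrightarrow> Z t"
proof -
  have "countable (\<rat> \<inter> {0..1::real})" by (intro countable_Int1 countable_rat)
  then obtain r where r: "strict_mono (r :: nat \<Rightarrow> nat)"
    and rat: "\<And>q. q \<in> \<rat> \<inter> {0..1} \<Longrightarrow> \<exists>l. (\<lambda>j. G (r j) q) \<longlonglongrightarrow> l"
    using function_convergent_subsequence[of "\<rat> \<inter> {0..1}" G B] bnd by blast
  have lip_r: "\<forall>\<^sub>F j in sequentially. \<forall>s\<in>{0..1}. \<forall>t\<in>{0..1}. norm (G (r j) s - G (r j) t) \<le> L * \<bar>s - t\<bar> + \<epsilon>"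
    if "\<epsilon> > 0" for \<epsilon>
    using lip[OF that] r by (rule eventually_subseq[rotated])
  have "\<exists>l. (\<lambda>j. G (r j) t) \<longlonglongrightarrow> l" if t: "t \<in> {0..1}" for t
  proof -
    have "Cauchy (\<lambda>j. G (r j) t)"
    proof (rule metric_CauchyI)
      fix e :: real assume "e > 0"
      define d where "d = e / 8 / (L + 1)"
      have "d > 0" using \<open>e > 0\<close> \<open>L \<ge> 0\<close> by (simp add: d_def)
      have Ld: "L * d \<le> e / 8"
      proof -
        have "L * d \<le> (L + 1) * d" using \<open>d > 0\<close> by (intro mult_right_mono) auto
        also have "\<dots> = e / 8" using \<open>L \<ge> 0\<close> unfolding d_def times_divide_eq_right[of "L + 1" "e / 8" "L + 1"]
          by (intro nonzero_mult_div_cancel_left) simp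
        finally show ?thesis .
      qed
      obtain q where q: "q \<in> \<rat> \<inter> {0..1}" "\<bar>t - q\<bar> < d"
      proof (cases "t = 1")
        case True
        then show thesis using that[of 1] \<open>d > 0\<close> by simp
      next
        case False
        with t \<open>d > 0\<close> have "t < min 1 (t + d)" by auto
        from Rats_dense_in_real[OF this] obtain q where "q \<in> \<rat>" "t < q" "q < min 1 (t + d)" by blast
        then show thesis using that[of q] t by auto
      qed
      from rat[OF q(1)] have "Cauchy (\<lambda>j. G (r j) q)" using LIMSEQ_imp_Cauchy by blast
      from metric_CauchyD[OF this, of "e / 4"] \<open>e > 0\<close> obtain N1 where
        N1: "\<And>m n. N1 \<le> m \<Longrightarrow> N1 \<le> n \<Longrightarrow> dist (G (r m) q) (G (r n) q) < e / 4" by auto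
      have "e / 8 > 0" using \<open>e > 0\<close> by simp
      from lip_r[OF this] obtain N2 where
        N2: "\<And>j s t. N2 \<le> j \<Longrightarrow> s \<in> {0..1} \<Longrightarrow> t \<in> {0..1} \<Longrightarrow> norm (G (r j) s - G (r j) t) \<le> L * \<bar>s - t\<bar> + e / 8"
        unfolding eventually_sequentially by blast
      have close: "dist (G (r j) t) (G (r j) q) \<le> e / 4" if "N2 \<le> j" for j
      proof -
        have "L * \<bar>t - q\<bar> \<le> L * d" using q \<open>L \<ge> 0\<close> by (intro mult_left_mono) auto
        then show ?thesis using N2[OF that t, of q] q Ld by (simp add: dist_norm)
      qed
      show "\<exists>N. \<forall>m\<ge>N. \<forall>n\<ge>N. dist (G (r m) t) (G (r n) t) < e"
      proof (intro exI[of _ "max N1 N2"] allI impI)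
        fix m n assume "max N1 N2 \<le> m" "max N1 N2 \<le> n"
        then have "dist (G (r m) q) (G (r n) q) < e / 4" "dist (G (r m) t) (G (r m) q) \<le> e / 4"
          "dist (G (r n) t) (G (r n) q) \<le> e / 4" using N1[of m n] close[of m] close[of n] by simp_all
        moreover have "dist (G (r m) t) (G (r n) t) \<le>
            dist (G (r m) t) (G (r m) q) + dist (G (r m) q) (G (r n) q) + dist (G (r n) t) (G (r n) q)"
          using dist_triangle[of "G (r m) t" "G (r n) t" "G (r m) q"]
            dist_triangle[of "G (r m) q" "G (r n) t" "G (r n) q"]
            dist_commute[of "G (r n) t" "G (r n) q"] by linarith
        ultimately show "dist (G (r m) t) (G (r n) t) < e" using \<open>e > 0\<close> by linarith
      qed
    qed
    then show ?thesis by (simp add: Cauchy_convergent_iff convergent_def)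
  qed
  then obtain Z where Z: "\<And>t. t \<in> {0..1} \<Longrightarrow> (\<lambda>j. G (r j) t) \<longlonglongrightarrow> Z t" by metis
  show thesis
  proof
    show "strict_mono r" by (rule r)
    show "L-lipschitz_on {0..1} Z"
    proof (rule lipschitz_onI[OF _ \<open>L \<ge> 0\<close>])
      fix s t :: real assume st: "s \<in> {0..1}" "t \<in> {0..1}"
      have "norm (Z s - Z t) \<le> L * \<bar>s - t\<bar> + \<epsilon>" if "\<epsilon> > 0" for \<epsilon>
      proof (rule tendsto_upperbound)
        show "(\<lambda>j. norm (G (r j) s - G (r j) t)) \<longlonglongrightarrow> norm (Z s - Z t)"
          by (intro tendsto_intros Z st)
        show "\<forall>\<^sub>F j in sequentially. norm (G (r j) s - G (r j) t) \<le> L * \<bar>s - t\<bar> + \<epsilon>"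
          using lip_r[OF that] by eventually_elim (use st in blast)
      qed simp
      then show "dist (Z s) (Z t) \<le> L * dist s t"
        by (simp add: dist_norm field_le_epsilon)
    qed
    fix t and u :: "nat \<Rightarrow> nat" and tj :: "nat \<Rightarrow> real"
    assume u: "filterlim u at_top sequentially" and tj: "\<And>j. tj j \<in> {0..1}" "tj \<longlonglongrightarrow> t"
    have t: "t \<in> {0..1}"
      using closed_sequentially[OF closed_atLeastAtMost, of tj 0 1 t] tj by blast
    have "(\<lambda>j. G (r (u j)) (tj j) - G (r (u j)) t) \<longlonglongrightarrow> 0"
    proof (rule LIMSEQ_I)
      fix e :: real assume "e > 0"
      have "(\<lambda>j. L * \<bar>tj j - t\<bar>) \<longlonglongrightarrow> L * \<bar>t - t\<bar>" by (intro tendsto_intros tj(2))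
      then have "\<forall>\<^sub>F j in sequentially. L * \<bar>tj j - t\<bar> < e / 2"
        using \<open>e > 0\<close> by (intro order_tendstoD(2)) auto
      moreover have "e / 2 > 0" using \<open>e > 0\<close> by simp
      from filterlim_iff[THEN iffD1, rule_format, OF u lip_r[OF this]]
      have "\<forall>\<^sub>F j in sequentially. \<forall>s\<in>{0..1}. \<forall>t\<in>{0..1}. norm (G (r (u j)) s - G (r (u j)) t) \<le> L * \<bar>s - t\<bar> + e / 2" .
      ultimately have "\<forall>\<^sub>F j in sequentially. norm (G (r (u j)) (tj j) - G (r (u j)) t - 0) < e"
      proof eventually_elim
        case (elim j)
        then have "norm (G (r (u j)) (tj j) - G (r (u j)) t) \<le> L * \<bar>tj j - t\<bar> + e / 2" using tj t by blast
        with elim(1) show ?case by simp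
      qed
      then show "\<exists>no. \<forall>n\<ge>no. norm (G (r (u n)) (tj n) - G (r (u n)) t - 0) < e"
        by (simp add: eventually_sequentially)
    qed
    moreover have "(\<lambda>j. G (r (u j)) t) \<longlonglongrightarrow> Z t" by (rule filterlim_compose[OF Z[OF t] u])
    ultimately show "(\<lambda>j. G (r (u j)) (tj j)) \<longlonglongrightarrow> Z t" using tendsto_add by fastforce
  qed
qed

lemma lipschitz_imp_abs_cont_on:
  assumes "L-lipschitz_on {a..b} \<gamma>"
  shows "abs_cont_on a b \<gamma>"
  unfolding abs_cont_on_def
proof (intro allI impI)
  fix \<epsilon> :: real assume "\<epsilon> > 0"
  have L: "L \<ge> 0" using assms by (rule lipschitz_on_nonneg)
  show "\<exists>\<delta>>0. \<forall>(n::nat) u v.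
        (\<forall>i<n. a \<le> u i \<and> u i \<le> v i \<and> v i \<le> b) \<longrightarrow>
        (\<forall>i<n. \<forall>j<n. i \<noteq> j \<longrightarrow> {u i<..<v i} \<inter> {u j<..<v j} = {}) \<longrightarrow>
        (\<Sum>i<n. v i - u i) < \<delta> \<longrightarrow>
        (\<Sum>i<n. norm (\<gamma> (v i) - \<gamma> (u i))) < \<epsilon>"
  proof (intro exI[of _ "\<epsilon> / (L + 1)"] conjI allI impI)
    show "0 < \<epsilon> / (L + 1)" using \<open>\<epsilon> > 0\<close> L by simp
    fix n and u v :: "nat \<Rightarrow> real"
    assume uv: "\<forall>i<n. a \<le> u i \<and> u i \<le> v i \<and> v i \<le> b" and less: "(\<Sum>i<n. v i - u i) < \<epsilon> / (L + 1)"
    have "(\<Sum>i<n. norm (\<gamma> (v i) - \<gamma> (u i))) \<le> (\<Sum>i<n. (L + 1) * (v i - u i))"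
    proof (rule sum_mono)
      fix i assume "i \<in> {..<n}"
      then have i: "a \<le> u i" "u i \<le> v i" "v i \<le> b" using uv by auto
      have "norm (\<gamma> (v i) - \<gamma> (u i)) \<le> L * (v i - u i)"
        using lipschitz_onD[OF assms, of "v i" "u i"] i by (simp add: dist_norm)
      also have "\<dots> \<le> (L + 1) * (v i - u i)" using i by (intro mult_right_mono) auto
      finally show "norm (\<gamma> (v i) - \<gamma> (u i)) \<le> (L + 1) * (v i - u i)" .
    qed
    also have "\<dots> = (L + 1) * (\<Sum>i<n. v i - u i)" by (rule sum_distrib_left[symmetric])
    also have "\<dots> < (L + 1) * (\<epsilon> / (L + 1))" using less L by (intro mult_strict_left_mono) auto
    finally show "(\<Sum>i<n. norm (\<gamma> (v i) - \<gamma> (u i))) < \<epsilon>" using L by simp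
  qed
qed

section \<open>Maps with closed graph\<close>

text \<open>Otherwise there are values at points converging to \<open>x\<close> that stay away from \<open>D x\<close>; by compactness
  of the ball some of them converge, and the closed graph puts the limit into \<open>D x\<close>.\<close>

lemma closed_graph_upper_semicontinuous:
  fixes D :: "'a::euclidean_space \<Rightarrow> 'a set"
  assumes graph: "closed {(x, v). v \<in> D x}" and "\<epsilon> > 0"
  obtains \<rho> where "\<rho> > 0"
    "\<And>y v. dist y x < \<rho> \<Longrightarrow> v \<in> D y \<Longrightarrow> norm v \<le> R \<Longrightarrow> \<exists>c\<in>D x \<inter> cball 0 R. norm (v - c) \<le> \<epsilon>"
proof (rule ccontr)
  assume "\<not> thesis"
  with that have "\<not> (\<forall>y v. dist y x < \<rho> \<longrightarrow> v \<in> D y \<longrightarrow> norm v \<le> R \<longrightarrow> (\<exists>c\<in>D x \<inter> cball 0 R. norm (v - c) \<le> \<epsilon>))"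
    if "\<rho> > 0" for \<rho> using \<open>\<rho> > 0\<close> by blast
  then have "\<exists>y v. dist y x < inverse (real (Suc n)) \<and> v \<in> D y \<and> norm v \<le> R \<and> (\<forall>c\<in>D x \<inter> cball 0 R. norm (v - c) > \<epsilon>)" for n
    by (meson inverse_positive_iff_positive not_le of_nat_0_less_iff zero_less_Suc)
  then obtain y v where y: "\<And>n. dist (y n) x < inverse (real (Suc n))" and v: "\<And>n. v n \<in> D (y n)"
    "\<And>n. norm (v n) \<le> R" and far: "\<And>n c. c \<in> D x \<inter> cball 0 R \<Longrightarrow> norm (v n - c) > \<epsilon>"
    by metis
  have "compact (cball (0::'a) R)" by simp
  then obtain c r where c: "c \<in> cball 0 R" "strict_mono (r::nat \<Rightarrow> nat)" "(v \<circ> r) \<longlonglongrightarrow> c"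
    using v(2) unfolding compact_def by (metis mem_cball_0)
  have "y \<longlonglongrightarrow> x"
  proof (rule metric_LIMSEQ_I)
    fix e :: real assume "e > 0"
    then obtain N where N: "inverse (real (Suc N)) < e" using reals_Archimedean by blast
    have "dist (y n) x < e" if "n \<ge> N" for n
    proof -
      have "inverse (real (Suc n)) \<le> inverse (real (Suc N))" using that by (intro le_imp_inverse_le) auto
      with y[of n] N show ?thesis by linarith
    qed
    then show "\<exists>N. \<forall>n\<ge>N. dist (y n) x < e" by blast
  qed
  then have "(y \<circ> r) \<longlonglongrightarrow> x" using c(2) by (rule LIMSEQ_subseq_LIMSEQ)
  with c(3) have lim: "(\<lambda>n. ((y \<circ> r) n, (v \<circ> r) n)) \<longlonglongrightarrow> (x, c)" by (intro tendsto_Pair)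
  have mem: "((y \<circ> r) n, (v \<circ> r) n) \<in> {(x, v). v \<in> D x}" for n using v(1) by simp
  have "(x, c) \<in> {(x, v). v \<in> D x}" by (rule closed_sequentially[OF graph mem lim])
  with c(1) have "\<epsilon> < norm ((v \<circ> r) n - c)" for n using far by simp
  moreover have "(\<lambda>n. norm ((v \<circ> r) n - c)) \<longlonglongrightarrow> norm (c - c)" by (intro tendsto_intros c(3))
  then have "\<forall>\<^sub>F n in sequentially. norm ((v \<circ> r) n - c) < \<epsilon>"
    using \<open>\<epsilon> > 0\<close> by (intro order_tendstoD(2)) auto
  ultimately show False using eventually_happens'[OF sequentially_bot] by (metis less_asym)
qed

section \<open>Hessians of kernels on compact sets\<close>

lemma norm_matrix_vector_mult_le: "norm (A *v w) \<le> norm A * norm w" for A :: "real^'n^'m"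
proof -
  have "norm (A *v w) = L2_set (\<lambda>i. norm ((A *v w) $ i)) UNIV" by (simp add: norm_vec_def)
  also have "\<dots> \<le> L2_set (\<lambda>i. norm (A $ i) * norm w) UNIV"
  proof (rule L2_set_mono)
    fix i
    have "(A *v w) $ i = A $ i \<bullet> w" by (simp add: matrix_vector_mult_def inner_vec_def)
    then show "norm ((A *v w) $ i) \<le> norm (A $ i) * norm w" by (simp add: Cauchy_Schwarz_ineq2)
  qed simp
  also have "\<dots> = norm A * norm w" by (simp add: L2_set_left_distrib norm_vec_def)
  finally show ?thesis .
qed

lemma positive_definite_matrix_inv:
  assumes "positive_definite A"
  shows "A *v (matrix_inv A *v h) = h" "matrix_inv A *v (A *v h) = h"
proof -
  have "\<forall>h. A *v h = 0 \<longrightarrow> h = 0"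
    using assms by (metis inner_zero_right less_irrefl positive_definite_def)
  then have "invertible A" unfolding invertible_left_inverse matrix_left_invertible_ker .
  then have "A ** matrix_inv A = mat 1 \<and> matrix_inv A ** A = mat 1"
    unfolding invertible_def matrix_inv_def by (rule someI_ex)
  then show "A *v (matrix_inv A *v h) = h" "matrix_inv A *v (A *v h) = h"
    by (simp_all add: matrix_vector_mul_assoc)
qed

lemma positive_definite_sym: "positive_definite A \<Longrightarrow> x \<bullet> (A *v y) = y \<bullet> (A *v x)"
  unfolding positive_definite_def
  by (metis dot_lmul_matrix inner_commute transpose_matrix_vector)

context
  fixes \<phi> :: "real^'n \<Rightarrow> real"
  assumes C2: "C2_fun \<phi>" and pd: "\<And>z. positive_definite (hessian \<phi> z)"
begin

lemma grad_has_derivative: "(grad \<phi> has_derivative (\<lambda>h. hessian \<phi> x *v h)) (at x)"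
  using C2 unfolding C2_fun_def hessian_def by (metis jacobian_works)

lemma grad_continuous: "continuous_on S (grad \<phi>)"
  using C2 unfolding C2_fun_def C1_fun_def by (meson continuous_on_subset subset_UNIV)

lemma hessian_continuous: "continuous_on S (hessian \<phi>)"
  using C2 unfolding C2_fun_def by (meson continuous_on_subset subset_UNIV)

lemma hessian_elliptic_on_compact:
  assumes "compact K"
  obtains \<mu> where "\<mu> > 0" "\<And>x h. x \<in> K \<Longrightarrow> \<mu> * (norm h)\<^sup>2 \<le> h \<bullet> (hessian \<phi> x *v h)"
proof (cases "K = {}")
  case True
  then show thesis using that[of 1] by simp
next
  case False
  let ?q = "\<lambda>p :: (real^'n) \<times> (real^'n). snd p \<bullet> (hessian \<phi> (fst p) *v snd p)"
  have "axis undefined 1 \<in> sphere (0 :: real^'n) 1" by (simp add: norm_axis_1)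
  then have ne: "K \<times> sphere (0 :: real^'n) 1 \<noteq> {}" using False by blast
  have "continuous_on (K \<times> sphere 0 1) (\<lambda>p. hessian \<phi> (fst p))"
    by (rule continuous_on_compose2[OF hessian_continuous[of UNIV]]) (auto intro: continuous_intros)
  then have "continuous_on (K \<times> sphere 0 1) ?q"
    unfolding inner_vec_def matrix_vector_mult_def
    by (intro continuous_intros) 
  moreover have "compact (K \<times> sphere (0 :: real^'n) 1)" using assms by (intro compact_Times) auto
  ultimately obtain p where p: "p \<in> K \<times> sphere 0 1" and min: "\<And>q. q \<in> K \<times> sphere 0 1 \<Longrightarrow> ?q p \<le> ?q q"
    using continuous_attains_inf[OF _ ne, of ?q] by blast
  show thesis
  proof (rule that[of "?q p"])
    have "snd p \<noteq> 0" using p by auto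
    then show "0 < ?q p" using pd[of "fst p"] unfolding positive_definite_def by blast
    fix x h :: "real^'n" assume x: "x \<in> K"
    show "?q p * (norm h)\<^sup>2 \<le> h \<bullet> (hessian \<phi> x *v h)"
    proof (cases "h = 0")
      case False
      let ?u = "inverse (norm h) *\<^sub>R h"
      have "?q p \<le> ?q (x, ?u)" using x False by (intro min) simp
      also have "?q (x, ?u) = (inverse (norm h))\<^sup>2 * (h \<bullet> (hessian \<phi> x *v h))"
        by (simp add: matrix_vector_mult_scaleR power2_eq_square)
      finally have "?q p * (norm h)\<^sup>2 \<le> (inverse (norm h))\<^sup>2 * (h \<bullet> (hessian \<phi> x *v h)) * (norm h)\<^sup>2"
        by (intro mult_right_mono) auto
      then show ?thesis using False by (simp add: field_simps)
    qed simp
  qed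
qed

text \<open>The mean value theorem for the gradient in the direction \<open>x - y\<close>. It turns bounds on gradient
  increments, which the recursion provides, into bounds on the increments of the iterates.\<close>

lemma grad_strongly_monotone:
  assumes "convex K" and "\<mu> > 0" and ell: "\<And>x h. x \<in> K \<Longrightarrow> \<mu> * (norm h)\<^sup>2 \<le> h \<bullet> (hessian \<phi> x *v h)"
    and "x \<in> K" "y \<in> K"
  shows "\<mu> * norm (x - y) \<le> norm (grad \<phi> x - grad \<phi> y)"
proof (cases "x = y")
  case False
  let ?h = "x - y"
  define q where "q t = grad \<phi> (y + t *\<^sub>R ?h) \<bullet> ?h" for t :: real
  have q: "(q has_real_derivative ?h \<bullet> (hessian \<phi> (y + t *\<^sub>R ?h) *v ?h)) (at t)" for t
  proof -
    have "((\<lambda>t. y + t *\<^sub>R ?h) has_derivative (\<lambda>t. t *\<^sub>R ?h)) (at t)"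
      by (auto intro!: derivative_eq_intros)
    from has_derivative_compose[OF this grad_has_derivative]
    have "((\<lambda>t. grad \<phi> (y + t *\<^sub>R ?h)) has_derivative (\<lambda>s. hessian \<phi> (y + t *\<^sub>R ?h) *v (s *\<^sub>R ?h))) (at t)" .
    then have "(q has_derivative (\<lambda>s. (hessian \<phi> (y + t *\<^sub>R ?h) *v (s *\<^sub>R ?h)) \<bullet> ?h)) (at t)"
      unfolding q_def by (rule has_derivative_inner_left)
    then show ?thesis
      unfolding has_field_derivative_def
      by (rule has_derivative_eq_rhs) (simp add: fun_eq_iff matrix_vector_mult_scaleR inner_commute)
  qed
  obtain t where t: "0 < t" "t < 1" "q 1 - q 0 = (1 - 0) * (?h \<bullet> (hessian \<phi> (y + t *\<^sub>R ?h) *v ?h))"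
    using MVT2[of 0 1 q, OF _ q] by auto
  have "y + t *\<^sub>R ?h = (1 - t) *\<^sub>R y + t *\<^sub>R x" by (simp add: algebra_simps)
  also have "\<dots> \<in> K" using \<open>convex K\<close> assms(4,5) t by (intro convexD) auto
  finally have "\<mu> * (norm ?h)\<^sup>2 \<le> q 1 - q 0" using ell t(3) by simp
  also have "\<dots> = (grad \<phi> x - grad \<phi> y) \<bullet> ?h" by (simp add: q_def inner_diff_left)
  also have "\<dots> \<le> norm (grad \<phi> x - grad \<phi> y) * norm ?h" by (rule norm_cauchy_schwarz)
  finally show ?thesis using False by (simp add: power2_eq_square)
qed simp

lemma hessian_bounded_on_compact:
  assumes "compact K"
  obtains \<Lambda> where "\<Lambda> > 0" "\<And>x h. x \<in> K \<Longrightarrow> norm (hessian \<phi> x *v h) \<le> \<Lambda> * norm h"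
proof -
  have "bounded (hessian \<phi> ` K)"
    using compact_continuous_image[OF hessian_continuous assms] by (rule compact_imp_bounded)
  then obtain b where b: "b > 0" "\<And>x. x \<in> K \<Longrightarrow> norm (hessian \<phi> x) \<le> b"
    unfolding bounded_pos by auto
  show thesis
  proof (rule that[OF b(1)])
    fix x h :: "real^'n" assume "x \<in> K"
    then have "norm (hessian \<phi> x) * norm h \<le> b * norm h" using b(2) by (intro mult_right_mono) auto
    then show "norm (hessian \<phi> x *v h) \<le> b * norm h"
      by (rule order_trans[OF norm_matrix_vector_mult_le])
  qed
qed

lemma inverse_hessian_bound:
  assumes "\<mu> > 0" and ell: "\<And>h. \<mu> * (norm h)\<^sup>2 \<le> h \<bullet> (hessian \<phi> x *v h)"
  shows "norm (matrix_inv (hessian \<phi> x) *v h) \<le> norm h / \<mu>"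
proof (cases "matrix_inv (hessian \<phi> x) *v h = 0")
  case True
  then show ?thesis using assms(1) by simp
next
  case False
  let ?w = "matrix_inv (hessian \<phi> x) *v h"
  have "\<mu> * (norm ?w)\<^sup>2 \<le> ?w \<bullet> h" using ell[of ?w] positive_definite_matrix_inv(1)[OF pd] by simp
  also have "\<dots> \<le> norm ?w * norm h" by (rule norm_cauchy_schwarz)
  finally have "\<mu> * norm ?w \<le> norm h" using False by (simp add: power2_eq_square)
  then show ?thesis using assms(1) by (simp add: field_simps)
qed

text \<open>By the resolvent identity, the difference of the inverses at \<open>y\<close> and \<open>x\<close> is the inverse at
  \<open>y\<close> times the difference of the Hessians at \<open>x\<close> and \<open>y\<close> times the inverse at \<open>x\<close>.\<close>

lemma inverse_hessian_continuous:
  assumes "\<mu> > 0" and ell: "\<And>x h. x \<in> K \<Longrightarrow> \<mu> * (norm h)\<^sup>2 \<le> h \<bullet> (hessian \<phi> x *v h)"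
    and "x \<in> K" "\<epsilon> > 0"
  obtains \<rho> where "\<rho> > 0"
    "\<And>y h. y \<in> K \<Longrightarrow> dist y x < \<rho> \<Longrightarrow>
      norm (matrix_inv (hessian \<phi> y) *v h - matrix_inv (hessian \<phi> x) *v h) \<le> \<epsilon> * norm h"
proof -
  have "\<epsilon> * \<mu>\<^sup>2 > 0" using assms by simp
  moreover have "continuous (at x) (hessian \<phi>)"
    using hessian_continuous[of UNIV] by (simp add: continuous_on_eq_continuous_at)
  ultimately obtain \<rho> where \<rho>: "\<rho> > 0" "\<And>y. dist y x < \<rho> \<Longrightarrow> dist (hessian \<phi> y) (hessian \<phi> x) < \<epsilon> * \<mu>\<^sup>2"
    unfolding continuous_at_eps_delta by blast
  show thesis
  proof (rule that[OF \<rho>(1)])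
    fix y h :: "real^'n" assume y: "y \<in> K" "dist y x < \<rho>"
    let ?Px = "matrix_inv (hessian \<phi> x)" and ?Py = "matrix_inv (hessian \<phi> y)"
    let ?w = "?Px *v h"
    have "?Py *v h - ?Px *v h = ?Py *v ((hessian \<phi> x - hessian \<phi> y) *v ?w)"
      by (simp add: matrix_vector_mult_diff_rdistrib matrix_vector_mult_diff_distrib
          positive_definite_matrix_inv[OF pd])
    also have "norm \<dots> \<le> norm ((hessian \<phi> x - hessian \<phi> y) *v ?w) / \<mu>"
      by (rule inverse_hessian_bound[OF assms(1) ell[OF y(1)]])
    also have "\<dots> \<le> (norm (hessian \<phi> x - hessian \<phi> y) * norm ?w) / \<mu>"
      using assms(1) by (intro divide_right_mono norm_matrix_vector_mult_le) simp
    also have "\<dots> \<le> ((\<epsilon> * \<mu>\<^sup>2) * (norm h / \<mu>)) / \<mu>"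
    proof (intro divide_right_mono mult_mono)
      show "norm (hessian \<phi> x - hessian \<phi> y) \<le> \<epsilon> * \<mu>\<^sup>2"
        using \<rho>(2)[OF y(2)] by (simp add: dist_norm norm_minus_commute)
      show "norm ?w \<le> norm h / \<mu>" by (rule inverse_hessian_bound[OF assms(1) ell[OF assms(3)]])
    qed (use assms in auto)
    also have "\<dots> = \<epsilon> * norm h" using assms(1) by (simp add: power2_eq_square)
    finally show "norm (?Py *v h - ?Px *v h) \<le> \<epsilon> * norm h" .
  qed
qed

end

section \<open>The time scale of the step sizes\<close>

locale step_sizes =
  fixes \<eta> :: "nat \<Rightarrow> real"
  assumes \<eta>_pos: "\<And>k. \<eta> k > 0"
    and \<eta>_diverges: "filterlim (\<lambda>n. \<Sum>k<n. \<eta> k) at_top sequentially"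
    and \<eta>_null: "\<eta> \<longlonglongrightarrow> 0"
begin

text \<open>With step \<open>k\<close> taking time \<open>\<eta> k\<close>, \<open>elapsed n k\<close> is the time from index \<open>n\<close> to index \<open>k\<close>, and
  \<open>index_at n t\<close> is the index in progress at time \<open>t\<close> after \<open>n\<close>.\<close>

definition elapsed :: "nat \<Rightarrow> nat \<Rightarrow> real" where "elapsed n k = (\<Sum>i=n..<k. \<eta> i)"

definition index_at :: "nat \<Rightarrow> real \<Rightarrow> nat" where "index_at n t = (LEAST k. n \<le> k \<and> t < elapsed n (Suc k))"

lemma elapsed_self [simp]: "elapsed n n = 0" by (simp add: elapsed_def)

lemma elapsed_Suc: "n \<le> k \<Longrightarrow> elapsed n (Suc k) = elapsed n k + \<eta> k" by (simp add: elapsed_def)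

lemma elapsed_add: "n \<le> k \<Longrightarrow> k \<le> l \<Longrightarrow> elapsed n k + elapsed k l = elapsed n l"
  unfolding elapsed_def by (rule sum.atLeastLessThan_concat)

lemma elapsed_nonneg: "0 \<le> elapsed n k" unfolding elapsed_def by (intro sum_nonneg) (simp add: \<eta>_pos less_imp_le)

lemma elapsed_mono: "n \<le> k \<Longrightarrow> k \<le> l \<Longrightarrow> elapsed n k \<le> elapsed n l"
  using elapsed_add[of n k l] elapsed_nonneg[of k l] by simp

lemma index_at_exists: "\<exists>k. n \<le> k \<and> t < elapsed n (Suc k)"
proof -
  have "\<forall>\<^sub>F m in sequentially. (\<Sum>k<n. \<eta> k) + t < (\<Sum>k<m. \<eta> k)"
    using \<eta>_diverges unfolding filterlim_at_top_dense by blast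
  then obtain m0 where m0: "\<And>m. m \<ge> m0 \<Longrightarrow> (\<Sum>k<n. \<eta> k) + t < (\<Sum>k<m. \<eta> k)"
    by (auto simp: eventually_sequentially)
  define m where "m = max n m0"
  have "(\<Sum>k<n. \<eta> k) + elapsed n (Suc m) = (\<Sum>k<Suc m. \<eta> k)"
    unfolding elapsed_def lessThan_atLeast0 by (rule sum.atLeastLessThan_concat) (auto simp: m_def)
  moreover have "m0 \<le> Suc m" by (simp add: m_def)
  ultimately have "t < elapsed n (Suc m)" using m0[of "Suc m"] by linarith
  then show ?thesis by (intro exI[of _ m]) (simp add: m_def)
qed

lemma index_at_ge: "n \<le> index_at n t" and index_at_above: "t < elapsed n (Suc (index_at n t))"
  using LeastI_ex[OF index_at_exists[of n t]] unfolding index_at_def by auto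

lemma index_at_below:
  assumes "0 \<le> t"
  shows "elapsed n (index_at n t) \<le> t"
proof (cases "index_at n t = n")
  case False
  then obtain k where k: "index_at n t = Suc k" "n \<le> k"
    using index_at_ge[of n t] by (cases "index_at n t") auto
  then have "\<not> (n \<le> k \<and> t < elapsed n (Suc k))"
    using not_less_Least[of k "\<lambda>k. n \<le> k \<and> t < elapsed n (Suc k)"] unfolding index_at_def by simp
  with k show ?thesis by simp
qed (use assms in simp)

lemma index_at_mono: "s \<le> t \<Longrightarrow> index_at n s \<le> index_at n t"
  unfolding index_at_def by (rule Least_le) (use index_at_ge[of n t] index_at_above[of t n] in \<open>auto simp: index_at_def\<close>)

lemma index_at_elapsed: "n \<le> k \<Longrightarrow> index_at n (elapsed n k) = k"
  unfolding index_at_def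
proof (rule Least_equality)
  assume "n \<le> k"
  then show "n \<le> k \<and> elapsed n k < elapsed n (Suc k)" using \<eta>_pos[of k] by (simp add: elapsed_Suc)
  fix y assume "n \<le> y \<and> elapsed n k < elapsed n (Suc y)"
  then show "k \<le> y" using elapsed_mono[of n "Suc y" k] by (force simp: not_le)
qed

lemma index_at_0 [simp]: "index_at n 0 = n" using index_at_elapsed[of n n] by simp

lemma elapsed_index_at:
  assumes "0 \<le> s" "s \<le> t"
  shows "elapsed (index_at n s) (index_at n t) \<le> t - s + \<eta> (index_at n s)" "t - s - \<eta> (index_at n t) \<le> elapsed (index_at n s) (index_at n t)"
proof -
  have "elapsed n (index_at n s) + elapsed (index_at n s) (index_at n t) = elapsed n (index_at n t)" by (rule elapsed_add[OF index_at_ge index_at_mono[OF assms(2)]])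
  moreover have "elapsed n (index_at n s) \<le> s" "elapsed n (index_at n t) \<le> t" using assms by (auto intro: index_at_below)
  moreover have "s < elapsed n (index_at n s) + \<eta> (index_at n s)" "t < elapsed n (index_at n t) + \<eta> (index_at n t)"
    using index_at_above[of s n] index_at_above[of t n] by (simp_all add: elapsed_Suc index_at_ge)
  ultimately show "elapsed (index_at n s) (index_at n t) \<le> t - s + \<eta> (index_at n s)" "t - s - \<eta> (index_at n t) \<le> elapsed (index_at n s) (index_at n t)"
    by linarith+
qed

lemma elapsed_index_at_le_1: "0 \<le> s \<Longrightarrow> s \<le> t \<Longrightarrow> t \<le> 1 \<Longrightarrow> elapsed (index_at n s) (index_at n t) \<le> 1"
  using elapsed_add[OF index_at_ge index_at_mono, of s t n] elapsed_nonneg[of n "index_at n s"] index_at_below[of t n] by linarith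

lemma eventually_all_ge: "(\<forall>\<^sub>F n in sequentially. Q n) \<Longrightarrow> (\<forall>\<^sub>F n in sequentially. \<forall>k\<ge>n. Q (k::nat))"
  unfolding eventually_sequentially by (meson order_trans)

lemma eventually_\<eta>_small: "\<epsilon> > 0 \<Longrightarrow> \<forall>\<^sub>F n in sequentially. \<forall>k\<ge>n. \<eta> k < \<epsilon>"
  using \<eta>_null by (intro eventually_all_ge order_tendstoD(2)) auto

lemma elapsed_index_at_tendsto:
  assumes "filterlim nn at_top sequentially" "0 \<le> s" "s \<le> t"
  shows "(\<lambda>j. elapsed (index_at (nn j) s) (index_at (nn j) t)) \<longlonglongrightarrow> t - s"
proof (rule LIMSEQ_I)
  fix e :: real assume "e > 0"
  have "\<forall>\<^sub>F j in sequentially. \<forall>k\<ge>nn j. \<eta> k < e"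
    using filterlim_iff[THEN iffD1, OF assms(1)] eventually_\<eta>_small[OF \<open>e > 0\<close>] by blast
  then have "\<forall>\<^sub>F j in sequentially. norm (elapsed (index_at (nn j) s) (index_at (nn j) t) - (t - s)) < e"
  proof eventually_elim
    case (elim j)
    with index_at_ge have "\<eta> (index_at (nn j) s) < e" "\<eta> (index_at (nn j) t) < e" by auto
    with elapsed_index_at[OF assms(2,3), of "nn j"] show ?case unfolding real_norm_def by linarith
  qed
  then show "\<exists>no. \<forall>n\<ge>no. norm (elapsed (index_at (nn n) s) (index_at (nn n) t) - (t - s)) < e"
    by (simp add: eventually_sequentially)
qed

end

section \<open>Paths of the recursion are asymptotically Lipschitz\<close>

text \<open>A single path with its constants: \<open>R\<close> bounds the path, \<open>\<mu>\<close> is an ellipticity constant of the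
  Hessian on the ball of radius \<open>R\<close>, \<open>U\<close> and \<open>V\<close> bound \<open>\<theta> k / \<eta> k\<close> and \<open>\<nu> k\<close>, and \<open>C\<close> bounds the
  variation of the noise per unit time.\<close>

locale momentum_recursion = step_sizes \<eta> for \<eta> :: "nat \<Rightarrow> real" +
  fixes \<phi> :: "real^'n \<Rightarrow> real" and D :: "real^'n \<Rightarrow> (real^'n) set"
    and \<theta> \<delta> \<nu> :: "nat \<Rightarrow> real" and x m d \<xi> :: "nat \<Rightarrow> real^'n"
    and \<tau> R \<mu> U V C :: real
  assumes C2: "C2_fun \<phi>" and pd: "\<And>z. positive_definite (hessian \<phi> z)"
    and \<theta>_pos: "\<And>k. \<theta> k > 0" and \<tau>: "\<tau> > 0" "(\<lambda>k. \<theta> k / \<eta> k) \<longlonglongrightarrow> \<tau>" and U: "\<And>k. \<theta> k \<le> U * \<eta> k"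
    and \<delta>: "\<And>k. 0 \<le> \<delta> k" "\<delta> \<longlonglongrightarrow> 0" and \<nu>: "\<And>k. \<nu> k \<le> V" "\<nu> \<longlonglongrightarrow> 0"
    and x_step: "\<And>k. norm (m k + (1 / \<eta> k) *\<^sub>R (grad \<phi> (x (Suc k)) - grad \<phi> (x k))) \<le> \<nu> k"
    and m_step: "\<And>k. m (Suc k) = m k - \<theta> k *\<^sub>R (matrix_inv (hessian \<phi> (x k)) *v (m k - (d k + \<xi> k)))"
    and d_in: "\<And>k. d k \<in> expansion D (\<delta> k) (x k)"
    and x_le: "\<And>k. norm (x k) \<le> R" and m_le: "\<And>k. norm (m k) \<le> R" and d_le: "\<And>k. norm (d k) \<le> R"
    and \<mu>: "\<mu> > 0" "\<And>z h. z \<in> cball 0 R \<Longrightarrow> \<mu> * (norm h)\<^sup>2 \<le> h \<bullet> (hessian \<phi> z *v h)"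
    and noise_small: "window_small \<eta> \<xi>" and C: "C \<ge> 0"
    and noise_bounded: "\<And>\<epsilon>. \<epsilon> > 0 \<Longrightarrow> \<forall>\<^sub>F n in sequentially. \<forall>l\<ge>n. (\<Sum>k=n..<l. \<eta> k) \<le> 1 \<longrightarrow>
     (\<Sum>k=n..<l. \<eta> k * norm (\<xi> k)) \<le> C * (\<Sum>k=n..<l. \<eta> k) + \<epsilon>"
begin

abbreviation "H \<equiv> hessian \<phi>"
abbreviation "P z \<equiv> matrix_inv (hessian \<phi> z)"

lemma R_nonneg: "0 \<le> R" by (rule order_trans[OF norm_ge_zero x_le])
lemma V_nonneg: "0 \<le> V" by (rule order_trans[OF norm_ge_zero order_trans[OF x_step \<nu>(1)]])
lemma U_pos: "0 < U" by (rule zero_less_mult_pos2[OF less_le_trans[OF \<theta>_pos U] \<eta>_pos])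

lemma x_in: "x k \<in> cball 0 R" using x_le by simp

lemma H_P: "H z *v (P z *v h) = h"
  by (simp add: positive_definite_matrix_inv pd)

lemma P_bound: "z \<in> cball 0 R \<Longrightarrow> norm (P z *v h) \<le> norm h / \<mu>"
  using inverse_hessian_bound[OF C2 pd \<mu>(1) \<mu>(2)] by blast

lemma grad_step: "norm (grad \<phi> (x (Suc k)) - grad \<phi> (x k) + \<eta> k *\<^sub>R m k) \<le> \<eta> k * \<nu> k"
proof -
  have "grad \<phi> (x (Suc k)) - grad \<phi> (x k) + \<eta> k *\<^sub>R m k =
      \<eta> k *\<^sub>R (m k + (1 / \<eta> k) *\<^sub>R (grad \<phi> (x (Suc k)) - grad \<phi> (x k)))"
    using \<eta>_pos[of k] by (simp add: scaleR_add_right)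
  also have "norm \<dots> \<le> \<eta> k * \<nu> k"
    using x_step[of k] \<eta>_pos[of k] by simp
  finally show ?thesis .
qed

lemma grad_window:
  assumes "k \<le> l"
  shows "norm (grad \<phi> (x l) - grad \<phi> (x k) + (\<Sum>i=k..<l. \<eta> i *\<^sub>R m i)) \<le> (\<Sum>i=k..<l. \<eta> i * \<nu> i)"
proof -
  have "grad \<phi> (x l) - grad \<phi> (x k) + (\<Sum>i=k..<l. \<eta> i *\<^sub>R m i) =
      (\<Sum>i=k..<l. grad \<phi> (x (Suc i)) - grad \<phi> (x i) + \<eta> i *\<^sub>R m i)"
    using sum_Suc_diff'[OF assms, of "\<lambda>i. grad \<phi> (x i)"] by (simp add: sum.distrib)
  also have "norm \<dots> \<le> (\<Sum>i=k..<l. \<eta> i * \<nu> i)"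
    by (intro sum_norm_le grad_step)
  finally show ?thesis .
qed

lemma x_window:
  assumes "k \<le> l"
  shows "norm (x l - x k) \<le> (R + V) / \<mu> * elapsed k l"
proof -
  have "\<mu> * norm (x l - x k) \<le> norm (grad \<phi> (x l) - grad \<phi> (x k))"
    using grad_strongly_monotone[OF C2 pd convex_cball \<mu>] x_in by blast
  also have "\<dots> \<le> norm (grad \<phi> (x l) - grad \<phi> (x k) + (\<Sum>i=k..<l. \<eta> i *\<^sub>R m i)) + norm (\<Sum>i=k..<l. \<eta> i *\<^sub>R m i)"
    using norm_triangle_ineq4[of "grad \<phi> (x l) - grad \<phi> (x k) + (\<Sum>i=k..<l. \<eta> i *\<^sub>R m i)" "\<Sum>i=k..<l. \<eta> i *\<^sub>R m i"]
    by (simp only: add_diff_cancel_right')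
  also have "\<dots> \<le> (\<Sum>i=k..<l. \<eta> i * \<nu> i) + (\<Sum>i=k..<l. \<eta> i * R)"
  proof (intro add_mono grad_window assms sum_norm_le)
    show "norm (\<eta> i *\<^sub>R m i) \<le> \<eta> i * R" for i
      using \<eta>_pos[of i] m_le[of i] by simp
  qed
  also have "\<dots> \<le> (\<Sum>i=k..<l. \<eta> i * V) + (\<Sum>i=k..<l. \<eta> i * R)"
    by (intro add_right_mono sum_mono mult_left_mono \<nu>) (simp add: \<eta>_pos less_imp_le)
  also have "\<dots> = (R + V) * elapsed k l" 
    by (simp add: elapsed_def algebra_simps flip: sum_distrib_left sum_distrib_right)
  finally show ?thesis using \<mu>(1) by (simp add: field_simps)
qed

lemma m_increment: "k \<le> l \<Longrightarrow> m l - m k = (\<Sum>i=k..<l. - (\<theta> i *\<^sub>R (P (x i) *v (m i - d i - \<xi> i))))"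
proof -
  assume "k \<le> l"
  then have "m l - m k = (\<Sum>i=k..<l. m (Suc i) - m i)" by (rule sum_Suc_diff'[symmetric])
  also have "\<dots> = (\<Sum>i=k..<l. - (\<theta> i *\<^sub>R (P (x i) *v (m i - d i - \<xi> i))))"
    by (rule sum.cong) (simp_all only: m_step diff_diff_eq, simp)
  finally show ?thesis .
qed

text \<open>A Lipschitz constant for the iterates and the momenta together: the first summand comes from
  \<open>x_window\<close>, the second one from \<open>m_window\<close>.\<close>

definition L :: real where "L = (R + V) / \<mu> + U * (2 * R + C) / \<mu>"

lemma L_nonneg: "0 \<le> L"
  using R_nonneg V_nonneg U_pos C \<mu>(1) by (simp add: L_def)

lemma m_window:
  assumes "\<epsilon> > 0"
  shows "\<forall>\<^sub>F n in sequentially. \<forall>k\<ge>n. \<forall>l\<ge>k. elapsed k l \<le> 1 \<longrightarrow> norm (m l - m k) \<le> U * (2 * R + C) / \<mu> * elapsed k l + \<epsilon>"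
proof -
  have "\<epsilon> * \<mu> / U > 0" using assms U_pos \<mu>(1) by simp
  from eventually_all_ge[OF noise_bounded[OF this]] show ?thesis
  proof eventually_elim
    case (elim n)
    show ?case
    proof (intro allI impI)
      fix k l assume kl: "n \<le> k" "k \<le> l" "elapsed k l \<le> 1"
      have "norm (m l - m k) \<le> (\<Sum>i=k..<l. U / \<mu> * (\<eta> i * (2 * R) + \<eta> i * norm (\<xi> i)))"
        unfolding m_increment[OF kl(2)]
      proof (rule sum_norm_le)
        fix i
        have "norm (m i - d i - \<xi> i) \<le> norm (m i) + norm (d i) + norm (\<xi> i)"
          using norm_triangle_ineq4[of "m i - d i" "\<xi> i"] norm_triangle_ineq4[of "m i" "d i"] by linarith
        also have "\<dots> \<le> 2 * R + norm (\<xi> i)" using m_le[of i] d_le[of i] by linarith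
        finally have u: "norm (m i - d i - \<xi> i) \<le> 2 * R + norm (\<xi> i)" .
        have "norm (- (\<theta> i *\<^sub>R (P (x i) *v (m i - d i - \<xi> i)))) = \<theta> i * norm (P (x i) *v (m i - d i - \<xi> i))"
          using \<theta>_pos[of i] by simp
        also have "\<dots> \<le> (U * \<eta> i) * (norm (m i - d i - \<xi> i) / \<mu>)"
          using U_pos \<eta>_pos[of i] by (intro mult_mono U P_bound x_in) (auto simp: less_imp_le)
        also have "\<dots> \<le> (U * \<eta> i) * ((2 * R + norm (\<xi> i)) / \<mu>)"
          using U_pos \<eta>_pos[of i] \<mu>(1) u by (intro mult_left_mono divide_right_mono) auto
        finally show "norm (- (\<theta> i *\<^sub>R (P (x i) *v (m i - d i - \<xi> i)))) \<le> U / \<mu> * (\<eta> i * (2 * R) + \<eta> i * norm (\<xi> i))"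
          by (simp add: field_simps)
      qed
      also have "\<dots> = U / \<mu> * (2 * R * elapsed k l + (\<Sum>i=k..<l. \<eta> i * norm (\<xi> i)))"
        unfolding elapsed_def sum_distrib_left[symmetric] sum.distrib by (simp add: sum_distrib_left algebra_simps)
      also have "\<dots> \<le> U / \<mu> * (2 * R * elapsed k l + (C * elapsed k l + \<epsilon> * \<mu> / U))"
        using elim kl U_pos \<mu>(1) unfolding elapsed_def by (intro mult_left_mono add_left_mono) auto
      also have "\<dots> = U * (2 * R + C) / \<mu> * elapsed k l + \<epsilon>"
        using U_pos \<mu>(1) by (simp add: field_simps)
      finally show "norm (m l - m k) \<le> U * (2 * R + C) / \<mu> * elapsed k l + \<epsilon>" .
    qed
  qed
qed

lemma joint_window:
  assumes "\<epsilon> > 0"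
  shows "\<forall>\<^sub>F n in sequentially. \<forall>k\<ge>n. \<forall>l\<ge>k. elapsed k l \<le> 1 \<longrightarrow> norm ((x l, m l) - (x k, m k)) \<le> L * elapsed k l + \<epsilon>"
  using m_window[OF assms]
proof eventually_elim
  case (elim n)
  show ?case
  proof (intro allI impI)
    fix k l assume kl: "n \<le> k" "k \<le> l" "elapsed k l \<le> 1"
    have "norm ((x l, m l) - (x k, m k)) \<le> norm (x l - x k) + norm (m l - m k)"
      using norm_Pair_le[of "x l - x k" "m l - m k"] by simp
    also have "\<dots> \<le> (R + V) / \<mu> * elapsed k l + (U * (2 * R + C) / \<mu> * elapsed k l + \<epsilon>)"
      using elim kl by (intro add_mono x_window) auto
    finally show "norm ((x l, m l) - (x k, m k)) \<le> L * elapsed k l + \<epsilon>" by (simp add: L_def algebra_simps)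
  qed
qed

lemma joint_lipschitz:
  assumes "\<epsilon> > 0"
  shows "\<forall>\<^sub>F n in sequentially. \<forall>s\<in>{0..1}. \<forall>t\<in>{0..1}.
    norm ((x (index_at n s), m (index_at n s)) - (x (index_at n t), m (index_at n t))) \<le> L * \<bar>s - t\<bar> + \<epsilon>"
proof -
  have "\<epsilon> / 2 > 0" "\<epsilon> / 2 / (L + 1) > 0" using assms L_nonneg by simp_all
  from joint_window[OF this(1)] eventually_\<eta>_small[OF this(2)] show ?thesis
  proof eventually_elim
    case (elim n)
    have *: "norm ((x (index_at n t), m (index_at n t)) - (x (index_at n s), m (index_at n s))) \<le> L * \<bar>s - t\<bar> + \<epsilon>"
      if "0 \<le> s" "s \<le> t" "t \<le> 1" for s t
    proof -
      have "norm ((x (index_at n t), m (index_at n t)) - (x (index_at n s), m (index_at n s))) \<le> L * elapsed (index_at n s) (index_at n t) + \<epsilon> / 2"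
        using elim(1) that by (simp add: index_at_ge index_at_mono elapsed_index_at_le_1)
      also have "\<dots> \<le> L * (t - s + \<epsilon> / 2 / (L + 1)) + \<epsilon> / 2"
        using elapsed_index_at(1)[OF that(1,2), of n] elim(2) index_at_ge[of n s] L_nonneg
        by (intro add_right_mono mult_left_mono) force+
      finally have "norm ((x (index_at n t), m (index_at n t)) - (x (index_at n s), m (index_at n s))) \<le>
          L * (t - s + \<epsilon> / 2 / (L + 1)) + \<epsilon> / 2" .
      moreover have "L * (\<epsilon> / 2 / (L + 1)) \<le> \<epsilon> / 2"
        using L_nonneg assms by (simp add: field_simps)
      ultimately have "norm ((x (index_at n t), m (index_at n t)) - (x (index_at n s), m (index_at n s))) \<le> L * (t - s) + \<epsilon>"
        unfolding distrib_left by linarith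
      then show ?thesis using that by simp
    qed
    show ?case
    proof (intro ballI)
      fix s t :: real assume st: "s \<in> {0..1}" "t \<in> {0..1}"
      show "norm ((x (index_at n s), m (index_at n s)) - (x (index_at n t), m (index_at n t))) \<le> L * \<bar>s - t\<bar> + \<epsilon>"
      proof (cases "s \<le> t")
        case True
        with *[of s t] st show ?thesis by (subst norm_minus_commute) auto
      next
        case False
        with *[of t s] st show ?thesis by (subst abs_minus_commute) auto
      qed
    qed
  qed
qed

end

section \<open>Velocities of limit curves\<close>

lemma right_difference_quotient:
  assumes "(g has_vector_derivative D) (at t within {0..1})" "0 \<le> t" "t < (1::real)" "\<epsilon> > 0"
  obtains h0 where "h0 > 0"
    "\<And>h. 0 < h \<Longrightarrow> h < h0 \<Longrightarrow> t + h \<le> 1 \<and> norm (g (t + h) - g t - h *\<^sub>R D) \<le> \<epsilon> * h"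
proof -
  from assms(1,4) obtain d where d: "d > 0"
    "\<And>y. y \<in> {0..1} \<Longrightarrow> norm (y - t) < d \<Longrightarrow> norm (g y - g t - (y - t) *\<^sub>R D) \<le> \<epsilon> * norm (y - t)"
    unfolding has_vector_derivative_def has_derivative_within_alt by blast
  show thesis
  proof (rule that[of "min d (1 - t)"])
    show "min d (1 - t) > 0" using d(1) assms by simp
    fix h assume h: "0 < h" "h < min d (1 - t)"
    with d(2)[of "t + h"] assms show "t + h \<le> 1 \<and> norm (g (t + h) - g t - h *\<^sub>R D) \<le> \<epsilon> * h" by simp
  qed
qed

lemma norm_add_add_le: "norm (a + b + c) \<le> norm a + norm b + norm c" for a b c :: "'a::real_normed_vector"
  by (rule order_trans[OF norm_triangle_ineq add_right_mono[OF norm_triangle_ineq]])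

lemma norm_diff_diff_le: "norm (a - b - c) \<le> norm a + norm b + norm c" for a b c :: "'a::real_normed_vector"
  by (rule order_trans[OF norm_triangle_ineq4 add_right_mono[OF norm_triangle_ineq4]])

context momentum_recursion
begin

context
  fixes nn :: "nat \<Rightarrow> nat" and X M :: "real \<Rightarrow> real^'n"
  assumes nn: "filterlim nn at_top sequentially"
    and X_lim: "\<And>t. t \<in> {0..1} \<Longrightarrow> (\<lambda>j. x (index_at (nn j) t)) \<longlonglongrightarrow> X t"
    and M_lim: "\<And>t. t \<in> {0..1} \<Longrightarrow> (\<lambda>j. m (index_at (nn j) t)) \<longlonglongrightarrow> M t"
begin

lemma X_in: "t \<in> {0..1} \<Longrightarrow> X t \<in> cball 0 R"
  by (rule closed_sequentially[OF closed_cball x_in X_lim])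

lemma M_le: "t \<in> {0..1} \<Longrightarrow> norm (M t) \<le> R"
  using closed_sequentially[OF closed_cball[of 0 R] _ M_lim[of t]] m_le by simp

lemma eventually_nn: "(\<forall>\<^sub>F n in sequentially. Q n) \<Longrightarrow> (\<forall>\<^sub>F j in sequentially. Q (nn j))"
  using filterlim_iff[THEN iffD1, OF nn] by blast

text \<open>During the window that belongs to the interval from \<open>t\<close> to \<open>t + h\<close> all iterates, not only those
  at its ends, are within about \<open>L h\<close> of the limit curve at \<open>t\<close>.\<close>

lemma near_on_window:
  assumes t: "0 \<le> t" "0 < h" "t + h \<le> 1" and "\<epsilon> > 0"
  shows "\<forall>\<^sub>F j in sequentially. \<forall>i. index_at (nn j) t \<le> i \<longrightarrow> i \<le> index_at (nn j) (t + h) \<longrightarrow>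
    norm (x i - X t) \<le> L * h + \<epsilon> \<and> norm (m i - M t) \<le> L * h + \<epsilon>"
proof -
  have \<epsilon>: "\<epsilon> / 3 > 0" using \<open>\<epsilon> > 0\<close> by simp
  have tt: "t \<in> {0..1}" using t by simp
  have "(\<lambda>j. L * elapsed (index_at (nn j) t) (index_at (nn j) (t + h))) \<longlonglongrightarrow> L * (t + h - t)"
    using t by (intro tendsto_intros elapsed_index_at_tendsto nn) auto
  then have "\<forall>\<^sub>F j in sequentially. L * elapsed (index_at (nn j) t) (index_at (nn j) (t + h)) < L * h + \<epsilon> / 3"
    using \<epsilon> by (intro order_tendstoD(2)) auto
  moreover have "\<forall>\<^sub>F j in sequentially. dist (x (index_at (nn j) t)) (X t) < \<epsilon> / 3"
    "\<forall>\<^sub>F j in sequentially. dist (m (index_at (nn j) t)) (M t) < \<epsilon> / 3"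
    using tendstoD[OF X_lim[OF tt] \<epsilon>] tendstoD[OF M_lim[OF tt] \<epsilon>] by auto
  moreover note eventually_nn[OF joint_window[OF \<epsilon>]]
  ultimately show ?thesis
  proof eventually_elim
    case (elim j)
    show ?case
    proof (intro allI impI)
      fix i assume i: "index_at (nn j) t \<le> i" "i \<le> index_at (nn j) (t + h)"
      have le: "elapsed (index_at (nn j) t) i \<le> elapsed (index_at (nn j) t) (index_at (nn j) (t + h))" by (rule elapsed_mono[OF i])
      moreover have "elapsed (index_at (nn j) t) (index_at (nn j) (t + h)) \<le> 1" using t by (intro elapsed_index_at_le_1) auto
      ultimately have "elapsed (index_at (nn j) t) i \<le> 1" by linarith
      then have "norm ((x i, m i) - (x (index_at (nn j) t), m (index_at (nn j) t))) \<le> L * elapsed (index_at (nn j) t) i + \<epsilon> / 3"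
        using elim(4) i(1) index_at_ge by blast
      also have "\<dots> \<le> L * elapsed (index_at (nn j) t) (index_at (nn j) (t + h)) + \<epsilon> / 3"
        using le L_nonneg by (intro add_right_mono mult_left_mono)
      finally have b: "norm ((x i, m i) - (x (index_at (nn j) t), m (index_at (nn j) t))) \<le> L * h + 2 * \<epsilon> / 3"
        using elim(1) by linarith
      have "norm (x i - x (index_at (nn j) t)) \<le> L * h + 2 * \<epsilon> / 3" "norm (m i - m (index_at (nn j) t)) \<le> L * h + 2 * \<epsilon> / 3"
        using b norm_fst_le[of "x i - x (index_at (nn j) t)" "m i - m (index_at (nn j) t)"]
          norm_snd_le[of "m i - m (index_at (nn j) t)" "x i - x (index_at (nn j) t)"] by simp_all
      moreover have "norm (x (index_at (nn j) t) - X t) < \<epsilon> / 3" "norm (m (index_at (nn j) t) - M t) < \<epsilon> / 3"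
        using elim(2,3) by (simp_all add: dist_norm)
      moreover have "norm (x i - X t) \<le> norm (x i - x (index_at (nn j) t)) + norm (x (index_at (nn j) t) - X t)"
        "norm (m i - M t) \<le> norm (m i - m (index_at (nn j) t)) + norm (m (index_at (nn j) t) - M t)"
        by norm+
      ultimately show "norm (x i - X t) \<le> L * h + \<epsilon> \<and> norm (m i - M t) \<le> L * h + \<epsilon>"
        by linarith
    qed
  qed
qed

lemma grad_increment_limit:
  assumes t: "0 \<le> t" "0 < h" "t + h \<le> 1"
  shows "norm (grad \<phi> (X (t + h)) - grad \<phi> (X t) + h *\<^sub>R M t) \<le> L * h * h"
proof (rule field_le_epsilon)
  fix e :: real assume "e > 0"
  define \<epsilon> where "\<epsilon> = e / (2 * h)"
  have \<epsilon>: "\<epsilon> > 0" using \<open>e > 0\<close> t by (simp add: \<epsilon>_def)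
  let ?k = "\<lambda>j. index_at (nn j) t" and ?l = "\<lambda>j. index_at (nn j) (t + h)"
  let ?A = "\<lambda>j. grad \<phi> (x (?l j)) - grad \<phi> (x (?k j)) + elapsed (?k j) (?l j) *\<^sub>R M t"
  have elapsed_lim: "(\<lambda>j. elapsed (?k j) (?l j)) \<longlonglongrightarrow> h"
    using elapsed_index_at_tendsto[OF nn, of t "t + h"] t by simp
  have grad_cont: "isCont (grad \<phi>) y" for y
    using grad_continuous[OF C2 pd, of UNIV] by (simp add: continuous_on_eq_continuous_at)
  have "?A \<longlonglongrightarrow> grad \<phi> (X (t + h)) - grad \<phi> (X t) + h *\<^sub>R M t"
    using t by (intro tendsto_intros elapsed_lim isCont_tendsto_compose[OF grad_cont] X_lim) auto
  then have lim_A: "(\<lambda>j. norm (?A j)) \<longlonglongrightarrow> norm (grad \<phi> (X (t + h)) - grad \<phi> (X t) + h *\<^sub>R M t)"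
    by (rule tendsto_norm)
  have lim_W: "(\<lambda>j. elapsed (?k j) (?l j) * (L * h + 2 * \<epsilon>)) \<longlonglongrightarrow> h * (L * h + 2 * \<epsilon>)"
    by (intro tendsto_intros elapsed_lim)
  have le: "\<forall>\<^sub>F j in sequentially. norm (?A j) \<le> elapsed (?k j) (?l j) * (L * h + 2 * \<epsilon>)"
  proof -
    have "\<forall>\<^sub>F n in sequentially. \<forall>i\<ge>n. \<nu> i < \<epsilon>"
      using \<nu>(2) \<epsilon> by (intro eventually_all_ge order_tendstoD(2)) auto
    from eventually_nn[OF this] near_on_window[OF t \<epsilon>] show ?thesis
    proof eventually_elim
      case (elim j)
      have kl: "?k j \<le> ?l j" using t by (intro index_at_mono) simp
      have split: "?A j = (grad \<phi> (x (?l j)) - grad \<phi> (x (?k j)) + (\<Sum>i=?k j..<?l j. \<eta> i *\<^sub>R m i))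
          - (\<Sum>i=?k j..<?l j. \<eta> i *\<^sub>R (m i - M t))"
        by (simp add: elapsed_def scaleR_diff_right sum_subtractf scaleR_sum_left)
      have "norm (?A j) \<le> (\<Sum>i=?k j..<?l j. \<eta> i * \<nu> i) + (\<Sum>i=?k j..<?l j. \<eta> i * (L * h + \<epsilon>))"
        unfolding split
      proof (rule order_trans[OF norm_triangle_ineq4 add_mono[OF grad_window[OF kl] sum_norm_le]])
        fix i assume i: "i \<in> {?k j..<?l j}"
        then have "norm (m i - M t) \<le> L * h + \<epsilon>" using elim(2) by auto
        then show "norm (\<eta> i *\<^sub>R (m i - M t)) \<le> \<eta> i * (L * h + \<epsilon>)"
          using \<eta>_pos[of i] by simp
      qed
      moreover have "(\<Sum>i=?k j..<?l j. \<eta> i * \<nu> i) \<le> (\<Sum>i=?k j..<?l j. \<eta> i * \<epsilon>)"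
      proof (intro sum_mono mult_left_mono)
        fix i assume "i \<in> {?k j..<?l j}"
        then have "?k j \<le> i" by simp
        with index_at_ge have "nn j \<le> i" by (rule order_trans)
        with elim(1) show "\<nu> i \<le> \<epsilon>" by (blast intro: less_imp_le)
      qed (simp add: \<eta>_pos less_imp_le)
      moreover have "(\<Sum>i=?k j..<?l j. \<eta> i * \<epsilon>) + (\<Sum>i=?k j..<?l j. \<eta> i * (L * h + \<epsilon>)) = elapsed (?k j) (?l j) * (L * h + 2 * \<epsilon>)"
        unfolding elapsed_def sum_distrib_right[symmetric] distrib_left[symmetric] by simp
      ultimately show ?case by linarith
    qed
  qed
  have "norm (grad \<phi> (X (t + h)) - grad \<phi> (X t) + h *\<^sub>R M t) \<le> h * (L * h + 2 * \<epsilon>)"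
    by (rule tendsto_le[OF sequentially_bot lim_W lim_A le])
  also have "\<dots> = L * h * h + e" using t unfolding \<epsilon>_def by (simp add: field_simps)
  finally show "norm (grad \<phi> (X (t + h)) - grad \<phi> (X t) + h *\<^sub>R M t) \<le> L * h * h + e" .
qed

text \<open>By \<open>grad_increment_limit\<close> the gradient along the curve has right derivative \<open>- M t\<close>; the chain
  rule computes the same derivative as \<open>H (X t) *v w\<close>.\<close>

lemma X_velocity:
  assumes t: "0 \<le> t" "t < 1" and w: "(X has_vector_derivative w) (at t within {0..1})"
  shows "H (X t) *v w = - M t"
proof -
  have "((grad \<phi> \<circ> X) has_vector_derivative H (X t) *v w) (at t within {0..1})"
  proof -
    have "((\<lambda>s. grad \<phi> (X s)) has_derivative (\<lambda>h. H (X t) *v (h *\<^sub>R w))) (at t within {0..1})"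
      using w unfolding has_vector_derivative_def
      by (rule has_derivative_compose[OF _ grad_has_derivative[OF C2 pd]])
    then show ?thesis
      unfolding has_vector_derivative_def o_def by (simp add: matrix_vector_mult_scaleR)
  qed
  note g = right_difference_quotient[OF this t]
  have "norm (H (X t) *v w + M t) \<le> 0 + \<epsilon>" if "\<epsilon> > 0" for \<epsilon>
  proof -
    define \<epsilon>' where "\<epsilon>' = \<epsilon> / (1 + L)"
    have \<epsilon>': "\<epsilon>' > 0" "(1 + L) * \<epsilon>' = \<epsilon>" using that L_nonneg by (simp_all add: \<epsilon>'_def)
    from g[OF \<epsilon>'(1)] obtain h0 where h0: "h0 > 0"
      "\<And>h. 0 < h \<Longrightarrow> h < h0 \<Longrightarrow> t + h \<le> 1 \<and> norm ((grad \<phi> \<circ> X) (t + h) - (grad \<phi> \<circ> X) t - h *\<^sub>R (H (X t) *v w)) \<le> \<epsilon>' * h"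
      by blast
    define h where "h = min (h0 / 2) \<epsilon>'"
    have h: "0 < h" "h < h0" "h \<le> \<epsilon>'" using h0(1) \<epsilon>'(1) by (auto simp: h_def)
    have "h *\<^sub>R (H (X t) *v w + M t) = (grad \<phi> (X (t + h)) - grad \<phi> (X t) + h *\<^sub>R M t)
        - (grad \<phi> (X (t + h)) - grad \<phi> (X t) - h *\<^sub>R (H (X t) *v w))" by (simp add: algebra_simps)
    then have "norm (h *\<^sub>R (H (X t) *v w + M t)) \<le> L * h * h + \<epsilon>' * h"
      using norm_triangle_ineq4[of "grad \<phi> (X (t + h)) - grad \<phi> (X t) + h *\<^sub>R M t"
          "grad \<phi> (X (t + h)) - grad \<phi> (X t) - h *\<^sub>R (H (X t) *v w)"]
        grad_increment_limit[OF t(1) h(1)] h0(2)[OF h(1,2)] by simp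
    also have "\<dots> \<le> L * h * \<epsilon>' + \<epsilon>' * h"
      using h L_nonneg by (intro add_right_mono mult_left_mono) auto
    also have "\<dots> = h * \<epsilon>" unfolding \<epsilon>'(2)[symmetric] by (simp add: algebra_simps)
    finally show ?thesis using h(1) by simp
  qed
  then have "norm (H (X t) *v w + M t) \<le> 0" by (rule field_le_epsilon)
  then show ?thesis by (simp add: eq_neg_iff_add_eq_0)
qed

text \<open>The increment of \<open>m\<close> over the window of \<open>[t, t + h]\<close> is a weighted sum of the vectors
  \<open>P (x i) *v (m i - d i - \<xi> i)\<close>. For small \<open>h\<close> and late windows, \<open>P (x i)\<close> and \<open>m i\<close> are close to their
  values \<open>P (X t)\<close> and \<open>M t\<close>, each \<open>d i\<close> is close to some \<open>c i\<close> in the part \<open>K\<close> of \<open>D (X t)\<close> within a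
  ball, and the noise averages out. As \<open>K\<close> is convex, the weighted mean \<open>cc\<close> of the \<open>c i\<close> lies in
  \<open>K\<close>, so the difference quotient of \<open>M\<close> is nearly \<open>- \<tau> *\<^sub>R (P (X t) *v (M t - cc))\<close>. Compactness of
  \<open>K\<close> makes this exact in the limit.\<close>

lemma M_velocity:
  assumes graph: "closed {(z, v). v \<in> D z}" and conv: "\<And>z. convex (D z)"
    and t: "0 \<le> t" "t < 1" and w: "(M has_vector_derivative w) (at t within {0..1})"
  shows "\<exists>c\<in>D (X t). H (X t) *v w = - (\<tau> *\<^sub>R (M t - c))"
proof -
  let ?x = "X t" and ?p = "M t"
  \<comment> \<open>Radius \<open>R + 1\<close>, since \<open>d i\<close> is a value of \<open>D\<close> only up to an error \<open>\<delta> i \<le> 1\<close>.\<close>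
  define K where "K = D ?x \<inter> cball 0 (R + 1)"
  \<comment> \<open>The sum of the constants in front of \<open>\<epsilon>\<close> in the estimates below.\<close>
  define \<kappa> where "\<kappa> = 2 + (1 / \<mu> + \<tau>) * (4 * R + 2 * C + 1) + 7 * \<tau> / \<mu> + \<tau> * (2 * R + 1) / \<mu>"
  have tt: "t \<in> {0..1}" using t by simp
  have x_ball: "?x \<in> cball 0 R" by (rule X_in[OF tt])
  have "closed (D ?x)"
  proof -
    have "D ?x = Pair ?x -` {(z, v). v \<in> D z}" by auto
    then show ?thesis using closed_vimage[OF graph, of "Pair ?x"] by (simp add: continuous_on_Pair continuous_intros)
  qed
  then have compact_K: "compact K" unfolding K_def by (intro closed_Int_compact compact_cball)
  have convex_K: "convex K" unfolding K_def by (intro convex_Int conv convex_cball)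
  have approx: "\<exists>c\<in>K. norm (w + \<tau> *\<^sub>R (P ?x *v (?p - c))) \<le> \<kappa> * \<epsilon>" if \<epsilon>: "0 < \<epsilon>" "\<epsilon> < 1" for \<epsilon>
  proof -
    obtain \<rho>1 where \<rho>1: "\<rho>1 > 0"
      "\<And>y v. dist y ?x < \<rho>1 \<Longrightarrow> v \<in> D y \<Longrightarrow> norm v \<le> R + 1 \<Longrightarrow> \<exists>c\<in>K. norm (v - c) \<le> \<epsilon>"
      using closed_graph_upper_semicontinuous[OF graph \<epsilon>(1), of ?x "R + 1"] unfolding K_def by blast
    obtain \<rho>2 where \<rho>2: "\<rho>2 > 0"
      "\<And>y h. y \<in> cball 0 R \<Longrightarrow> dist y ?x < \<rho>2 \<Longrightarrow> norm (P y *v h - P ?x *v h) \<le> \<epsilon> * norm h"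
      using inverse_hessian_continuous[OF C2 pd \<mu> x_ball \<epsilon>(1)] by blast
    obtain h0 where h0: "h0 > 0"
      "\<And>h. 0 < h \<Longrightarrow> h < h0 \<Longrightarrow> t + h \<le> 1 \<and> norm (M (t + h) - M t - h *\<^sub>R w) \<le> \<epsilon> * h"
      using right_difference_quotient[OF w t \<epsilon>(1)] by blast
    define r where "r = min \<epsilon> (min (\<rho>1 / 2) \<rho>2) / 4"
    have r: "r > 0" "4 * r \<le> \<epsilon>" "4 * r \<le> \<rho>1 / 2" "4 * r \<le> \<rho>2" using \<epsilon> \<rho>1 \<rho>2 by (auto simp: r_def)
    \<comment> \<open>So short that the path moves by at most \<open>2 r\<close> during the window, by \<open>near_on_window\<close>.\<close>
    define h where "h = min (h0 / 2) (r / (L + 1))"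
    have h: "0 < h" "h < h0" using h0(1) r(1) L_nonneg by (auto simp: h_def)
    have Lh: "L * h \<le> r"
    proof -
      have "L * h \<le> (L + 1) * (r / (L + 1))"
        using h(1) L_nonneg by (intro mult_mono) (auto simp: h_def)
      then show ?thesis using L_nonneg by simp
    qed
    have th: "t + h \<le> 1" and quot: "norm (M (t + h) - M t - h *\<^sub>R w) \<le> \<epsilon> * h" using h0(2)[OF h] by auto
    let ?k = "\<lambda>j. index_at (nn j) t" and ?l = "\<lambda>j. index_at (nn j) (t + h)"
    have \<epsilon>h: "\<epsilon> * h > 0" using \<epsilon> h by simp
    have "(\<lambda>j. elapsed (?k j) (?l j)) \<longlonglongrightarrow> h"
      using elapsed_index_at_tendsto[OF nn, of t "t + h"] t h by simp
    then have "\<forall>\<^sub>F j in sequentially. dist (elapsed (?k j) (?l j)) h < \<epsilon> * h" by (rule tendstoD[OF _ \<epsilon>h])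
    moreover have "(\<lambda>j. m (?l j) - m (?k j)) \<longlonglongrightarrow> M (t + h) - M t"
      using t th h by (intro tendsto_intros M_lim) auto
    then have "\<forall>\<^sub>F j in sequentially. dist (m (?l j) - m (?k j)) (M (t + h) - M t) < \<epsilon> * h"
      by (rule tendstoD[OF _ \<epsilon>h])
    moreover have "\<forall>\<^sub>F j in sequentially. \<forall>i\<ge>nn j. \<delta> i < r"
      using \<delta>(2) r(1) by (intro eventually_nn eventually_all_ge order_tendstoD(2)) auto
    moreover have "\<forall>\<^sub>F j in sequentially. \<forall>i\<ge>nn j. dist (\<theta> i / \<eta> i) \<tau> < \<epsilon>"
      by (intro eventually_nn eventually_all_ge tendstoD[OF \<tau>(2) \<epsilon>(1)])
    moreover have "\<forall>\<^sub>F j in sequentially. \<forall>k\<ge>nn j. \<forall>l\<ge>k. (\<Sum>i=k..<l. \<eta> i) \<le> 1 \<longrightarrow> norm (\<Sum>i=k..<l. \<eta> i *\<^sub>R \<xi> i) \<le> \<epsilon> * h"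
      using noise_small \<epsilon>h unfolding window_small_def by (intro eventually_nn eventually_all_ge) blast
    moreover have "\<forall>\<^sub>F j in sequentially. \<forall>k\<ge>nn j. \<forall>l\<ge>k. (\<Sum>i=k..<l. \<eta> i) \<le> 1 \<longrightarrow>
      (\<Sum>i=k..<l. \<eta> i * norm (\<xi> i)) \<le> C * (\<Sum>i=k..<l. \<eta> i) + h"
      by (intro eventually_nn eventually_all_ge noise_bounded h)
    moreover note near_on_window[OF t(1) h(1) th r(1)]
    ultimately have "\<forall>\<^sub>F j in sequentially. \<exists>c\<in>K. norm (w + \<tau> *\<^sub>R (P ?x *v (?p - c))) \<le> \<kappa> * \<epsilon>"
    proof eventually_elim
      case (elim j)
      define k l where "k = ?k j" and "l = ?l j"
      have kl: "k \<le> l" "nn j \<le> k" unfolding k_def l_def using h by (auto intro: index_at_mono index_at_ge)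
      have W1: "elapsed k l \<le> 1" unfolding k_def l_def using t h th by (intro elapsed_index_at_le_1) auto
      have elapsed_close: "\<bar>elapsed k l - h\<bar> < \<epsilon> * h" using elim(1) by (simp add: k_def l_def dist_real_def)
      have "\<epsilon> * h < 1 * h" using \<epsilon> h by (intro mult_strict_right_mono) auto
      with elapsed_close have elapsed_pos: "0 < elapsed k l" and elapsed_le: "elapsed k l \<le> 2 * h" by linarith+
      have m_close: "norm (m l - m k - (M (t + h) - M t)) < \<epsilon> * h"
        using elim(2) by (simp add: k_def l_def dist_norm)
      have step: "norm (x i - ?x) \<le> 2 * r" "norm (m i - ?p) \<le> 2 * r" "\<delta> i < r" "\<bar>\<theta> i / \<eta> i - \<tau>\<bar> < \<epsilon>"
        if "i \<in> {k..<l}" for i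
      proof -
        have i: "?k j \<le> i" "i \<le> ?l j" "nn j \<le> i" using that kl by (auto simp: k_def l_def)
        then have "norm (x i - ?x) \<le> L * h + r" "norm (m i - ?p) \<le> L * h + r" using elim(7) by blast+
        then show "norm (x i - ?x) \<le> 2 * r" "norm (m i - ?p) \<le> 2 * r" using Lh by linarith+
        show "\<delta> i < r" "\<bar>\<theta> i / \<eta> i - \<tau>\<bar> < \<epsilon>" using elim(3,4) i(3) by (auto simp: dist_real_def)
      qed
      have "\<exists>c\<in>K. norm (d i - c) \<le> 2 * \<epsilon>" if i: "i \<in> {k..<l}" for i
      proof -
        from d_in[of i] obtain y v b where y: "norm (y - x i) \<le> \<delta> i" and v: "v \<in> D y"
          and b: "norm b \<le> 1" and d_eq: "d i = v + \<delta> i *\<^sub>R b"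
          unfolding expansion_def by (auto simp: dist_norm norm_minus_commute)
        have \<delta>b: "norm (\<delta> i *\<^sub>R b) \<le> \<delta> i" using b \<delta>(1)[of i] by (simp add: mult_left_le)
        have \<delta>r: "\<delta> i \<le> r" using step(3)[OF i] by simp
        have "norm (y - ?x) \<le> norm (y - x i) + norm (x i - ?x)" by norm
        also have "\<dots> < \<rho>1" using y \<delta>r step(1)[OF i] r by linarith
        finally have "dist y ?x < \<rho>1" by (simp add: dist_norm)
        moreover have "norm v \<le> norm (d i) + norm (\<delta> i *\<^sub>R b)"
          using norm_triangle_ineq4[of "d i" "\<delta> i *\<^sub>R b"] unfolding d_eq by simp
        then have "norm v \<le> R + 1" using d_le[of i] \<delta>b \<delta>r r \<epsilon> by linarith
        ultimately obtain c where c: "c \<in> K" "norm (v - c) \<le> \<epsilon>" using \<rho>1(2) v by blast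
        have "norm (d i - c) \<le> norm (v - c) + norm (\<delta> i *\<^sub>R b)"
          using norm_triangle_ineq[of "v - c" "\<delta> i *\<^sub>R b"] unfolding d_eq by (simp add: algebra_simps)
        then have "norm (d i - c) \<le> 2 * \<epsilon>" using c \<delta>b \<delta>r r r(1) by linarith
        with c(1) show ?thesis by blast
      qed
      then obtain c where c: "\<And>i. i \<in> {k..<l} \<Longrightarrow> c i \<in> K" "\<And>i. i \<in> {k..<l} \<Longrightarrow> norm (d i - c i) \<le> 2 * \<epsilon>" by metis
      define cc where "cc = (\<Sum>i=k..<l. (\<eta> i / elapsed k l) *\<^sub>R c i)"
      have cc_K: "cc \<in> K"
        unfolding cc_def
      proof (rule convex_sum[OF _ convex_K])
        show "(\<Sum>i=k..<l. \<eta> i / elapsed k l) = 1"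
          unfolding sum_divide_distrib[symmetric] using elapsed_pos by (simp add: elapsed_def)
        show "0 \<le> \<eta> i / elapsed k l" for i using elapsed_pos \<eta>_pos[of i] by (simp add: less_imp_le)
      qed (use c in auto)
      have elapsed_cc: "elapsed k l *\<^sub>R cc = (\<Sum>i=k..<l. \<eta> i *\<^sub>R c i)"
        unfolding cc_def scaleR_sum_right using elapsed_pos by simp
      let ?u = "\<lambda>i. m i - d i - \<xi> i"
      have increment: "norm (m l - m k + \<tau> *\<^sub>R (P ?x *v (elapsed k l *\<^sub>R (?p - cc))) - \<tau> *\<^sub>R (P ?x *v (\<Sum>i=k..<l. \<eta> i *\<^sub>R \<xi> i)))
        \<le> (\<Sum>i=k..<l. \<epsilon> * (1 / \<mu> + \<tau>) * (\<eta> i * (2 * R) + \<eta> i * norm (\<xi> i)) + 3 * \<epsilon> * \<tau> / \<mu> * \<eta> i)"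
      proof -
        have "elapsed k l *\<^sub>R (?p - cc) = (\<Sum>i=k..<l. \<eta> i *\<^sub>R (?p - c i))"
          unfolding scaleR_diff_right elapsed_cc sum_subtractf by (simp add: elapsed_def scaleR_sum_left)
        then have "\<tau> *\<^sub>R (P ?x *v (elapsed k l *\<^sub>R (?p - cc))) - \<tau> *\<^sub>R (P ?x *v (\<Sum>i=k..<l. \<eta> i *\<^sub>R \<xi> i))
          = \<tau> *\<^sub>R (P ?x *v (\<Sum>i=k..<l. \<eta> i *\<^sub>R (?p - c i - \<xi> i)))"
          by (simp add: scaleR_diff_right[symmetric] matrix_vector_mult_diff_distrib[symmetric] sum_subtractf[symmetric])
        also have "\<dots> = (\<Sum>i=k..<l. \<eta> i *\<^sub>R (\<tau> *\<^sub>R (P ?x *v (?p - c i - \<xi> i))))"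
          by (simp add: linear_sum[OF matrix_vector_mul_linear] matrix_vector_mult_scaleR scaleR_sum_right mult.commute)
        finally have F: "\<tau> *\<^sub>R (P ?x *v (elapsed k l *\<^sub>R (?p - cc))) - \<tau> *\<^sub>R (P ?x *v (\<Sum>i=k..<l. \<eta> i *\<^sub>R \<xi> i))
          = (\<Sum>i=k..<l. \<eta> i *\<^sub>R (\<tau> *\<^sub>R (P ?x *v (?p - c i - \<xi> i))))" .
        have split: "m l - m k + \<tau> *\<^sub>R (P ?x *v (elapsed k l *\<^sub>R (?p - cc))) - \<tau> *\<^sub>R (P ?x *v (\<Sum>i=k..<l. \<eta> i *\<^sub>R \<xi> i))
          = (\<Sum>i=k..<l. \<eta> i *\<^sub>R (\<tau> *\<^sub>R (P ?x *v (?p - c i - \<xi> i))) - \<theta> i *\<^sub>R (P (x i) *v ?u i))"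
          unfolding add_diff_eq[symmetric] F unfolding m_increment[OF kl(1)]
          by (simp add: sum_subtractf sum_negf)
        show ?thesis
          unfolding split
        proof (rule sum_norm_le)
          fix i assume i: "i \<in> {k..<l}"
          have u: "norm (?u i) \<le> 2 * R + norm (\<xi> i)"
            using norm_triangle_ineq4[of "m i - d i" "\<xi> i"] norm_triangle_ineq4[of "m i" "d i"] m_le[of i] d_le[of i] by linarith
          have "dist (x i) ?x < \<rho>2" using step(1)[OF i] r by (simp add: dist_norm)
          then have P_close: "norm (P (x i) *v ?u i - P ?x *v ?u i) \<le> \<epsilon> * norm (?u i)" by (rule \<rho>2(2)[OF x_in])
          have "norm ((?p - c i) - (m i - d i)) \<le> norm (m i - ?p) + norm (d i - c i)" by norm
          also have "\<dots> \<le> 3 * \<epsilon>" using step(2)[OF i] c(2)[OF i] r by linarith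
          finally have diff: "norm ((?p - c i - \<xi> i) - ?u i) \<le> 3 * \<epsilon>" by (simp add: algebra_simps)
          have split_step: "\<tau> *\<^sub>R (P ?x *v (?p - c i - \<xi> i)) - (\<theta> i / \<eta> i) *\<^sub>R (P (x i) *v ?u i)
            = \<tau> *\<^sub>R (P ?x *v ((?p - c i - \<xi> i) - ?u i)) - \<tau> *\<^sub>R (P (x i) *v ?u i - P ?x *v ?u i)
              - (\<theta> i / \<eta> i - \<tau>) *\<^sub>R (P (x i) *v ?u i)"
            by (simp add: algebra_simps)
          have "norm (\<tau> *\<^sub>R (P ?x *v (?p - c i - \<xi> i)) - (\<theta> i / \<eta> i) *\<^sub>R (P (x i) *v ?u i))
            \<le> norm (\<tau> *\<^sub>R (P ?x *v ((?p - c i - \<xi> i) - ?u i)))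
              + norm (\<tau> *\<^sub>R (P (x i) *v ?u i - P ?x *v ?u i)) + norm ((\<theta> i / \<eta> i - \<tau>) *\<^sub>R (P (x i) *v ?u i))"
            unfolding split_step by (rule norm_diff_diff_le)
          also have "\<dots> \<le> \<tau> * (3 * \<epsilon> / \<mu>) + \<tau> * (\<epsilon> * (2 * R + norm (\<xi> i))) + \<epsilon> * ((2 * R + norm (\<xi> i)) / \<mu>)"
            unfolding norm_scaleR
          proof (intro add_mono mult_mono)
            show "norm (P ?x *v ((?p - c i - \<xi> i) - ?u i)) \<le> 3 * \<epsilon> / \<mu>"
              using \<mu>(1) diff by (intro order_trans[OF P_bound[OF x_ball]] divide_right_mono) auto
            show "norm (P (x i) *v ?u i - P ?x *v ?u i) \<le> \<epsilon> * (2 * R + norm (\<xi> i))"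
              using \<epsilon> u by (intro order_trans[OF P_close] mult_left_mono) auto
            show "norm (P (x i) *v ?u i) \<le> (2 * R + norm (\<xi> i)) / \<mu>"
              using \<mu>(1) u by (intro order_trans[OF P_bound[OF x_in]] divide_right_mono) auto
            show "\<bar>\<theta> i / \<eta> i - \<tau>\<bar> \<le> \<epsilon>" using step(4)[OF i] by simp
          qed (use \<tau>(1) \<epsilon> in auto)
          also have "\<dots> = \<epsilon> * (1 / \<mu> + \<tau>) * (2 * R + norm (\<xi> i)) + 3 * \<epsilon> * \<tau> / \<mu>"
            using \<mu>(1) by (simp add: field_simps)
          finally have "\<eta> i * norm (\<tau> *\<^sub>R (P ?x *v (?p - c i - \<xi> i)) - (\<theta> i / \<eta> i) *\<^sub>R (P (x i) *v ?u i))
            \<le> \<eta> i * (\<epsilon> * (1 / \<mu> + \<tau>) * (2 * R + norm (\<xi> i)) + 3 * \<epsilon> * \<tau> / \<mu>)"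
            using \<eta>_pos[of i] by (intro mult_left_mono) auto
          note bound = this
          have rescale: "\<eta> i *\<^sub>R (\<tau> *\<^sub>R (P ?x *v (?p - c i - \<xi> i))) - \<theta> i *\<^sub>R (P (x i) *v ?u i)
            = \<eta> i *\<^sub>R (\<tau> *\<^sub>R (P ?x *v (?p - c i - \<xi> i)) - (\<theta> i / \<eta> i) *\<^sub>R (P (x i) *v ?u i))"
            using \<eta>_pos[of i] by (simp add: scaleR_diff_right)
          show "norm (\<eta> i *\<^sub>R (\<tau> *\<^sub>R (P ?x *v (?p - c i - \<xi> i))) - \<theta> i *\<^sub>R (P (x i) *v ?u i))
            \<le> \<epsilon> * (1 / \<mu> + \<tau>) * (\<eta> i * (2 * R) + \<eta> i * norm (\<xi> i)) + 3 * \<epsilon> * \<tau> / \<mu> * \<eta> i"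
            unfolding rescale norm_scaleR abs_of_pos[OF \<eta>_pos[of i]]
            by (rule order_trans[OF bound eq_refl]) (simp add: distrib_left mult_ac)
        qed
      qed
      also have "\<dots> = \<epsilon> * (1 / \<mu> + \<tau>) * (2 * R * elapsed k l + (\<Sum>i=k..<l. \<eta> i * norm (\<xi> i))) + 3 * \<epsilon> * \<tau> / \<mu> * elapsed k l"
        unfolding sum.distrib sum_distrib_left[symmetric] elapsed_def by (simp add: sum_distrib_left mult.commute)
      also have "\<dots> \<le> \<epsilon> * (1 / \<mu> + \<tau>) * (2 * R * (2 * h) + (C * (2 * h) + h)) + 3 * \<epsilon> * \<tau> / \<mu> * (2 * h)"
      proof (intro add_mono mult_left_mono elapsed_le)
        have "(\<Sum>i=k..<l. \<eta> i * norm (\<xi> i)) \<le> C * elapsed k l + h"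
          using elim(6) kl W1 unfolding elapsed_def by blast
        also have "\<dots> \<le> C * (2 * h) + h" using C elapsed_le by (intro add_right_mono mult_left_mono)
        finally show "(\<Sum>i=k..<l. \<eta> i * norm (\<xi> i)) \<le> C * (2 * h) + h" .
      qed (use R_nonneg \<epsilon> \<mu>(1) \<tau>(1) in auto)
      finally have b1: "norm (m l - m k + \<tau> *\<^sub>R (P ?x *v (elapsed k l *\<^sub>R (?p - cc))) - \<tau> *\<^sub>R (P ?x *v (\<Sum>i=k..<l. \<eta> i *\<^sub>R \<xi> i)))
        \<le> h * (\<epsilon> * (1 / \<mu> + \<tau>) * (4 * R + 2 * C + 1) + 6 * \<epsilon> * \<tau> / \<mu>)"
        by (simp add: algebra_simps)
      have b2: "norm (\<tau> *\<^sub>R (P ?x *v (\<Sum>i=k..<l. \<eta> i *\<^sub>R \<xi> i))) \<le> h * (\<epsilon> * \<tau> / \<mu>)"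
      proof -
        have "norm (P ?x *v (\<Sum>i=k..<l. \<eta> i *\<^sub>R \<xi> i)) \<le> \<epsilon> * h / \<mu>"
          using elim(5) kl W1 \<mu>(1) unfolding elapsed_def
          by (intro order_trans[OF P_bound[OF x_ball]] divide_right_mono) auto
        then have "\<tau> * norm (P ?x *v (\<Sum>i=k..<l. \<eta> i *\<^sub>R \<xi> i)) \<le> \<tau> * (\<epsilon> * h / \<mu>)"
          using \<tau>(1) by (intro mult_left_mono) auto
        then show ?thesis using \<tau>(1) by (simp add: field_simps)
      qed
      have b3: "norm (\<tau> *\<^sub>R (P ?x *v ((h - elapsed k l) *\<^sub>R (?p - cc)))) \<le> h * (\<epsilon> * \<tau> * (2 * R + 1) / \<mu>)"
      proof -
        have "norm (?p - cc) \<le> 2 * R + 1"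
          using norm_triangle_ineq4[of ?p cc] M_le[OF tt] cc_K by (simp add: K_def)
        then have "norm (P ?x *v (?p - cc)) \<le> (2 * R + 1) / \<mu>"
          using \<mu>(1) by (intro order_trans[OF P_bound[OF x_ball]] divide_right_mono) auto
        then have "\<tau> * (\<bar>h - elapsed k l\<bar> * norm (P ?x *v (?p - cc))) \<le> \<tau> * ((\<epsilon> * h) * ((2 * R + 1) / \<mu>))"
          using elapsed_close \<tau>(1) \<epsilon>h by (intro mult_left_mono mult_mono) (auto simp: abs_minus_commute)
        moreover have "\<tau> * ((\<epsilon> * h) * ((2 * R + 1) / \<mu>)) = h * (\<epsilon> * \<tau> * (2 * R + 1) / \<mu>)" by simp
        ultimately show ?thesis
          unfolding matrix_vector_mult_scaleR norm_scaleR abs_of_pos[OF \<tau>(1)] by linarith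
      qed
      \<comment> \<open>The three errors: variable coefficients, averaged noise, and the length of the window.\<close>
      define a1 a2 a3 where "a1 = m l - m k + \<tau> *\<^sub>R (P ?x *v (elapsed k l *\<^sub>R (?p - cc))) - \<tau> *\<^sub>R (P ?x *v (\<Sum>i=k..<l. \<eta> i *\<^sub>R \<xi> i))"
        and "a2 = \<tau> *\<^sub>R (P ?x *v (\<Sum>i=k..<l. \<eta> i *\<^sub>R \<xi> i))"
        and "a3 = \<tau> *\<^sub>R (P ?x *v ((h - elapsed k l) *\<^sub>R (?p - cc)))"
      have split: "h *\<^sub>R (w + \<tau> *\<^sub>R (P ?x *v (?p - cc))) =
        a1 + a2 + a3 - (M (t + h) - M t - h *\<^sub>R w) - (m l - m k - (M (t + h) - M t))"
        unfolding a1_def a2_def a3_def matrix_vector_mult_scaleR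
        by (simp add: scaleR_diff_left scaleR_diff_right scaleR_add_right mult.commute)
      have "norm (h *\<^sub>R (w + \<tau> *\<^sub>R (P ?x *v (?p - cc)))) \<le> norm a1 + norm a2 + norm a3 + norm (M (t + h) - M t - h *\<^sub>R w) + norm (m l - m k - (M (t + h) - M t))"
        unfolding split by (rule order_trans[OF norm_diff_diff_le]) (intro add_right_mono norm_add_add_le)
      also have "\<dots> \<le> h * (\<epsilon> * (1 / \<mu> + \<tau>) * (4 * R + 2 * C + 1) + 6 * \<epsilon> * \<tau> / \<mu>) + h * (\<epsilon> * \<tau> / \<mu>)
          + h * (\<epsilon> * \<tau> * (2 * R + 1) / \<mu>) + \<epsilon> * h + \<epsilon> * h"
        using b1 b2 b3 quot m_close unfolding a1_def a2_def a3_def by (intro add_mono) auto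
      also have "\<dots> = h * (\<kappa> * \<epsilon>)"
        using \<mu>(1) unfolding \<kappa>_def by (simp add: field_simps)
      finally have "norm (w + \<tau> *\<^sub>R (P ?x *v (?p - cc))) \<le> \<kappa> * \<epsilon>" using h(1) by simp
      with cc_K show ?case by blast
    qed
    then show ?thesis by simp
  qed
  have \<kappa>_pos: "\<kappa> > 0"
    using R_nonneg C \<mu>(1) \<tau>(1) unfolding \<kappa>_def by (intro add_pos_nonneg) auto
  have "K \<noteq> {}" using approx[of "1/2"] by auto
  moreover have "continuous_on K (\<lambda>c. norm (w + \<tau> *\<^sub>R (P ?x *v (?p - c))))"
    by (intro continuous_intros continuous_on_compose2[OF matrix_vector_mult_linear_continuous_on[of UNIV]]) auto
  ultimately obtain c where c: "c \<in> K" and min: "\<And>c'. c' \<in> K \<Longrightarrow>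
      norm (w + \<tau> *\<^sub>R (P ?x *v (?p - c))) \<le> norm (w + \<tau> *\<^sub>R (P ?x *v (?p - c')))"
    using continuous_attains_inf[OF compact_K] by blast
  have "norm (w + \<tau> *\<^sub>R (P ?x *v (?p - c))) \<le> 0 + e" if "e > 0" for e
  proof -
    define \<epsilon> where "\<epsilon> = min (1/2) (e / \<kappa>)"
    have "0 < \<epsilon>" "\<epsilon> < 1" using that \<kappa>_pos by (auto simp: \<epsilon>_def)
    from approx[OF this] min have "norm (w + \<tau> *\<^sub>R (P ?x *v (?p - c))) \<le> \<kappa> * \<epsilon>" by (meson order_trans)
    also have "\<dots> \<le> \<kappa> * (e / \<kappa>)" using \<kappa>_pos by (intro mult_left_mono) (auto simp: \<epsilon>_def)
    finally show ?thesis using \<kappa>_pos by simp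
  qed
  then have "norm (w + \<tau> *\<^sub>R (P ?x *v (?p - c))) \<le> 0" by (rule field_le_epsilon)
  then have "w = - (\<tau> *\<^sub>R (P ?x *v (?p - c)))" by (simp add: eq_neg_iff_add_eq_0)
  then have "H ?x *v w = - (\<tau> *\<^sub>R (?p - c))"
    by (simp add: matrix_vector_mult_scaleR H_P linear_neg[OF matrix_vector_mul_linear])
  moreover have "c \<in> D ?x" using c by (simp add: K_def)
  ultimately show ?thesis by blast
qed

end

end

section \<open>Energy along limit curves\<close>

lemma locally_lipschitz_imp_isCont:
  fixes f :: "'a::metric_space \<Rightarrow> 'b::metric_space"
  assumes "locally_lipschitz f"
  shows "isCont f z"
proof -
  obtain e L where e: "e > 0" "L-lipschitz_on (ball z e) f"
    using assms unfolding locally_lipschitz_def by blast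
  from lipschitz_on_continuous_on[OF e(2)] have "continuous (at z within ball z e) f"
    using e(1) by (simp add: continuous_on_eq_continuous_within)
  then show ?thesis using e(1) by (simp add: at_within_open[of z "ball z e"])
qed

context momentum_recursion
begin

definition energy :: "(real^'n \<Rightarrow> real) \<Rightarrow> (real^'n) \<times> (real^'n) \<Rightarrow> real" where
  "energy f p = f (fst p) + (norm (snd p))\<^sup>2 / (2 * \<tau>)"

context
  fixes f :: "real^'n \<Rightarrow> real" and nn :: "nat \<Rightarrow> nat" and X M :: "real \<Rightarrow> real^'n"
  assumes loc_lip: "locally_lipschitz f" and cf: "conservative_field f D" and conv: "\<And>z. convex (D z)"
    and nn: "filterlim nn at_top sequentially"
    and X_lim: "\<And>t. t \<in> {0..1} \<Longrightarrow> (\<lambda>j. x (index_at (nn j) t)) \<longlonglongrightarrow> X t"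
    and M_lim: "\<And>t. t \<in> {0..1} \<Longrightarrow> (\<lambda>j. m (index_at (nn j) t)) \<longlonglongrightarrow> M t"
    and X_lip: "L-lipschitz_on {0..1} X" and M_lip: "L-lipschitz_on {0..1} M"
begin

abbreviation energy_along :: "real \<Rightarrow> real" where "energy_along t \<equiv> energy f (X t, M t)"

text \<open>Lipschitz curves are absolutely continuous, so the conservative field provides derivatives almost
  everywhere, and the chain rule along \<open>X\<close>; applied to \<open>M\<close> it is used for differentiability alone.\<close>

lemma AE_differentiable:
  "AE t in lebesgue_on {0..1}. \<exists>X' M'. (X has_vector_derivative X') (at t within {0..1}) \<and>
     (M has_vector_derivative M') (at t within {0..1}) \<and>
     (\<forall>v\<in>D (X t). ((f \<circ> X) has_real_derivative v \<bullet> X') (at t within {0..1}))"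
proof -
  have chain: "AE t in lebesgue_on {0..1}. \<exists>\<gamma>'.
       (\<gamma> has_vector_derivative \<gamma>') (at t within {0..1}) \<and>
       (\<forall>v\<in>D (\<gamma> t). ((f \<circ> \<gamma>) has_real_derivative v \<bullet> \<gamma>') (at t within {0..1}))"
    if "L-lipschitz_on {0..1} \<gamma>" for \<gamma>
    using cf lipschitz_imp_abs_cont_on[OF that] unfolding conservative_field_def by blast
  from chain[OF X_lip] chain[OF M_lip] show ?thesis
    by eventually_elim blast
qed

text \<open>With \<open>c\<close> from \<open>M_velocity\<close>, the derivative is \<open>c \<bullet> X' + M t \<bullet> M' / \<tau>\<close>, and
  \<open>c = M t + (1 / \<tau>) *\<^sub>R (H *v M')\<close>. By symmetry of \<open>H\<close> the terms with \<open>M'\<close> cancel, because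
  \<open>H *v X' = - M t\<close>.\<close>

lemma energy_derivative:
  assumes t: "0 \<le> t" "t < 1"
    and X': "(X has_vector_derivative X') (at t within {0..1})"
    and M': "(M has_vector_derivative M') (at t within {0..1})"
    and f': "\<And>v. v \<in> D (X t) \<Longrightarrow> ((f \<circ> X) has_real_derivative v \<bullet> X') (at t within {0..1})"
  shows "H (X t) *v X' = - M t" "(energy_along has_real_derivative - (X' \<bullet> (H (X t) *v X'))) (at t within {0..1})"
proof -
  show HX: "H (X t) *v X' = - M t" by (rule X_velocity[OF nn X_lim M_lim t X'])
  have "closed {(z, v). v \<in> D z}" using cf unfolding conservative_field_def by blast
  from M_velocity[OF nn X_lim M_lim this conv t M'] obtain c where
    c: "c \<in> D (X t)" "H (X t) *v M' = - (\<tau> *\<^sub>R (M t - c))" by blast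
  have "(M has_derivative (\<lambda>h. h *\<^sub>R M')) (at t within {0..1})"
    using M' unfolding has_vector_derivative_def .
  from has_derivative_inner[OF this this]
  have "((\<lambda>s. M s \<bullet> M s) has_real_derivative 2 * (M t \<bullet> M')) (at t within {0..1})"
    unfolding has_field_derivative_def
    by (rule has_derivative_eq_rhs) (auto simp: fun_eq_iff inner_commute)
  then have "((\<lambda>s. (norm (M s))\<^sup>2 / (2 * \<tau>)) has_real_derivative 2 * (M t \<bullet> M') / (2 * \<tau>)) (at t within {0..1})"
    unfolding power2_norm_eq_inner by (rule DERIV_cdivide)
  from DERIV_add[OF f'[OF c(1)] this]
  have "(energy_along has_real_derivative c \<bullet> X' + 2 * (M t \<bullet> M') / (2 * \<tau>)) (at t within {0..1})"
    unfolding energy_def fst_conv snd_conv o_def .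
  moreover have "c \<bullet> X' + 2 * (M t \<bullet> M') / (2 * \<tau>) = - (X' \<bullet> (H (X t) *v X'))"
  proof -
    have c_eq: "c = M t + (1 / \<tau>) *\<^sub>R (H (X t) *v M')"
      unfolding c(2) using \<tau>(1) by simp
    have "c \<bullet> X' = M t \<bullet> X' + (1 / \<tau>) * (X' \<bullet> (H (X t) *v M'))"
      by (subst c_eq) (simp only: inner_add_left inner_scaleR_left inner_commute[of X' "H (X t) *v M'"])
    also have "X' \<bullet> (H (X t) *v M') = - (M t \<bullet> M')"
      by (subst positive_definite_sym[OF pd]) (simp add: HX inner_commute)
    also have "M t \<bullet> X' = - (X' \<bullet> (H (X t) *v X'))" by (simp add: HX inner_commute)
    finally show ?thesis using \<tau>(1) by (simp add: field_simps)
  qed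
  ultimately show "(energy_along has_real_derivative - (X' \<bullet> (H (X t) *v X'))) (at t within {0..1})" by simp
qed

lemma X_cont: "continuous_on {0..1} X" and M_cont: "continuous_on {0..1} M"
  using X_lip M_lip by (auto intro: lipschitz_on_continuous_on)

lemma energy_along_continuous: "continuous_on {0..1} energy_along"
proof -
  have "continuous_on UNIV f"
    by (rule continuous_at_imp_continuous_on) (simp add: locally_lipschitz_imp_isCont[OF loc_lip])
  from continuous_on_compose2[OF this X_cont] have "continuous_on {0..1} (\<lambda>t. f (X t))" by simp
  then show ?thesis
    unfolding energy_def fst_conv snd_conv using \<tau>(1)
    by (intro continuous_on_add continuous_on_divide continuous_on_power continuous_on_norm M_cont continuous_on_const) auto
qed

lemma energy_along_locally_lipschitz:
  assumes t: "t \<in> {0..1}"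
  shows "\<exists>T B. open T \<and> t \<in> T \<and> (\<forall>s\<in>{0..1} \<inter> T. norm (energy_along s - energy_along t) \<le> B * norm (s - t))"
proof -
  obtain \<rho> K where \<rho>: "\<rho> > 0" "K-lipschitz_on (ball (X t) \<rho>) f"
    using loc_lip unfolding locally_lipschitz_def by blast
  have "K \<ge> 0" using \<rho>(2) by (rule lipschitz_on_nonneg)
  define B where "B = K * L + R * L / \<tau>"
  define T where "T = ball t (\<rho> / (L + 1))"
  have "norm (energy_along s - energy_along t) \<le> B * norm (s - t)" if s: "s \<in> {0..1} \<inter> T" for s
  proof -
    have dX: "norm (X s - X t) \<le> L * norm (s - t)" and dM: "norm (M s - M t) \<le> L * norm (s - t)"
      using lipschitz_onD[OF X_lip, of s t] lipschitz_onD[OF M_lip, of s t] s t by (auto simp: dist_norm)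
    have "norm (X s - X t) < \<rho>"
    proof -
      have "L * norm (s - t) \<le> (L + 1) * norm (s - t)" by (intro mult_right_mono) auto
      also have "\<dots> < \<rho>" using s L_nonneg by (simp add: T_def dist_real_def abs_minus_commute field_simps)
      finally show ?thesis using dX by simp
    qed
    then have "X s \<in> ball (X t) \<rho>" by (simp add: dist_norm norm_minus_commute)
    then have "norm (f (X s) - f (X t)) \<le> K * norm (X s - X t)"
      using lipschitz_onD[OF \<rho>(2), of "X s" "X t"] \<rho>(1) by (simp add: dist_norm)
    also have "\<dots> \<le> K * (L * norm (s - t))" using \<open>K \<ge> 0\<close> dX by (intro mult_left_mono)
    finally have 1: "norm (f (X s) - f (X t)) \<le> K * L * norm (s - t)" by (simp add: mult.assoc)
    have "norm ((norm (M s))\<^sup>2 - (norm (M t))\<^sup>2) = (norm (M s) + norm (M t)) * \<bar>norm (M s) - norm (M t)\<bar>"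
      by (simp add: power2_eq_square square_diff_square_factored abs_mult)
    also have "\<dots> \<le> (R + R) * (L * norm (s - t))"
      using M_le[OF nn X_lim M_lim, of s] M_le[OF nn X_lim M_lim, of t] s t dM norm_triangle_ineq3[of "M s" "M t"] R_nonneg
      by (intro mult_mono add_mono) auto
    finally have "norm ((norm (M s))\<^sup>2 - (norm (M t))\<^sup>2) / (2 * \<tau>) \<le> ((R + R) * (L * norm (s - t))) / (2 * \<tau>)"
      using \<tau>(1) by (intro divide_right_mono) auto
    then have 2: "norm ((norm (M s))\<^sup>2 / (2 * \<tau>) - (norm (M t))\<^sup>2 / (2 * \<tau>)) \<le> R * L / \<tau> * norm (s - t)"
      using \<tau>(1) by (simp add: diff_divide_distrib[symmetric])
    have "energy_along s - energy_along t = (f (X s) - f (X t)) + ((norm (M s))\<^sup>2 / (2 * \<tau>) - (norm (M t))\<^sup>2 / (2 * \<tau>))"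
      by (simp add: energy_def)
    then have "norm (energy_along s - energy_along t) \<le> norm (f (X s) - f (X t)) + norm ((norm (M s))\<^sup>2 / (2 * \<tau>) - (norm (M t))\<^sup>2 / (2 * \<tau>))"
      using norm_triangle_ineq by metis
    then show ?thesis using 1 2 by (simp add: B_def distrib_right)
  qed
  moreover have "open T" "t \<in> T" using \<rho>(1) L_nonneg by (auto simp: T_def)
  ultimately show ?thesis by blast
qed

text \<open>From \<open>H *v X' = - M t\<close> and \<open>\<bar>H *v X'\<bar> \<le> \<Lambda> \<bar>X'\<bar>\<close>, the speed is at least \<open>\<beta> / \<Lambda>\<close>, and ellipticity turns
  this into a rate of decay.\<close>

lemma energy_decay:
  assumes ab: "0 \<le> a" "a \<le> b" "b \<le> 1" and \<beta>: "\<beta> \<ge> 0" "\<And>t. t \<in> {a..b} \<Longrightarrow> \<beta> \<le> norm (M t)"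
    and \<Lambda>: "\<Lambda> > 0" "\<And>z h. z \<in> cball 0 R \<Longrightarrow> norm (H z *v h) \<le> \<Lambda> * norm h"
  shows "energy_along b \<le> energy_along a - \<mu> * (\<beta> / \<Lambda>)\<^sup>2 * (b - a)"
proof -
  let ?c = "- (\<mu> * (\<beta> / \<Lambda>)\<^sup>2)"
  have "energy_along b \<le> energy_along a + ?c * (b - a)"
  proof (rule growth_le_if_AE_derivative_le[OF _ _ _ ab(2)])
    show "continuous_on {a..b} energy_along" by (rule continuous_on_subset[OF energy_along_continuous]) (use ab in auto)
    show "\<exists>T B. open T \<and> t \<in> T \<and> (\<forall>s\<in>{a..b} \<inter> T. norm (energy_along s - energy_along t) \<le> B * norm (s - t))" if "t \<in> {a..b}" for t
    proof -
      have "t \<in> {0..1}" using that ab by auto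
      from energy_along_locally_lipschitz[OF this] obtain T B where T: "open T" "t \<in> T"
        "\<forall>s\<in>{0..1} \<inter> T. norm (energy_along s - energy_along t) \<le> B * norm (s - t)" by blast
      have "{a..b} \<inter> T \<subseteq> {0..1} \<inter> T" using ab by auto
      with T show ?thesis by blast
    qed
    let ?good = "\<lambda>t. \<exists>X' M'. (X has_vector_derivative X') (at t within {0..1}) \<and>
     (M has_vector_derivative M') (at t within {0..1}) \<and>
     (\<forall>v\<in>D (X t). ((f \<circ> X) has_real_derivative v \<bullet> X') (at t within {0..1}))"
    have "negligible ({t\<in>{0..1}. \<not> ?good t} \<union> {1})"
      by (intro negligible_Un AE_lebesgue_on_negligible AE_differentiable) simp
    then show "negligible {t\<in>{a..b}. \<not> (\<exists>D\<le>?c. (energy_along has_real_derivative D) (at t within {a..b}))}"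
    proof (rule negligible_subset, intro subsetI)
      fix t assume t: "t \<in> {t\<in>{a..b}. \<not> (\<exists>D\<le>?c. (energy_along has_real_derivative D) (at t within {a..b}))}"
      show "t \<in> {t\<in>{0..1}. \<not> ?good t} \<union> {1}"
      proof (rule ccontr)
        assume no: "t \<notin> {t\<in>{0..1}. \<not> ?good t} \<union> {1}"
        have t01: "0 \<le> t" "t < 1" using no t ab by auto
        then have "?good t" using no by auto
        then obtain X' M' where good: "(X has_vector_derivative X') (at t within {0..1})"
          "(M has_vector_derivative M') (at t within {0..1})"
          "\<And>v. v\<in>D (X t) \<Longrightarrow> ((f \<circ> X) has_real_derivative v \<bullet> X') (at t within {0..1})" by blast
        note der = energy_derivative[OF t01 good]
        have Xt: "X t \<in> cball 0 R" using t01 by (intro X_in[OF nn X_lim M_lim]) auto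
        have "\<beta> \<le> norm (M t)" using \<beta>(2)[of t] t by simp
        also have "\<dots> = norm (H (X t) *v X')" using der(1) by simp
        also have "\<dots> \<le> \<Lambda> * norm X'" by (rule \<Lambda>(2)[OF Xt])
        finally have "\<beta> / \<Lambda> \<le> norm X'" using \<Lambda>(1) by (simp add: field_simps)
        then have "(\<beta> / \<Lambda>)\<^sup>2 \<le> (norm X')\<^sup>2" using \<beta>(1) \<Lambda>(1) by (intro power_mono) auto
        then have "\<mu> * (\<beta> / \<Lambda>)\<^sup>2 \<le> \<mu> * (norm X')\<^sup>2" using \<mu>(1) by (intro mult_left_mono) auto
        also have "\<dots> \<le> X' \<bullet> (H (X t) *v X')" by (rule \<mu>(2)[OF Xt])
        finally have "- (X' \<bullet> (H (X t) *v X')) \<le> ?c" by simp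
        moreover have "(energy_along has_real_derivative - (X' \<bullet> (H (X t) *v X'))) (at t within {a..b})"
          by (rule has_field_derivative_subset[OF der(2)]) (use ab in auto)
        ultimately show False using t by blast
      qed
    qed
  qed
  then show ?thesis by simp
qed

lemma energy_nonincreasing: "0 \<le> a \<Longrightarrow> a \<le> b \<Longrightarrow> b \<le> 1 \<Longrightarrow> energy_along b \<le> energy_along a"
proof -
  assume ab: "0 \<le> a" "a \<le> b" "b \<le> 1"
  obtain \<Lambda> where \<Lambda>: "\<Lambda> > 0" "\<And>z h. z \<in> cball 0 R \<Longrightarrow> norm (H z *v h) \<le> \<Lambda> * norm h"
    using hessian_bounded_on_compact[OF C2 pd compact_cball[of 0 R]] by blast
  show "energy_along b \<le> energy_along a" using energy_decay[OF ab, of 0 \<Lambda>] \<Lambda> by simp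
qed

text \<open>Constant energy forces \<open>M t = 0\<close> for \<open>t < 1\<close>. Then \<open>M' = 0\<close>, so \<open>M_velocity\<close> gives
  \<open>0 \<in> D (X t)\<close> for almost every \<open>t\<close>; let \<open>t\<close> tend to \<open>0\<close> and use the closed graph.\<close>

lemma stationary_if_energy_constant:
  assumes const: "energy_along 1 = energy_along 0"
  shows "M 0 = 0" "0 \<in> D (X 0)"
proof -
  obtain \<Lambda> where \<Lambda>: "\<Lambda> > 0" "\<And>z h. z \<in> cball 0 R \<Longrightarrow> norm (H z *v h) \<le> \<Lambda> * norm h"
    using hessian_bounded_on_compact[OF C2 pd compact_cball[of 0 R]] by blast
  have interior: "M t = 0" if t: "0 \<le> t" "t < 1" for t
  proof (rule ccontr)
    assume "M t \<noteq> 0"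
    define \<beta> where "\<beta> = norm (M t) / 2"
    have "\<beta> > 0" using \<open>M t \<noteq> 0\<close> by (simp add: \<beta>_def)
    define b where "b = min 1 (t + \<beta> / (L + 1))"
    have b: "t < b" "b \<le> 1" using t \<open>\<beta> > 0\<close> L_nonneg by (auto simp: b_def)
    have "\<beta> \<le> norm (M s)" if s: "s \<in> {t..b}" for s
    proof -
      have "norm (M s - M t) \<le> L * norm (s - t)"
        using lipschitz_onD[OF M_lip, of s t] s t b by (auto simp: dist_norm)
      also have "\<dots> \<le> (L + 1) * (\<beta> / (L + 1))"
        using s L_nonneg by (intro mult_mono) (auto simp: b_def)
      also have "\<dots> = \<beta>" using L_nonneg by simp
      finally show ?thesis using norm_triangle_ineq2[of "M t" "M s"] by (simp add: \<beta>_def norm_minus_commute)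
    qed
    then have "energy_along b \<le> energy_along t - \<mu> * (\<beta> / \<Lambda>)\<^sup>2 * (b - t)"
      using t b \<open>\<beta> > 0\<close> \<Lambda> by (intro energy_decay) auto
    moreover have "0 < \<mu> * (\<beta> / \<Lambda>)\<^sup>2 * (b - t)" using \<mu>(1) \<Lambda>(1) \<open>\<beta> > 0\<close> b by simp
    moreover have "energy_along 1 \<le> energy_along b" "energy_along t \<le> energy_along 0" using t b by (auto intro: energy_nonincreasing)
    ultimately show False using const by linarith
  qed
  show "M 0 = 0" using interior by simp
  have graph: "closed {(z, v). v \<in> D z}" using cf unfolding conservative_field_def by blast
  have "\<exists>s. 0 < s \<and> s < inverse (real (Suc n)) \<and> 0 \<in> D (X s)" for n
  proof -
    let ?good = "\<lambda>t. \<exists>X' M'. (X has_vector_derivative X') (at t within {0..1}) \<and>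
     (M has_vector_derivative M') (at t within {0..1}) \<and>
     (\<forall>v\<in>D (X t). ((f \<circ> X) has_real_derivative v \<bullet> X') (at t within {0..1}))"
    have le1: "inverse (real (Suc n)) \<le> 1" by (simp add: inverse_le_1_iff)
    obtain s where s: "0 < s" "s < inverse (real (Suc n))" "?good s"
      by (rule AE_lebesgue_on_frequently[OF AE_differentiable, of 0 "inverse (real (Suc n))"])
        (use le1 in auto)
    then have s1: "0 \<le> s" "s < 1" using le1 by linarith+
    from s(3) obtain M' where M': "(M has_vector_derivative M') (at s within {0..1})" by blast
    from M_velocity[OF nn X_lim M_lim graph conv s1 M'] obtain c where
      c: "c \<in> D (X s)" "H (X s) *v M' = - (\<tau> *\<^sub>R (M s - c))" by blast
    have "M' = 0"
    proof -
      have "norm M' \<le> 0 + \<epsilon>" if \<epsilon>: "\<epsilon> > 0" for \<epsilon>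
      proof -
        obtain h0 where h0: "h0 > 0" "\<And>h. 0 < h \<Longrightarrow> h < h0 \<Longrightarrow> s + h \<le> 1 \<and> norm (M (s + h) - M s - h *\<^sub>R M') \<le> \<epsilon> * h"
          using right_difference_quotient[OF M' s1 \<epsilon>] by blast
        define h where "h = min (h0 / 2) ((1 - s) / 2)"
        have h: "0 < h" "h < h0" "s + h < 1" using h0(1) s1 by (auto simp: h_def min_def field_simps)
        have "M (s + h) = 0" "M s = 0" using h s1 by (auto intro: interior)
        then show ?thesis using h0(2)[OF h(1,2)] h(1) by simp
      qed
      then have "norm M' \<le> 0" by (rule field_le_epsilon)
      then show ?thesis by simp
    qed
    then have "\<tau> *\<^sub>R (M s - c) = 0" using c(2) by simp
    then have "c = 0" using \<tau>(1) interior[OF s1] by simp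
    with c(1) s show ?thesis by blast
  qed
  then obtain s where s: "\<And>n. 0 < s n" "\<And>n. s n < inverse (real (Suc n))" "\<And>n. 0 \<in> D (X (s n))" by metis
  have s_lim: "s \<longlonglongrightarrow> 0"
    by (rule tendsto_sandwich[OF _ _ tendsto_const LIMSEQ_inverse_real_of_nat])
      (use s in \<open>auto intro!: always_eventually less_imp_le\<close>)
  have s01: "s n \<in> {0..1}" for n
  proof -
    have "inverse (real (Suc n)) \<le> 1" by (simp add: inverse_le_1_iff)
    with s(1,2)[of n] show ?thesis by (simp add: less_imp_le)
  qed
  have "(\<lambda>n. X (s n)) \<longlonglongrightarrow> X 0"
    by (rule continuous_on_tendsto_compose[OF X_cont s_lim]) (use s01 in auto)
  then have "(\<lambda>n. (X (s n), 0 :: real^'n)) \<longlonglongrightarrow> (X 0, 0)" by (intro tendsto_intros)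
  from closed_sequentially[OF graph _ this] s(3) show "0 \<in> D (X 0)" by simp
qed

end

end

section \<open>Convergence of a path\<close>

lemma not_convergent_crossing:
  fixes s :: "nat \<Rightarrow> real"
  assumes "bounded (range s)" "\<not> convergent s"
  obtains a b where "a < b" "\<exists>\<^sub>F k in sequentially. s k < a" "\<exists>\<^sub>F k in sequentially. b < s k"
proof -
  have "compact (closure (range s))" using assms(1) by simp
  moreover have "\<forall>k. s k \<in> closure (range s)" using closure_subset[of "range s"] by blast
  ultimately obtain l r where r: "strict_mono (r :: nat \<Rightarrow> nat)" "(s \<circ> r) \<longlonglongrightarrow> l"
    unfolding compact_def by metis
  have "\<not> s \<longlonglongrightarrow> l" using assms(2) by (auto simp: convergent_def)
  then obtain \<epsilon> where \<epsilon>: "\<epsilon> > 0" "\<exists>\<^sub>F k in sequentially. \<not> dist (s k) l < \<epsilon>"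
    unfolding tendsto_iff frequently_def by auto
  have near: "\<exists>\<^sub>F k in sequentially. dist (s k) l < \<epsilon> / 3"
  proof -
    have "\<forall>\<^sub>F j in sequentially. dist (s (r j)) l < \<epsilon> / 3"
      using tendstoD[OF r(2), of "\<epsilon> / 3"] \<epsilon>(1) by simp
    then show ?thesis
      unfolding frequently_sequentially eventually_sequentially
      by (meson le_trans nle_le r(1) seq_suble)
  qed
  have "\<exists>\<^sub>F k in sequentially. l + 2 * \<epsilon> / 3 < s k \<or> s k < l - 2 * \<epsilon> / 3"
    using \<epsilon>(2) by (rule frequently_elim1) (use \<epsilon>(1) in \<open>auto simp: dist_real_def abs_if split: if_splits\<close>)
  then consider "\<exists>\<^sub>F k in sequentially. l + 2 * \<epsilon> / 3 < s k" | "\<exists>\<^sub>F k in sequentially. s k < l - 2 * \<epsilon> / 3"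
    unfolding frequently_disj_iff by blast
  then show thesis
  proof cases
    case 1
    have "\<exists>\<^sub>F k in sequentially. s k < l + \<epsilon> / 3"
      using near by (rule frequently_elim1) (unfold dist_real_def, linarith)
    with 1 show thesis using \<epsilon>(1) by (intro that[of "l + \<epsilon> / 3" "l + 2 * \<epsilon> / 3"]) auto
  next
    case 2
    have "\<exists>\<^sub>F k in sequentially. l - \<epsilon> / 3 < s k"
      using near by (rule frequently_elim1) (unfold dist_real_def, linarith)
    with 2 show thesis using \<epsilon>(1) by (intro that[of "l - 2 * \<epsilon> / 3" "l - \<epsilon> / 3"]) auto
  qed
qed

lemma last_exit_before_upcrossing:
  fixes s :: "nat \<Rightarrow> real"
  assumes "a \<le> c" "c \<le> b" "\<exists>\<^sub>F k in sequentially. s k < a" "\<exists>\<^sub>F k in sequentially. b < s k"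
  obtains p q where "j \<le> p" "p < q" "s p \<le> c" "\<And>i. p < i \<Longrightarrow> i \<le> q \<Longrightarrow> c < s i" "b < s q"
proof -
  obtain k where k: "j \<le> k" "s k < a" using assms(3) unfolding frequently_sequentially by blast
  obtain q where q: "k \<le> q" "b < s q" using assms(4) unfolding frequently_sequentially by blast
  define A where "A = {i\<in>{k..q}. s i \<le> c}"
  have A: "finite A" "k \<in> A" using k q assms(1) by (auto simp: A_def)
  then have "A \<noteq> {}" by blast
  have mx: "Max A \<in> A" by (rule Max_in[OF A(1) \<open>A \<noteq> {}\<close>])
  show thesis
  proof (rule that[of "Max A" q])
    show "j \<le> Max A" using mx k by (auto simp: A_def)
    show "s (Max A) \<le> c" using mx by (auto simp: A_def)
    then have "Max A \<noteq> q" using q assms(2) by auto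
    then show "Max A < q" using mx by (auto simp: A_def)
    show "c < s i" if "Max A < i" "i \<le> q" for i
    proof (rule ccontr)
      assume "\<not> c < s i"
      then have "i \<in> A" using that mx by (auto simp: A_def)
      then have "i \<le> Max A" by (rule Max_ge[OF A(1)])
      with that show False by simp
    qed
    show "b < s q" by (rule q)
  qed
qed

context momentum_recursion
begin

context
  fixes f :: "real^'n \<Rightarrow> real"
  assumes loc_lip: "locally_lipschitz f" and cf: "conservative_field f D" and conv: "\<And>z. convex (D z)"
begin

abbreviation "E k \<equiv> energy f (x k, m k)"

lemma energy_continuous: "continuous_on S (energy f)"
proof -
  have "continuous_on UNIV f"
    by (rule continuous_at_imp_continuous_on) (simp add: locally_lipschitz_imp_isCont[OF loc_lip])
  from continuous_on_compose2[OF this continuous_on_fst[OF continuous_on_id]]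
  have "continuous_on S (\<lambda>p. f (fst p))" by simp
  then show ?thesis
    unfolding energy_def using \<tau>(1)
    by (intro continuous_on_add continuous_on_divide continuous_on_power continuous_on_norm
        continuous_on_snd continuous_on_id continuous_on_const) auto
qed

lemma energy_tendsto: "u \<longlonglongrightarrow> p \<Longrightarrow> (\<lambda>j. energy f (u j)) \<longlonglongrightarrow> energy f p"
proof -
  assume u: "u \<longlonglongrightarrow> p"
  have "isCont (energy f) p"
    using energy_continuous[of UNIV] unfolding continuous_on_eq_continuous_at[OF open_UNIV] by blast
  then show ?thesis by (rule isCont_tendsto_compose[OF _ u])
qed

abbreviation "states \<equiv> cball (0::real^'n) R \<times> cball (0::real^'n) R"

lemma compact_states: "compact states" by (intro compact_Times) auto

lemma state_in: "(x k, m k) \<in> states" using x_le m_le by simp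

text \<open>The properties of limit curves in terms of the energies \<open>E k\<close> of the iterates alone, with \<open>h t\<close>
  the energy of the limit curve at time \<open>t\<close>.\<close>

lemma limit_energy:
  assumes nn: "filterlim nn at_top sequentially" and z0: "(\<lambda>j. (x (nn j), m (nn j))) \<longlonglongrightarrow> (x0, m0)"
  obtains r h where "strict_mono (r :: nat \<Rightarrow> nat)" "h 0 = energy f (x0, m0)"
    "\<And>t. t \<in> {0..1} \<Longrightarrow> h t \<le> h (0::real)" "h 1 = h 0 \<Longrightarrow> m0 = 0 \<and> 0 \<in> D x0"
    "\<And>u tj t. filterlim u at_top sequentially \<Longrightarrow> (\<And>j. tj j \<in> {0..1}) \<Longrightarrow> tj \<longlonglongrightarrow> t \<Longrightarrow>
      (\<lambda>j. E (index_at (nn (r (u j))) (tj j))) \<longlonglongrightarrow> h t"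
proof -
  define G where "G j t = (x (index_at (nn j) t), m (index_at (nn j) t))" for j t
  have bnd: "norm (G j t) \<le> R + R" for j t
    unfolding G_def by (rule order_trans[OF norm_Pair_le add_mono[OF x_le m_le]])
  have lip: "\<forall>\<^sub>F j in sequentially. \<forall>s\<in>{0..1}. \<forall>t\<in>{0..1}. norm (G j s - G j t) \<le> L * \<bar>s - t\<bar> + \<epsilon>"
    if "\<epsilon> > 0" for \<epsilon>
    using filterlim_iff[THEN iffD1, rule_format, OF nn joint_lipschitz[OF that]] unfolding G_def .
  obtain r Z where r: "strict_mono (r :: nat \<Rightarrow> nat)" and Z_lip: "L-lipschitz_on {0..1} Z"
    and Z_lim: "\<And>u t tj. filterlim u at_top sequentially \<Longrightarrow> (\<And>j. tj j \<in> {0..1}) \<Longrightarrow> tj \<longlonglongrightarrow> t \<Longrightarrow>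
      (\<lambda>j. G (r (u j)) (tj j)) \<longlonglongrightarrow> Z t"
    using asymptotically_lipschitz_limit[of G "R + R" L, OF bnd L_nonneg lip] by blast
  define X where "X t = fst (Z t)" for t
  define M where "M t = snd (Z t)" for t
  have nnr: "filterlim (\<lambda>j. nn (r j)) at_top sequentially"
    by (rule filterlim_compose[OF nn filterlim_subseq[OF r]])
  have Z_lim': "(\<lambda>j. G (r j) t) \<longlonglongrightarrow> Z t" if "t \<in> {0..1}" for t
    by (rule Z_lim[OF filterlim_ident that tendsto_const])
  have X_lim: "(\<lambda>j. x (index_at (nn (r j)) t)) \<longlonglongrightarrow> X t" and M_lim: "(\<lambda>j. m (index_at (nn (r j)) t)) \<longlonglongrightarrow> M t"
    if "t \<in> {0..1}" for t
    using tendsto_fst[OF Z_lim'[OF that]] tendsto_snd[OF Z_lim'[OF that]] by (simp_all add: G_def X_def M_def)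
  have X_lip: "L-lipschitz_on {0..1} X" and M_lip: "L-lipschitz_on {0..1} M"
    unfolding X_def M_def
    by (rule lipschitz_onI[OF order_trans[OF dist_fst_le lipschitz_onD[OF Z_lip]] L_nonneg],
        assumption, assumption,
        rule lipschitz_onI[OF order_trans[OF dist_snd_le lipschitz_onD[OF Z_lip]] L_nonneg])
  have "(\<lambda>j. (x (nn (r j)), m (nn (r j)))) \<longlonglongrightarrow> (x0, m0)"
    using LIMSEQ_subseq_LIMSEQ[OF z0 r] by (simp add: o_def)
  then have "Z 0 = (x0, m0)"
    using LIMSEQ_unique[OF Z_lim'[of 0]] by (simp add: G_def)
  then have X0: "X 0 = x0" and M0: "M 0 = m0" by (simp_all add: X_def M_def)
  note curve = loc_lip cf conv nnr X_lim M_lim X_lip M_lip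
  define h where "h t = energy f (Z t)" for t
  have h_eq: "h t = energy f (X t, M t)" for t
    by (simp add: h_def X_def M_def)
  show thesis
  proof (rule that[OF r])
    show "h 0 = energy f (x0, m0)" by (simp add: h_def \<open>Z 0 = (x0, m0)\<close>)
    show "h t \<le> h 0" if "t \<in> {0..1}" for t
      unfolding h_eq using energy_nonincreasing[OF curve, of 0 t] that by simp
    show "m0 = 0 \<and> 0 \<in> D x0" if "h 1 = h 0"
      using stationary_if_energy_constant[OF curve that[unfolded h_eq]] X0 M0 by simp
    show "(\<lambda>j. E (index_at (nn (r (u j))) (tj j))) \<longlonglongrightarrow> h t"
      if "filterlim u at_top sequentially" "\<And>j. tj j \<in> {0..1}" "tj \<longlonglongrightarrow> t" for u tj t
      using energy_tendsto[OF Z_lim[OF that]] by (simp add: h_def G_def)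
  qed
qed

lemma state_subsequence:
  obtains r z where "strict_mono (r :: nat \<Rightarrow> nat)" "(\<lambda>j. (x (k (r j)), m (k (r j)))) \<longlonglongrightarrow> z"
proof -
  obtain z r where "strict_mono (r :: nat \<Rightarrow> nat)" "((\<lambda>j. (x (k j), m (k j))) \<circ> r) \<longlonglongrightarrow> z"
    using compact_states[unfolded compact_def, rule_format, of "\<lambda>j. (x (k j), m (k j))"] state_in by blast
  then show thesis using that by (simp add: o_def)
qed

lemma state_increments: "(\<lambda>k. (x (Suc k), m (Suc k)) - (x k, m k)) \<longlonglongrightarrow> 0"
proof (rule LIMSEQ_I)
  fix \<epsilon> :: real assume "\<epsilon> > 0"
  then have "\<epsilon> / 2 > 0" "min 1 (\<epsilon> / 2 / (L + 1)) > 0" using L_nonneg by auto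
  from joint_window[OF this(1)] eventually_\<eta>_small[OF this(2)]
  have "\<forall>\<^sub>F k in sequentially. norm ((x (Suc k), m (Suc k)) - (x k, m k) - 0) < \<epsilon>"
  proof eventually_elim
    case (elim k)
    have \<eta>k: "\<eta> k < 1" "\<eta> k < \<epsilon> / 2 / (L + 1)" using elim(2) by (auto dest: spec[of _ k])
    have Wk: "elapsed k (Suc k) = \<eta> k" by (simp add: elapsed_def)
    have "norm ((x (Suc k), m (Suc k)) - (x k, m k)) \<le> L * \<eta> k + \<epsilon> / 2"
      using elim(1)[rule_format, of k "Suc k"] \<eta>k(1) unfolding Wk by simp
    moreover have "L * \<eta> k < \<epsilon> / 2"
    proof -
      have "L * \<eta> k < (L + 1) * \<eta> k" using \<eta>_pos[of k] by (intro mult_strict_right_mono) auto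
      also have "\<dots> < \<epsilon> / 2" using \<eta>k(2) L_nonneg by (simp add: field_simps)
      finally show ?thesis .
    qed
    ultimately show ?case by simp
  qed
  then show "\<exists>no. \<forall>k\<ge>no. norm ((x (Suc k), m (Suc k)) - (x k, m k) - 0) < \<epsilon>"
    by (simp add: eventually_sequentially)
qed

lemma energy_increments: "(\<lambda>k. E (Suc k) - E k) \<longlonglongrightarrow> 0"
proof -
  have "uniformly_continuous_on states (energy f)"
    by (rule compact_uniformly_continuous[OF energy_continuous compact_states])
  moreover have "(\<lambda>k. dist (x (Suc k), m (Suc k)) (x k, m k)) \<longlonglongrightarrow> 0"
    using tendsto_norm_zero[OF state_increments] by (simp only: dist_norm)
  ultimately have "(\<lambda>k. dist (E (Suc k)) (E k)) \<longlonglongrightarrow> 0"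
    unfolding uniformly_continuous_on_sequentially using state_in
    by (elim allE[of _ "\<lambda>k. (x (Suc k), m (Suc k))"] allE[of _ "\<lambda>k. (x k, m k)"]) blast
  then show ?thesis unfolding dist_real_def by (rule tendsto_rabs_zero_cancel)
qed

text \<open>See the upcrossing argument in the introduction. Here \<open>c\<close> is the regular level, \<open>p j\<close> the last exit
  before an upcrossing ends at \<open>q j\<close>, and \<open>k\<close> and \<open>k'\<close> are \<open>p\<close> and \<open>q\<close> along the subsequence for which
  the windows converge.\<close>

lemma energy_convergent:
  assumes critical: "interior {f z |z. 0 \<in> D z} = {}"
  shows "convergent E"
proof (rule ccontr)
  assume diverges: "\<not> convergent E"
  have "range E \<subseteq> energy f ` states" using state_in by blast
  then have bnd: "bounded (range E)"
    by (rule bounded_subset[OF compact_imp_bounded[OF compact_continuous_image[OF energy_continuous compact_states]]])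
  obtain a b where ab: "a < b" and low: "\<exists>\<^sub>F k in sequentially. E k < a"
    and high: "\<exists>\<^sub>F k in sequentially. b < E k"
    by (rule not_convergent_crossing[OF bnd diverges])
  have "\<not> {a<..<b} \<subseteq> {f z |z. 0 \<in> D z}"
    using interior_maximal[of "{a<..<b}" "{f z |z. 0 \<in> D z}"] critical ab by auto
  then obtain c where "c \<in> {a<..<b}" "c \<notin> {f z |z. 0 \<in> D z}" by blast
  then have c: "a < c" "c < b" and regular: "\<And>z. 0 \<in> D z \<Longrightarrow> f z \<noteq> c" by auto
  have "\<exists>p q. j \<le> p \<and> p < q \<and> E p \<le> c \<and> (\<forall>i. p < i \<longrightarrow> i \<le> q \<longrightarrow> c < E i) \<and> b < E q" for j
  proof (rule last_exit_before_upcrossing[OF less_imp_le[OF c(1)] less_imp_le[OF c(2)] low high, of j])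
    fix p q assume "j \<le> p" "p < q" "E p \<le> c" "\<And>i. p < i \<Longrightarrow> i \<le> q \<Longrightarrow> c < E i" "b < E q"
    then show ?thesis by (intro exI[of _ p] exI[of _ q]) simp
  qed
  then obtain p q where p: "\<And>j. j \<le> p j" and pq: "\<And>j. p j < q j" and p_le: "\<And>j. E (p j) \<le> c"
    and above: "\<And>j i. p j < i \<Longrightarrow> i \<le> q j \<Longrightarrow> c < E i" and q: "\<And>j. b < E (q j)" by metis
  have p_top: "filterlim p at_top sequentially"
    by (rule filterlim_at_top_mono[OF filterlim_ident]) (simp add: p)
  have E_p: "(\<lambda>j. E (p j)) \<longlonglongrightarrow> c"
  proof (rule tendsto_sandwich[OF _ _ _ tendsto_const])
    show "(\<lambda>j. c - (E (Suc (p j)) - E (p j))) \<longlonglongrightarrow> c"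
      using tendsto_diff[OF tendsto_const filterlim_compose[OF energy_increments p_top], of c] by simp
    have "c < E (Suc (p j))" for j using above[of j "Suc (p j)"] pq[of j] by simp
    then show "\<forall>\<^sub>F j in sequentially. c - (E (Suc (p j)) - E (p j)) \<le> E (p j)"
      by (simp add: less_imp_le)
  qed (simp add: p_le)
  obtain s z0 where s: "strict_mono (s :: nat \<Rightarrow> nat)" and z0: "(\<lambda>j. (x (p (s j)), m (p (s j)))) \<longlonglongrightarrow> z0"
    by (rule state_subsequence)
  obtain x0 m0 where z0_eq: "z0 = (x0, m0)" by (cases z0)
  have ps_top: "filterlim (\<lambda>j. p (s j)) at_top sequentially"
    by (rule filterlim_compose[OF p_top filterlim_subseq[OF s]])
  have E_z0: "energy f (x0, m0) = c"
    using LIMSEQ_unique[OF energy_tendsto[OF z0] filterlim_compose[OF E_p filterlim_subseq[OF s]]] z0_eq by simp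
  from limit_energy[OF ps_top z0[unfolded z0_eq]] obtain r h where r: "strict_mono (r :: nat \<Rightarrow> nat)"
    and h0: "h 0 = energy f (x0, m0)" and h_le: "\<And>t. t \<in> {0..1} \<Longrightarrow> h t \<le> h (0::real)"
    and stat: "h 1 = h 0 \<Longrightarrow> m0 = 0 \<and> 0 \<in> D x0"
    and h_lim: "\<And>u tj t. filterlim u at_top sequentially \<Longrightarrow> (\<And>j. tj j \<in> {0..1}) \<Longrightarrow> tj \<longlonglongrightarrow> t \<Longrightarrow>
      (\<lambda>j. E (index_at (p (s (r (u j)))) (tj j))) \<longlonglongrightarrow> h t"
    by blast
  have "h 1 \<noteq> h 0"
  proof
    assume "h 1 = h 0"
    then have "m0 = 0" "0 \<in> D x0" using stat by auto
    moreover have "f x0 = c" using E_z0 \<open>m0 = 0\<close> by (simp add: energy_def)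
    ultimately show False using regular by blast
  qed
  then have h1: "h 1 < c" using h_le[of 1] h0 E_z0 by simp
  define k where "k j = p (s (r j))" for j
  define k' where "k' j = q (s (r j))" for j
  have E_k: "(\<lambda>j. E (k j)) \<longlonglongrightarrow> c"
    unfolding k_def
    by (rule filterlim_compose[OF E_p filterlim_compose[OF filterlim_subseq[OF s] filterlim_subseq[OF r]]])
  have E_end: "(\<lambda>j. E (index_at (k j) 1)) \<longlonglongrightarrow> h 1"
    unfolding k_def by (rule h_lim[OF filterlim_ident _ tendsto_const]) simp
  define v where "v = (h 1 + c) / 2"
  have v: "h 1 < v" "v < c" using h1 by (auto simp: v_def)
  have inside: "\<forall>\<^sub>F j in sequentially. k' j < index_at (k j) 1"
    using order_tendstoD(2)[OF E_end v(1)] order_tendstoD(1)[OF E_k v(2)]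
  proof eventually_elim
    case (elim j)
    show ?case
    proof (rule ccontr)
      assume "\<not> k' j < index_at (k j) 1"
      then have le: "index_at (k j) 1 \<le> k' j" by simp
      have "k j \<noteq> index_at (k j) 1" using elim by auto
      then have "k j < index_at (k j) 1" using index_at_ge[of "k j" 1] by simp
      then have "c < E (index_at (k j) 1)" using above le unfolding k_def k'_def by blast
      with elim v show False by simp
    qed
  qed
  \<comment> \<open>The time at which the upcrossing ends; the minimum only matters for finitely many \<open>j\<close>, by \<open>inside\<close>.\<close>
  define \<rho> where "\<rho> j = min 1 (elapsed (k j) (k' j))" for j
  have \<rho>01: "\<rho> j \<in> {0..1}" for j using elapsed_nonneg[of "k j" "k' j"] by (simp add: \<rho>_def)
  have kk': "k j \<le> k' j" for j using pq[of "s (r j)"] by (simp add: k_def k'_def)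
  have hit: "\<forall>\<^sub>F j in sequentially. index_at (k j) (\<rho> j) = k' j"
    using inside
  proof eventually_elim
    case (elim j)
    have "elapsed (k j) (k' j) \<le> elapsed (k j) (index_at (k j) 1)" using elim by (intro elapsed_mono kk') simp
    also have "\<dots> \<le> 1" by (rule index_at_below) simp
    finally show ?case using index_at_elapsed[OF kk'] by (simp add: \<rho>_def)
  qed
  have "\<forall>j. \<rho> j \<in> {0..1}" using \<rho>01 by blast
  then obtain t u where u: "strict_mono (u :: nat \<Rightarrow> nat)" and t: "t \<in> {0..1}" "(\<rho> \<circ> u) \<longlonglongrightarrow> t"
    using compact_Icc[of 0 "1::real"] unfolding compact_def by metis
  have "(\<lambda>j. E (index_at (k (u j)) ((\<rho> \<circ> u) j))) \<longlonglongrightarrow> h t"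
    unfolding k_def using \<rho>01 by (intro h_lim filterlim_subseq[OF u] t(2)) simp
  moreover have "\<forall>\<^sub>F j in sequentially. b \<le> E (index_at (k (u j)) ((\<rho> \<circ> u) j))"
    using eventually_subseq[OF u hit]
  proof eventually_elim
    case (elim j)
    then show ?case using q[of "s (r (u j))"] by (simp add: k'_def less_imp_le)
  qed
  ultimately have "b \<le> h t" by (rule tendsto_lowerbound) simp
  with h_le[OF t(1)] h0 E_z0 c show False by simp
qed

text \<open>Since the energies converge to \<open>E0\<close>, every limit curve has constant energy \<open>E0\<close>, and
  \<open>stationary_if_energy_constant\<close> applies to every cluster point of the pairs of iterates and momenta.\<close>

lemma path_conclusions:
  assumes critical: "interior {f z |z. 0 \<in> D z} = {}"
  shows "(\<forall>xstar. (\<exists>r. strict_mono r \<and> (\<lambda>k. x (r k)) \<longlonglongrightarrow> xstar) \<longrightarrow> 0 \<in> D xstar) \<and>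
      m \<longlonglongrightarrow> 0 \<and> convergent (\<lambda>k. f (x k))"
proof -
  obtain E0 where E0: "E \<longlonglongrightarrow> E0" using energy_convergent[OF critical] by (auto simp: convergent_def)
  have stationary: "m0 = 0 \<and> 0 \<in> D x0"
    if nn: "filterlim nn at_top sequentially" and z0: "(\<lambda>j. (x (nn j), m (nn j))) \<longlonglongrightarrow> (x0, m0)" for nn x0 m0
  proof -
    from limit_energy[OF nn z0] obtain r h where r: "strict_mono (r :: nat \<Rightarrow> nat)"
      and h0: "h 0 = energy f (x0, m0)" and h_le: "\<And>t. t \<in> {0..1} \<Longrightarrow> h t \<le> h (0::real)"
      and stat: "h 1 = h 0 \<Longrightarrow> m0 = 0 \<and> 0 \<in> D x0"
      and h_lim: "\<And>u tj t. filterlim u at_top sequentially \<Longrightarrow> (\<And>j. tj j \<in> {0..1}) \<Longrightarrow> tj \<longlonglongrightarrow> t \<Longrightarrow>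
      (\<lambda>j. E (index_at (nn (r (u j))) (tj j))) \<longlonglongrightarrow> h t"
      by blast
    have "h t = E0" if "t \<in> {0..1}" for t
    proof (rule LIMSEQ_unique)
      show "(\<lambda>j. E (index_at (nn (r j)) t)) \<longlonglongrightarrow> h t"
        by (rule h_lim[OF filterlim_ident that tendsto_const])
      have "filterlim (\<lambda>j. index_at (nn (r j)) t) at_top sequentially"
        by (rule filterlim_at_top_mono[OF filterlim_compose[OF nn filterlim_subseq[OF r]]]) (simp add: index_at_ge)
      then show "(\<lambda>j. E (index_at (nn (r j)) t)) \<longlonglongrightarrow> E0" by (rule filterlim_compose[OF E0])
    qed
    then show ?thesis by (intro stat) simp
  qed
  have cluster: "0 \<in> D xstar" if r: "strict_mono r" "(\<lambda>k. x (r k)) \<longlonglongrightarrow> xstar" for r xstar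
  proof -
    obtain s z where s: "strict_mono (s :: nat \<Rightarrow> nat)" "(\<lambda>j. (x (r (s j)), m (r (s j)))) \<longlonglongrightarrow> z"
      by (rule state_subsequence)
    have "fst z = xstar"
      using LIMSEQ_unique[OF tendsto_fst[OF s(2)]] LIMSEQ_subseq_LIMSEQ[OF r(2) s(1)] by (simp add: o_def)
    then have "(\<lambda>j. (x (r (s j)), m (r (s j)))) \<longlonglongrightarrow> (xstar, snd z)" using s(2) by (cases z) simp
    from stationary[OF _ this] filterlim_compose[OF filterlim_subseq[OF r(1)] filterlim_subseq[OF s(1)]]
    show ?thesis by blast
  qed
  have m_lim: "m \<longlonglongrightarrow> 0"
  proof (rule ccontr)
    assume "\<not> m \<longlonglongrightarrow> 0"
    then obtain \<epsilon> where \<epsilon>: "\<epsilon> > 0" "\<exists>\<^sub>F k in sequentially. \<not> dist (m k) 0 < \<epsilon>"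
      unfolding tendsto_iff frequently_def by auto
    then have "\<exists>k. j \<le> k \<and> \<not> dist (m k) 0 < \<epsilon>" for j unfolding frequently_sequentially by blast
    then obtain k where "\<And>j. j \<le> k j \<and> \<not> dist (m (k j)) 0 < \<epsilon>" by metis
    then have k: "\<And>j. j \<le> k j" "\<And>j. \<epsilon> \<le> norm (m (k j))" by (simp_all add: not_less)
    have k_top: "filterlim k at_top sequentially"
      by (rule filterlim_at_top_mono[OF filterlim_ident]) (simp add: k)
    obtain s z where s: "strict_mono (s :: nat \<Rightarrow> nat)" "(\<lambda>j. (x (k (s j)), m (k (s j)))) \<longlonglongrightarrow> z"
      by (rule state_subsequence)
    have "(\<lambda>j. (x (k (s j)), m (k (s j)))) \<longlonglongrightarrow> (fst z, snd z)" using s(2) by simp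
    from stationary[OF filterlim_compose[OF k_top filterlim_subseq[OF s(1)]] this]
    have "snd z = 0" by blast
    moreover have "\<epsilon> \<le> norm (snd z)"
      using tendsto_lowerbound[OF tendsto_norm[OF tendsto_snd[OF s(2)]], of \<epsilon>] k(2) by simp
    ultimately show False using \<epsilon>(1) by simp
  qed
  have "(\<lambda>k. E k - (norm (m k))\<^sup>2 / (2 * \<tau>)) \<longlonglongrightarrow> E0 - (norm (0::real^'n))\<^sup>2 / (2 * \<tau>)"
    using \<tau>(1) by (intro tendsto_intros E0 m_lim) auto
  then have "convergent (\<lambda>k. f (x k))" unfolding energy_def convergent_def by auto
  with cluster m_lim show ?thesis by blast
qed

end

end

section \<open>Almost sure convergence\<close>

lemma noise_windows:
  fixes \<xi> :: "nat \<Rightarrow> 'w \<Rightarrow> real^'n"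
  assumes "prob_space M" "\<And>k. \<xi> k \<in> borel_measurable M" "martingale_difference M \<xi>"
    and pos: "\<And>k. \<eta> k > 0"
    and "((\<exists>C. AE \<omega> in M. \<forall>k. norm (\<xi> k \<omega>) \<le> C) \<and> \<eta> \<in> o(\<lambda>k. 1 / ln (real k))) \<or>
       ((\<exists>\<sigma>. \<forall>k. AE \<omega> in M.
           nn_cond_exp M (natural_filtration M \<xi> k) (\<lambda>\<omega>. ennreal ((norm (\<xi> (Suc k) \<omega>))\<^sup>2)) \<omega>
             \<le> ennreal (\<sigma>\<^sup>2)) \<and>
        summable (\<lambda>k. (\<eta> k)\<^sup>2))"
  shows "\<eta> \<longlonglongrightarrow> 0"
    and "AE \<omega> in M. window_small \<eta> (\<lambda>k. \<xi> k \<omega>) \<and> window_bounded \<eta> (\<lambda>k. \<xi> k \<omega>)"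
proof -
  have "\<eta> \<longlonglongrightarrow> 0 \<and> (AE \<omega> in M. window_small \<eta> (\<lambda>k. \<xi> k \<omega>) \<and> window_bounded \<eta> (\<lambda>k. \<xi> k \<omega>))"
    using assms(5)
  proof (elim disjE conjE exE)
    fix C assume C: "AE \<omega> in M. \<forall>k. norm (\<xi> k \<omega>) \<le> C" and "\<eta> \<in> o(\<lambda>k. 1 / ln (real k))"
    then have "(\<lambda>k. \<eta> k / (1 / ln (real k))) \<longlonglongrightarrow> 0" by (intro smalloD_tendsto)
    then have small: "(\<lambda>k. \<eta> k * ln (real k)) \<longlonglongrightarrow> 0" by simp
    have "\<eta> \<longlonglongrightarrow> 0"
    proof (rule tendsto_sandwich[OF _ _ tendsto_const small])
      show "\<forall>\<^sub>F k in sequentially. 0 \<le> \<eta> k" using pos by (simp add: less_imp_le)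
      show "\<forall>\<^sub>F k in sequentially. \<eta> k \<le> \<eta> k * ln (real k)"
        using eventually_ge_at_top[of 3]
      proof eventually_elim
        case (elim k)
        have "exp 1 \<le> real k" using exp_le elim by linarith
        then have "1 \<le> ln (real k)" using elim by (subst ln_ge_iff) auto
        then show ?case using pos[of k] mult_left_mono[of 1 "ln (real k)" "\<eta> k"] by simp
      qed
    qed
    with bounded_noise_windows[OF assms(1-3) pos small C] show ?thesis by blast
  next
    fix \<sigma> assume m2: "\<forall>k. AE \<omega> in M. nn_cond_exp M (natural_filtration M \<xi> k)
        (\<lambda>\<omega>. ennreal ((norm (\<xi> (Suc k) \<omega>))\<^sup>2)) \<omega> \<le> ennreal (\<sigma>\<^sup>2)"
      and sq: "summable (\<lambda>k. (\<eta> k)\<^sup>2)"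
    have "(\<lambda>k. sqrt ((\<eta> k)\<^sup>2)) \<longlonglongrightarrow> sqrt 0"
      by (intro tendsto_real_sqrt summable_LIMSEQ_zero sq)
    then have "\<eta> \<longlonglongrightarrow> 0" using pos by (simp add: less_imp_le)
    with square_integrable_noise_windows[OF assms(1-3) pos sq m2[rule_format]] show ?thesis by blast
  qed
  then show "\<eta> \<longlonglongrightarrow> 0"
    and "AE \<omega> in M. window_small \<eta> (\<lambda>k. \<xi> k \<omega>) \<and> window_bounded \<eta> (\<lambda>k. \<xi> k \<omega>)" by blast+
qed

theorem theorem4p2:
  fixes M :: "'w measure"
    and f :: "real^'n \<Rightarrow> real"
    and D :: "real^'n \<Rightarrow> (real^'n) set"
    and \<phi> :: "real^'n \<Rightarrow> real"
    and P :: "real^'n \<Rightarrow> real^'n^'n"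
    and \<eta> \<theta> \<delta> \<nu> :: "nat \<Rightarrow> real"
    and x m d g \<xi> :: "nat \<Rightarrow> 'w \<Rightarrow> real^'n"
  assumes "prob_space M"
    and "locally_lipschitz f"
    and "\<And>k. \<eta> k > 0" "\<And>k. \<theta> k > 0" "\<And>k. \<delta> k \<ge> 0" "\<And>k. \<nu> k \<ge> 0"
    and random_variables:
      "\<And>k. x k \<in> borel_measurable M" "\<And>k. m k \<in> borel_measurable M"
      "\<And>k. d k \<in> borel_measurable M" "\<And>k. \<xi> k \<in> borel_measurable M"
    and x_step: "\<And>k \<omega>. \<omega> \<in> space M \<Longrightarrow>
      nu_optimal (\<nu> k)
        (\<lambda>z. m k \<omega> \<bullet> (z - x k \<omega>) + 1 / \<eta> k * bregman \<phi> z (x k \<omega>)) (x (Suc k) \<omega>)"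
    and m_step: "\<And>k \<omega>. \<omega> \<in> space M \<Longrightarrow>
      m (Suc k) \<omega> = m k \<omega> - \<theta> k *\<^sub>R (P (x k \<omega>) *v (m k \<omega> - g k \<omega>))"
    and g_eq: "\<And>k \<omega>. \<omega> \<in> space M \<Longrightarrow> g k \<omega> = d k \<omega> + \<xi> k \<omega>"
    and d_in: "\<And>k \<omega>. \<omega> \<in> space M \<Longrightarrow> d k \<omega> \<in> expansion D (\<delta> k) (x k \<omega>)"
    and kernel: "C2_fun \<phi>" "legendre_kernel \<phi>" "supercoercive \<phi>"
      "\<And>z. positive_definite (hessian \<phi> z)" "\<And>z. P z = matrix_inv (hessian \<phi> z)"
    and bounded_iterates:
      "AE \<omega> in M. bounded (range (\<lambda>k. x k \<omega>))"
      "AE \<omega> in M. bounded (range (\<lambda>k. grad \<phi> (x k \<omega>)))"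
      "AE \<omega> in M. bounded (range (\<lambda>k. d k \<omega>))"
      "AE \<omega> in M. bounded (range (\<lambda>k. m k \<omega>))"
    and noise: "martingale_difference M \<xi>"
    and sum_eta: "filterlim (\<lambda>n. \<Sum>k<n. \<eta> k) at_top sequentially"
    and noise_step:
      "((\<exists>C. AE \<omega> in M. \<forall>k. norm (\<xi> k \<omega>) \<le> C) \<and> \<eta> \<in> o(\<lambda>k. 1 / ln (real k))) \<or>
       ((\<exists>\<sigma>. \<forall>k. AE \<omega> in M.
           nn_cond_exp M (natural_filtration M \<xi> k) (\<lambda>\<omega>. ennreal ((norm (\<xi> (Suc k) \<omega>))\<^sup>2)) \<omega>
             \<le> ennreal (\<sigma>\<^sup>2)) \<and>
        summable (\<lambda>k. (\<eta> k)\<^sup>2))"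
    and "\<delta> \<longlonglongrightarrow> 0" "\<nu> \<longlonglongrightarrow> 0"
    and "\<exists>\<tau>>0. (\<lambda>k. \<theta> k / \<eta> k) \<longlonglongrightarrow> \<tau>"
    and "bdd_below (range f)"
    and "conservative_field f D" "\<And>z. convex (D z)"
    and "interior {f z |z. 0 \<in> D z} = {}"
  shows "AE \<omega> in M.
      (\<forall>xstar. (\<exists>r. strict_mono r \<and> (\<lambda>k. x (r k) \<omega>) \<longlonglongrightarrow> xstar) \<longrightarrow> 0 \<in> D xstar) \<and>
      (\<lambda>k. m k \<omega>) \<longlonglongrightarrow> 0 \<and>
      convergent (\<lambda>k. f (x k \<omega>))"
proof -

  obtain \<tau> where \<tau>: "\<tau> > 0" "(\<lambda>k. \<theta> k / \<eta> k) \<longlonglongrightarrow> \<tau>"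
    using \<open>\<exists>\<tau>>0. (\<lambda>k. \<theta> k / \<eta> k) \<longlonglongrightarrow> \<tau>\<close> by blast
  have \<eta>_pos: "\<And>k. \<eta> k > 0" and \<theta>_pos: "\<And>k. \<theta> k > 0" by fact+
  have convex_kernel: "strictly_convex \<phi>" "C1_fun \<phi>"
    using kernel(2) by (auto simp: legendre_kernel_def)
  note windows = noise_windows[OF \<open>prob_space M\<close> random_variables(4) noise \<eta>_pos noise_step]
  obtain U where U: "\<And>k. \<theta> k \<le> U * \<eta> k"
  proof -
    obtain U where bound: "\<And>k. norm (\<theta> k / \<eta> k) \<le> U"
      using convergent_imp_Bseq[OF convergentI[OF \<tau>(2)]] unfolding Bseq_def by blast
    have "\<theta> k / \<eta> k \<le> U" for k
      by (rule order_trans[OF abs_ge_self bound[unfolded real_norm_def]])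
    then show thesis using \<eta>_pos by (intro that[of U]) (simp add: field_simps)
  qed
  obtain V where V: "\<And>k. \<nu> k \<le> V"
  proof -
    obtain V where bound: "\<And>k. norm (\<nu> k) \<le> V"
      using convergent_imp_Bseq[OF convergentI[OF \<open>\<nu> \<longlonglongrightarrow> 0\<close>]] unfolding Bseq_def by blast
    show thesis by (rule that[of V]) (rule order_trans[OF abs_ge_self bound[unfolded real_norm_def]])
  qed
  \<comment> \<open>From here on a single path is considered; the constants depend on it.\<close>
  from AE_space windows(2) bounded_iterates(1,3,4) show ?thesis
  proof eventually_elim
    case (elim \<omega>)
    obtain R1 R2 R3 where R: "\<And>k. norm (x k \<omega>) \<le> R1" "\<And>k. norm (d k \<omega>) \<le> R2" "\<And>k. norm (m k \<omega>) \<le> R3"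
      using elim(3-5) unfolding bounded_iff by blast
    define R where "R = max R1 (max R2 R3)"
    obtain \<mu> where \<mu>: "\<mu> > 0" "\<And>z h. z \<in> cball 0 R \<Longrightarrow> \<mu> * (norm h)\<^sup>2 \<le> h \<bullet> (hessian \<phi> z *v h)"
      using hessian_elliptic_on_compact[OF kernel(1,4) compact_cball[of 0 R]] by blast
    obtain C where C: "C \<ge> 0" "\<And>\<epsilon>. \<epsilon> > 0 \<Longrightarrow> \<forall>\<^sub>F n in sequentially. \<forall>l\<ge>n. (\<Sum>k=n..<l. \<eta> k) \<le> 1 \<longrightarrow>
       (\<Sum>k=n..<l. \<eta> k * norm (\<xi> k \<omega>)) \<le> C * (\<Sum>k=n..<l. \<eta> k) + \<epsilon>"
      using elim(2) unfolding window_bounded_def by blast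
    interpret momentum_recursion \<eta> \<phi> D \<theta> \<delta> \<nu> "\<lambda>k. x k \<omega>" "\<lambda>k. m k \<omega>" "\<lambda>k. d k \<omega>" "\<lambda>k. \<xi> k \<omega>" \<tau> R \<mu> U V C
    proof
      show "norm (m k \<omega> + (1 / \<eta> k) *\<^sub>R (grad \<phi> (x (Suc k) \<omega>) - grad \<phi> (x k \<omega>))) \<le> \<nu> k" for k
        using x_step[OF elim(1), of k] nu_optimal_bregman_iff[OF convex_kernel \<eta>_pos] by blast
      show "m (Suc k) \<omega> = m k \<omega> - \<theta> k *\<^sub>R (matrix_inv (hessian \<phi> (x k \<omega>)) *v (m k \<omega> - (d k \<omega> + \<xi> k \<omega>)))" for k
        using m_step[OF elim(1), of k] unfolding g_eq[OF elim(1)] kernel(5) .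
      show "d k \<omega> \<in> expansion D (\<delta> k) (x k \<omega>)" for k by (rule d_in[OF elim(1)])
      show "norm (x k \<omega>) \<le> R" "norm (m k \<omega>) \<le> R" "norm (d k \<omega>) \<le> R" for k
        using R(1)[of k] R(2)[of k] R(3)[of k] by (simp_all add: R_def)
      show "window_small \<eta> (\<lambda>k. \<xi> k \<omega>)" using elim(2) by blast
    qed (fact | rule windows(1) kernel(1,4) \<tau> U V \<mu> C | assumption)+
    show ?case
      by (rule path_conclusions[OF \<open>locally_lipschitz f\<close> \<open>conservative_field f D\<close> \<open>\<And>z. convex (D z)\<close>
            \<open>interior {f z |z. 0 \<in> D z} = {}\<close>])
  qed
qed

end
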